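(* Let $A$ be a commutative noetherian ring, let $\mathfrak a$ be an ideal of $A$, let ${\bf x}=x_1,\dots,x_t$ be a sequence of elements of $\mathfrak a$, and let $M$ be an $A$-module such that $H^i({\bf x},M)\in\mathcal{M}^0(A,\mathfrak a)_{\rm cof}$ for all integers $i$. Then $M\in\mathcal{M}^0(A,\mathfrak a)_{\rm cof}$.
   Context: $\mathcal{M}^0(A,\mathfrak a)_{\rm cof}$ is the full subcategory of $\operatorname{Mod} A$ of modules $N$ such that $\operatorname{Ext}^i_A(A/\mathfrak a,N)$ is finitely generated for all $i\ge 0$. $K_{\bullet}({\bf x})$ is the Koszul complex of ${\bf x}$ over $A$, $K^{\bullet}({\bf x},M)=\operatorname{Hom}_A(K_{\bullet}({\bf x}),M)$, and $H^i({\bf x},M)$ is its $i$-th cohomology module. *)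

theory Defs
  imports "HOL-Algebra.Module" "HOL-Algebra.Ring_Divisibility"
begin

text \<open>
  Modules are the records of \<^theory>\<open>HOL-Algebra.Module\<close>. That record type extends rings, so every
  module carries unused fields \<open>mult\<close> and \<open>one\<close>; they are left unspecified below.
\<close>

section \<open>Basic module constructions\<close>

definition self_module :: "('a, 'r) ring_scheme \<Rightarrow> ('a, 'a) module" where
  "self_module R =
     \<lparr>carrier = carrier R, mult = undefined, one = undefined,
      zero = \<zero>\<^bsub>R\<^esub>, add = (\<oplus>\<^bsub>R\<^esub>), smult = (\<otimes>\<^bsub>R\<^esub>)\<rparr>"

definition quotient_module :: "('a, 'b, 'm) module_scheme \<Rightarrow> 'b set \<Rightarrow> ('a, 'b set) module" where
  "quotient_module M K =
     \<lparr>carrier = a_rcosets\<^bsub>M\<^esub> K, mult = undefined, one = undefined,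
      zero = K, add = set_add M,
      smult = (\<lambda>r X. \<Union>x\<in>X. K +>\<^bsub>M\<^esub> (r \<odot>\<^bsub>M\<^esub> x))\<rparr>"

lemma quotient_smult:
  assumes M: "module R M" and K: "submodule K R M" and r: "r \<in> carrier R" and x: "x \<in> carrier M"
  shows "r \<odot>\<^bsub>quotient_module M K\<^esub> (K +>\<^bsub>M\<^esub> x) = K +>\<^bsub>M\<^esub> (r \<odot>\<^bsub>M\<^esub> x)"
proof -
  interpret module R M by fact
  interpret A: abelian_subgroup K M
    using K by (intro abelian_subgroupI3 additive_subgroup.intro abelian_group_axioms) (simp add: submodule_def)
  have Ks: "K \<subseteq> carrier M" by (rule A.a_subset)
  have eq: "K +>\<^bsub>M\<^esub> (r \<odot>\<^bsub>M\<^esub> y) = K +>\<^bsub>M\<^esub> (r \<odot>\<^bsub>M\<^esub> x)" if "y \<in> K +>\<^bsub>M\<^esub> x" for y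
  proof -
    from that obtain k where k: "k \<in> K" "y = k \<oplus>\<^bsub>M\<^esub> x" by (auto simp: a_r_coset_def')
    have "r \<odot>\<^bsub>M\<^esub> y = r \<odot>\<^bsub>M\<^esub> k \<oplus>\<^bsub>M\<^esub> r \<odot>\<^bsub>M\<^esub> x" using k r x Ks by (auto simp: smult_r_distr)
    moreover have "r \<odot>\<^bsub>M\<^esub> k \<in> K" using submoduleE(4)[OF K r k(1)] .
    ultimately have "r \<odot>\<^bsub>M\<^esub> y \<in> K +>\<^bsub>M\<^esub> (r \<odot>\<^bsub>M\<^esub> x)" by (auto simp: a_r_coset_def')
    then show ?thesis using a_repr_independence[OF _ smult_closed[OF r x] A.a_subgroup] by simp
  qed
  have "x \<in> K +>\<^bsub>M\<^esub> x" by (rule A.a_rcos_self[OF x])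
  then have "(\<Union>y\<in>K +>\<^bsub>M\<^esub> x. K +>\<^bsub>M\<^esub> (r \<odot>\<^bsub>M\<^esub> y)) = K +>\<^bsub>M\<^esub> (r \<odot>\<^bsub>M\<^esub> x)" using eq by blast
  then show ?thesis by (simp add: quotient_module_def)
qed

lemma quotient_module_module:
  assumes M: "module R M" and K: "submodule K R M"
  shows "module R (quotient_module M K)"
proof -
  interpret module R M by fact
  interpret A: abelian_subgroup K M
    using K by (intro abelian_subgroupI3 additive_subgroup.intro abelian_group_axioms) (simp add: submodule_def)
  have c: "X \<in> carrier (quotient_module M K) \<longleftrightarrow> (\<exists>x\<in>carrier M. X = K +>\<^bsub>M\<^esub> x)" for X
    by (auto simp: quotient_module_def A_RCOSETS_def RCOSETS_def a_r_coset_def)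
  have add: "(K +>\<^bsub>M\<^esub> x) \<oplus>\<^bsub>quotient_module M K\<^esub> (K +>\<^bsub>M\<^esub> y) = K +>\<^bsub>M\<^esub> (x \<oplus>\<^bsub>M\<^esub> y)"
    if "x \<in> carrier M" "y \<in> carrier M" for x y
    using A.a_rcos_sum that by (simp add: quotient_module_def)
  have cI: "K +>\<^bsub>M\<^esub> x \<in> carrier (quotient_module M K)" if "x \<in> carrier M" for x unfolding c by (rule bexI, rule refl, rule that)
  have cE: "thesis" if "X \<in> carrier (quotient_module M K)" "\<And>x. x \<in> carrier M \<Longrightarrow> X = K +>\<^bsub>M\<^esub> x \<Longrightarrow> thesis" for X thesis
    using that(1) unfolding c by (elim bexE) (rule that(2))
  have z: "\<zero>\<^bsub>quotient_module M K\<^esub> = K +>\<^bsub>M\<^esub> \<zero>\<^bsub>M\<^esub>"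
    using A.a_subset by (simp add: quotient_module_def a_coset_add_zero)
  have 1: "abelian_group (quotient_module M K)"
  proof (rule abelian_groupI)
    fix X assume "X \<in> carrier (quotient_module M K)"
    then obtain x where x: "x \<in> carrier M" "X = K +>\<^bsub>M\<^esub> x" by (rule cE)
    then have "(K +>\<^bsub>M\<^esub> (\<ominus>\<^bsub>M\<^esub> x)) \<oplus>\<^bsub>quotient_module M K\<^esub> X = \<zero>\<^bsub>quotient_module M K\<^esub>"
      by (simp add: add z M.l_neg)
    then show "\<exists>Y\<in>carrier (quotient_module M K). Y \<oplus>\<^bsub>quotient_module M K\<^esub> X = \<zero>\<^bsub>quotient_module M K\<^esub>"
      using cI[OF M.a_inv_closed[OF x(1)]] by (rule bexI)
  next
    show "\<zero>\<^bsub>quotient_module M K\<^esub> \<in> carrier (quotient_module M K)" unfolding z by (rule cI) simp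
  next
    fix X Y assume "X \<in> carrier (quotient_module M K)" "Y \<in> carrier (quotient_module M K)"
    then show "X \<oplus>\<^bsub>quotient_module M K\<^esub> Y \<in> carrier (quotient_module M K)" by (auto elim!: cE intro!: cI simp: add)
  qed (auto elim!: cE simp: add z M.a_ac)
  show ?thesis
  proof (rule moduleI[OF R.is_cring 1])
    show "r \<odot>\<^bsub>quotient_module M K\<^esub> X \<in> carrier (quotient_module M K)"
      if "r \<in> carrier R" "X \<in> carrier (quotient_module M K)" for r X
      using that by (auto elim!: cE intro!: cI simp: quotient_smult[OF M K])
  qed (auto elim!: cE simp: quotient_smult[OF M K] add smult_l_distr smult_r_distr smult_assoc1)
qed

text \<open>Linear maps are taken to be extensional on the carrier, so that equality of homomorphisms is
  equality of functions.\<close>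

definition linear_maps ::
  "('a, 'r) ring_scheme \<Rightarrow> ('a, 'p, 'm) module_scheme \<Rightarrow> ('a, 'n, 'k) module_scheme \<Rightarrow> ('p \<Rightarrow> 'n) set" where
  "linear_maps R P N =
     {f \<in> carrier P \<rightarrow>\<^sub>E carrier N.
        (\<forall>x\<in>carrier P. \<forall>y\<in>carrier P. f (x \<oplus>\<^bsub>P\<^esub> y) = f x \<oplus>\<^bsub>N\<^esub> f y) \<and>
        (\<forall>r\<in>carrier R. \<forall>x\<in>carrier P. f (r \<odot>\<^bsub>P\<^esub> x) = r \<odot>\<^bsub>N\<^esub> f x)}"

definition hom_module ::
  "('a, 'r) ring_scheme \<Rightarrow> ('a, 'p, 'm) module_scheme \<Rightarrow> ('a, 'n, 'k) module_scheme
    \<Rightarrow> ('a, 'p \<Rightarrow> 'n) module" where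
  "hom_module R P N =
     \<lparr>carrier = linear_maps R P N, mult = undefined, one = undefined,
      zero = (\<lambda>x\<in>carrier P. \<zero>\<^bsub>N\<^esub>),
      add = (\<lambda>f g. \<lambda>x\<in>carrier P. f x \<oplus>\<^bsub>N\<^esub> g x),
      smult = (\<lambda>r f. \<lambda>x\<in>carrier P. r \<odot>\<^bsub>N\<^esub> f x)\<rparr>"

definition fin_gen_module :: "('a, 'r) ring_scheme \<Rightarrow> ('a, 'b, 'm) module_scheme \<Rightarrow> bool" where
  "fin_gen_module R N \<longleftrightarrow>
     (\<exists>S \<subseteq> carrier N. finite S \<and>
        (\<forall>y\<in>carrier N. \<exists>c\<in>S \<rightarrow> carrier R. y = (\<Oplus>\<^bsub>N\<^esub>s\<in>S. c s \<odot>\<^bsub>N\<^esub> s)))"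

text \<open>The free module with basis \<open>B\<close>: finitely supported functions vanishing outside \<open>B\<close>.\<close>

definition free_module :: "('a, 'r) ring_scheme \<Rightarrow> 'b set \<Rightarrow> ('a, 'b \<Rightarrow> 'a) module" where
  "free_module R B =
     \<lparr>carrier = {f. (\<forall>b. f b \<in> carrier R) \<and> finite {b. f b \<noteq> \<zero>\<^bsub>R\<^esub>} \<and> (\<forall>b. b \<notin> B \<longrightarrow> f b = \<zero>\<^bsub>R\<^esub>)},
      mult = undefined, one = undefined,
      zero = (\<lambda>_. \<zero>\<^bsub>R\<^esub>), add = (\<lambda>f g b. f b \<oplus>\<^bsub>R\<^esub> g b), smult = (\<lambda>r f b. r \<otimes>\<^bsub>R\<^esub> f b)\<rparr>"

definition basis_elem :: "('a, 'r) ring_scheme \<Rightarrow> 'b \<Rightarrow> 'b \<Rightarrow> 'a" where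
  "basis_elem R b = (\<lambda>c. if c = b then \<one>\<^bsub>R\<^esub> else \<zero>\<^bsub>R\<^esub>)"

text \<open>The linear map from the free module with basis \<open>B\<close> to \<open>N\<close> sending the basis element of
  \<open>b\<close> to \<open>\<phi> b\<close>.\<close>

definition free_lift ::
  "('a, 'r) ring_scheme \<Rightarrow> 'b set \<Rightarrow> ('a, 'n, 'k) module_scheme \<Rightarrow> ('b \<Rightarrow> 'n) \<Rightarrow> ('b \<Rightarrow> 'a) \<Rightarrow> 'n" where
  "free_lift R B N \<phi> =
     (\<lambda>f\<in>carrier (free_module R B). \<Oplus>\<^bsub>N\<^esub>b\<in>{b. f b \<noteq> \<zero>\<^bsub>R\<^esub>}. f b \<odot>\<^bsub>N\<^esub> \<phi> b)"


section \<open>Cohomology\<close>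

text \<open>The differential \<open>\<delta> i\<close> maps \<open>C i\<close> to \<open>C (i + 1)\<close>.\<close>

definition cohomology :: "(int \<Rightarrow> ('a, 'c) module) \<Rightarrow> (int \<Rightarrow> 'c \<Rightarrow> 'c) \<Rightarrow> int \<Rightarrow> ('a, 'c set) module" where
  "cohomology C \<delta> i =
     quotient_module (C i\<lparr>carrier := a_kernel (C i) (C (i + 1)) (\<delta> i)\<rparr>)
       (\<delta> (i - 1) ` carrier (C (i - 1)))"

text \<open>Cohomology of \<open>Hom (F, N)\<close> for a chain complex \<open>F\<close> with \<open>d i\<close> mapping \<open>F i\<close> to
  \<open>F (i - 1)\<close>. No sign is put on the dual differentials.\<close>

definition hom_cohomology ::
  "('a, 'r) ring_scheme \<Rightarrow> (int \<Rightarrow> ('a, 'p) module) \<Rightarrow> (int \<Rightarrow> 'p \<Rightarrow> 'p)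
    \<Rightarrow> ('a, 'n, 'k) module_scheme \<Rightarrow> int \<Rightarrow> ('a, ('p \<Rightarrow> 'n) set) module" where
  "hom_cohomology R F d N =
     cohomology (\<lambda>i. hom_module R (F i) N)
       (\<lambda>i. \<lambda>f\<in>linear_maps R (F i) N. compose (carrier (F (i + 1))) f (d (i + 1)))"


section \<open>The Koszul complex\<close>

text \<open>In degree \<open>p\<close> the Koszul complex of \<open>xs\<close> is free on the \<open>p\<close>-element sets \<open>S\<close> of positions
  of \<open>xs\<close>, where \<open>S = {j\<^sub>1 < \<dots> < j\<^sub>p}\<close> stands for the wedge product of the \<open>e\<close>'s
  with these indices in increasing order; it is zero for \<open>p < 0\<close> and \<open>p > length xs\<close>.\<close>

definition koszul_basis :: "'a list \<Rightarrow> int \<Rightarrow> nat set set" where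
  "koszul_basis xs p = {S. S \<subseteq> {..<length xs} \<and> int (card S) = p}"

definition koszul :: "('a, 'r) ring_scheme \<Rightarrow> 'a list \<Rightarrow> int \<Rightarrow> ('a, nat set \<Rightarrow> 'a) module" where
  "koszul R xs p = free_module R (koszul_basis xs p)"

definition koszul_diff ::
  "('a, 'r) ring_scheme \<Rightarrow> 'a list \<Rightarrow> int \<Rightarrow> (nat set \<Rightarrow> 'a) \<Rightarrow> (nat set \<Rightarrow> 'a)" where
  "koszul_diff R xs p =
     free_lift R (koszul_basis xs p) (koszul R xs (p - 1))
       (\<lambda>S. \<Oplus>\<^bsub>koszul R xs (p - 1)\<^esub>j\<in>S.
          ((\<ominus>\<^bsub>R\<^esub> \<one>\<^bsub>R\<^esub>) [^]\<^bsub>R\<^esub> card {k\<in>S. k < j} \<otimes>\<^bsub>R\<^esub> xs ! j)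
            \<odot>\<^bsub>koszul R xs (p - 1)\<^esub> basis_elem R (S - {j}))"

definition koszul_cohomology ::
  "('a, 'r) ring_scheme \<Rightarrow> 'a list \<Rightarrow> ('a, 'm, 's) module_scheme \<Rightarrow> int
    \<Rightarrow> ('a, ((nat set \<Rightarrow> 'a) \<Rightarrow> 'm) set) module" where
  "koszul_cohomology R xs M = hom_cohomology R (koszul R xs) (koszul_diff R xs) M"


section \<open>A free resolution and Ext\<close>

text \<open>
  Ext is computed from one explicit free resolution of \<open>L\<close>, available over every commutative ring.
  \<open>F\<^sub>0\<close> is free on the elements of \<open>L\<close>, and the basis of \<open>F\<^sub>n\<^sub>+\<^sub>1\<close> consists of all
  formal linear combinations of basis elements of \<open>F\<^sub>n\<close> whose value lies in the kernel of
  \<open>F\<^sub>n \<rightarrow> F\<^sub>n\<^sub>-\<^sub>1\<close> (of \<open>F\<^sub>0 \<rightarrow> L\<close> if \<open>n = 0\<close>); such a basis element is mapped to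
  its value. Formal linear combinations are lists of pairs (coefficient, basis element), so the
  bases of all the \<open>F\<^sub>n\<close> live in a single datatype.
\<close>

datatype ('a, 'l) res_gen = Gen 'l | Syz "('a \<times> ('a, 'l) res_gen) list"

definition list_comb :: "('a, 'b, 'm) module_scheme \<Rightarrow> ('g \<Rightarrow> 'b) \<Rightarrow> ('a \<times> 'g) list \<Rightarrow> 'b" where
  "list_comb N \<phi> ts = foldr (\<lambda>(c, g) y. c \<odot>\<^bsub>N\<^esub> \<phi> g \<oplus>\<^bsub>N\<^esub> y) ts \<zero>\<^bsub>N\<^esub>"

definition gen_augment :: "('a, 'l, 'm) module_scheme \<Rightarrow> ('a, 'l) res_gen \<Rightarrow> 'l" where
  "gen_augment L g = (case g of Gen l \<Rightarrow> l | Syz ts \<Rightarrow> \<zero>\<^bsub>L\<^esub>)"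

definition gen_boundary :: "('a, 'r) ring_scheme \<Rightarrow> ('a, 'l) res_gen \<Rightarrow> ('a, 'l) res_gen \<Rightarrow> 'a" where
  "gen_boundary R g =
     (case g of Gen l \<Rightarrow> (\<lambda>_. \<zero>\<^bsub>R\<^esub>)
              | Syz ts \<Rightarrow> list_comb (free_module R UNIV) (basis_elem R) ts)"

fun res_basis :: "('a, 'r) ring_scheme \<Rightarrow> ('a, 'l, 'm) module_scheme \<Rightarrow> nat \<Rightarrow> ('a, 'l) res_gen set" where
  "res_basis R L 0 = Gen ` carrier L"
| "res_basis R L (Suc n) =
     {Syz ts | ts. set ts \<subseteq> carrier R \<times> res_basis R L n \<and>
        (if n = 0 then list_comb L (gen_augment L) ts = \<zero>\<^bsub>L\<^esub>
         else list_comb (free_module R UNIV) (gen_boundary R) ts = (\<lambda>_. \<zero>\<^bsub>R\<^esub>))}"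

definition res_basis_int ::
  "('a, 'r) ring_scheme \<Rightarrow> ('a, 'l, 'm) module_scheme \<Rightarrow> int \<Rightarrow> ('a, 'l) res_gen set" where
  "res_basis_int R L n = (if n < 0 then {} else res_basis R L (nat n))"

definition res ::
  "('a, 'r) ring_scheme \<Rightarrow> ('a, 'l, 'm) module_scheme \<Rightarrow> int \<Rightarrow> ('a, ('a, 'l) res_gen \<Rightarrow> 'a) module" where
  "res R L n = free_module R (res_basis_int R L n)"

definition res_diff ::
  "('a, 'r) ring_scheme \<Rightarrow> ('a, 'l, 'm) module_scheme \<Rightarrow> int
    \<Rightarrow> (('a, 'l) res_gen \<Rightarrow> 'a) \<Rightarrow> (('a, 'l) res_gen \<Rightarrow> 'a)" where
  "res_diff R L n = free_lift R (res_basis_int R L n) (res R L (n - 1)) (gen_boundary R)"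

definition res_augment ::
  "('a, 'r) ring_scheme \<Rightarrow> ('a, 'l, 'm) module_scheme \<Rightarrow> (('a, 'l) res_gen \<Rightarrow> 'a) \<Rightarrow> 'l" where
  "res_augment R L = free_lift R (res_basis R L 0) L (gen_augment L)"

lemma free_module_module:
  fixes B :: "'b set"
  assumes "cring R" shows "module R (free_module R B)"
proof -
  interpret cring R by fact
  have fin: "finite {b. f b \<oplus>\<^bsub>R\<^esub> g b \<noteq> \<zero>\<^bsub>R\<^esub>}"
    if "finite {b. f b \<noteq> \<zero>\<^bsub>R\<^esub>}" "finite {b. g b \<noteq> \<zero>\<^bsub>R\<^esub>}" for f g :: "'b \<Rightarrow> 'a"
    by (rule finite_subset[of _ "{b. f b \<noteq> \<zero>\<^bsub>R\<^esub>} \<union> {b. g b \<noteq> \<zero>\<^bsub>R\<^esub>}"]) (use that in auto)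
  have fin2: "finite {b. r \<otimes>\<^bsub>R\<^esub> f b \<noteq> \<zero>\<^bsub>R\<^esub>}"
    if "finite {b. f b \<noteq> \<zero>\<^bsub>R\<^esub>}" "r \<in> carrier R" for f :: "'b \<Rightarrow> 'a" and r
    by (rule finite_subset[of _ "{b. f b \<noteq> \<zero>\<^bsub>R\<^esub>}"]) (use that in auto)
  show ?thesis
  proof (intro moduleI abelian_groupI)
    fix x y assume "x \<in> carrier (free_module R B)" "y \<in> carrier (free_module R B)"
    then show "x \<oplus>\<^bsub>free_module R B\<^esub> y \<in> carrier (free_module R B)"
      using fin by (simp add: free_module_def)
  next
    fix r x assume "r \<in> carrier R" "x \<in> carrier (free_module R B)"
    then show "r \<odot>\<^bsub>free_module R B\<^esub> x \<in> carrier (free_module R B)"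
      using fin2 by (simp add: free_module_def)
  next
    fix x assume x: "x \<in> carrier (free_module R B)"
    let ?y = "\<lambda>b. \<ominus>\<^bsub>R\<^esub> x b"
    have "{b. ?y b \<noteq> \<zero>\<^bsub>R\<^esub>} \<subseteq> {b. x b \<noteq> \<zero>\<^bsub>R\<^esub>}" by auto
    then have "?y \<in> carrier (free_module R B)"
      using x finite_subset by (auto simp: free_module_def)
    moreover have "?y \<oplus>\<^bsub>free_module R B\<^esub> x = \<zero>\<^bsub>free_module R B\<^esub>"
      using x by (auto simp: free_module_def l_neg)
    ultimately show "\<exists>y\<in>carrier (free_module R B). y \<oplus>\<^bsub>free_module R B\<^esub> x = \<zero>\<^bsub>free_module R B\<^esub>"
      by blast
  qed (simp_all add: assms free_module_def fun_eq_iff a_ac m_assoc l_distr r_distr)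
qed

lemma basis_elem_in:
  assumes "cring R" "b \<in> B" shows "basis_elem R b \<in> carrier (free_module R B)"
proof -
  interpret cring R by fact
  have "{c. basis_elem R b c \<noteq> \<zero>\<^bsub>R\<^esub>} \<subseteq> {b}" by (auto simp: basis_elem_def)
  then show ?thesis
    using assms finite_subset[of _ "{b}"] by (fastforce simp: free_module_def basis_elem_def)
qed

lemma free_lift_superset:
  assumes "module R N" "\<phi> \<in> B \<rightarrow> carrier N" "f \<in> carrier (free_module R B)"
    "finite T" "T \<subseteq> B" "{b. f b \<noteq> \<zero>\<^bsub>R\<^esub>} \<subseteq> T"
  shows "free_lift R B N \<phi> f = (\<Oplus>\<^bsub>N\<^esub>b\<in>T. f b \<odot>\<^bsub>N\<^esub> \<phi> b)"
proof -
  interpret module R N by fact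
  have "(\<Oplus>\<^bsub>N\<^esub>b\<in>{b. f b \<noteq> \<zero>\<^bsub>R\<^esub>}. f b \<odot>\<^bsub>N\<^esub> \<phi> b) = (\<Oplus>\<^bsub>N\<^esub>b\<in>T. f b \<odot>\<^bsub>N\<^esub> \<phi> b)"
    by (rule M.add.finprod_mono_neutral_cong_left)
       (use assms in \<open>auto simp: free_module_def Pi_iff subset_iff\<close>)
  then show ?thesis using assms by (simp add: free_lift_def)
qed

lemma free_supp:
  assumes "f \<in> carrier (free_module R B)"
  shows "finite {b. f b \<noteq> \<zero>\<^bsub>R\<^esub>}" "{b. f b \<noteq> \<zero>\<^bsub>R\<^esub>} \<subseteq> B" "f b \<in> carrier R"
  using assms by (auto simp: free_module_def)

lemma free_lift_linear:
  assumes N: "module R N" and \<phi>: "\<phi> \<in> B \<rightarrow> carrier N"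
  shows "free_lift R B N \<phi> \<in> linear_maps R (free_module R B) N"
proof -
  interpret module R N by fact
  interpret F: module R "free_module R B" by (rule free_module_module) (rule R.is_cring)
  have add: "free_lift R B N \<phi> (f \<oplus>\<^bsub>free_module R B\<^esub> g) = free_lift R B N \<phi> f \<oplus>\<^bsub>N\<^esub> free_lift R B N \<phi> g"
    if f: "f \<in> carrier (free_module R B)" and g: "g \<in> carrier (free_module R B)" for f g
  proof -
    define T where "T = {b. f b \<noteq> \<zero>\<^bsub>R\<^esub>} \<union> {b. g b \<noteq> \<zero>\<^bsub>R\<^esub>}"
    have T: "finite T" "T \<subseteq> B" using free_supp f g unfolding T_def by blast+
    have fg: "f \<oplus>\<^bsub>free_module R B\<^esub> g \<in> carrier (free_module R B)" using f g by simp
    have s: "{b. (f \<oplus>\<^bsub>free_module R B\<^esub> g) b \<noteq> \<zero>\<^bsub>R\<^esub>} \<subseteq> T" by (auto simp: T_def free_module_def)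
    have 1: "free_lift R B N \<phi> (f \<oplus>\<^bsub>free_module R B\<^esub> g) = (\<Oplus>\<^bsub>N\<^esub>b\<in>T. (f b \<oplus>\<^bsub>R\<^esub> g b) \<odot>\<^bsub>N\<^esub> \<phi> b)"
      using free_lift_superset[OF N \<phi> fg T s] by (simp add: free_module_def)
    have 2: "free_lift R B N \<phi> f = (\<Oplus>\<^bsub>N\<^esub>b\<in>T. f b \<odot>\<^bsub>N\<^esub> \<phi> b)"
      by (rule free_lift_superset[OF N \<phi> f T]) (auto simp: T_def)
    have 3: "free_lift R B N \<phi> g = (\<Oplus>\<^bsub>N\<^esub>b\<in>T. g b \<odot>\<^bsub>N\<^esub> \<phi> b)"
      by (rule free_lift_superset[OF N \<phi> g T]) (auto simp: T_def)
    have c: "\<phi> b \<in> carrier N" if "b \<in> T" for b using that T \<phi> by auto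
    have "(\<Oplus>\<^bsub>N\<^esub>b\<in>T. (f b \<oplus>\<^bsub>R\<^esub> g b) \<odot>\<^bsub>N\<^esub> \<phi> b) = (\<Oplus>\<^bsub>N\<^esub>b\<in>T. f b \<odot>\<^bsub>N\<^esub> \<phi> b \<oplus>\<^bsub>N\<^esub> g b \<odot>\<^bsub>N\<^esub> \<phi> b)"
      by (rule M.add.finprod_cong')
         (use c free_supp(3)[OF f] free_supp(3)[OF g] in \<open>auto simp: smult_l_distr\<close>)
    also have "\<dots> = (\<Oplus>\<^bsub>N\<^esub>b\<in>T. f b \<odot>\<^bsub>N\<^esub> \<phi> b) \<oplus>\<^bsub>N\<^esub> (\<Oplus>\<^bsub>N\<^esub>b\<in>T. g b \<odot>\<^bsub>N\<^esub> \<phi> b)"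
      by (rule M.finsum_addf) (use c free_supp(3)[OF f] free_supp(3)[OF g] in auto)
    finally show ?thesis using 1 2 3 by simp
  qed
  have smult: "free_lift R B N \<phi> (r \<odot>\<^bsub>free_module R B\<^esub> f) = r \<odot>\<^bsub>N\<^esub> free_lift R B N \<phi> f"
    if r: "r \<in> carrier R" and f: "f \<in> carrier (free_module R B)" for f r
  proof -
    define T where "T = {b. f b \<noteq> \<zero>\<^bsub>R\<^esub>}"
    have T: "finite T" "T \<subseteq> B" using free_supp f unfolding T_def by blast+
    have rf: "r \<odot>\<^bsub>free_module R B\<^esub> f \<in> carrier (free_module R B)" using f r by simp
    have s: "{b. (r \<odot>\<^bsub>free_module R B\<^esub> f) b \<noteq> \<zero>\<^bsub>R\<^esub>} \<subseteq> T" using r by (auto simp: T_def free_module_def)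
    have 1: "free_lift R B N \<phi> (r \<odot>\<^bsub>free_module R B\<^esub> f) = (\<Oplus>\<^bsub>N\<^esub>b\<in>T. (r \<otimes>\<^bsub>R\<^esub> f b) \<odot>\<^bsub>N\<^esub> \<phi> b)"
      using free_lift_superset[OF N \<phi> rf T s] by (simp add: free_module_def)
    have 2: "free_lift R B N \<phi> f = (\<Oplus>\<^bsub>N\<^esub>b\<in>T. f b \<odot>\<^bsub>N\<^esub> \<phi> b)"
      by (rule free_lift_superset[OF N \<phi> f T]) (auto simp: T_def)
    have c: "\<phi> b \<in> carrier N" if "b \<in> T" for b using that T \<phi> by auto
    have "(\<Oplus>\<^bsub>N\<^esub>b\<in>T. (r \<otimes>\<^bsub>R\<^esub> f b) \<odot>\<^bsub>N\<^esub> \<phi> b) = (\<Oplus>\<^bsub>N\<^esub>b\<in>T. r \<odot>\<^bsub>N\<^esub> (f b \<odot>\<^bsub>N\<^esub> \<phi> b))"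
      by (rule M.add.finprod_cong') (use c r free_supp(3)[OF f] in \<open>auto simp: smult_assoc1\<close>)
    also have "\<dots> = r \<odot>\<^bsub>N\<^esub> (\<Oplus>\<^bsub>N\<^esub>b\<in>T. f b \<odot>\<^bsub>N\<^esub> \<phi> b)"
      by (rule finsum_smult_ldistr[symmetric]) (use c r T free_supp(3)[OF f] in auto)
    finally show ?thesis using 1 2 by simp
  qed
  have "free_lift R B N \<phi> f \<in> carrier N" if f: "f \<in> carrier (free_module R B)" for f
  proof -
    have "(\<Oplus>\<^bsub>N\<^esub>b\<in>{b. f b \<noteq> \<zero>\<^bsub>R\<^esub>}. f b \<odot>\<^bsub>N\<^esub> \<phi> b) \<in> carrier N"
      by (rule M.finsum_closed) (use free_supp[OF f] \<phi> in fastforce)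
    then show ?thesis using f by (simp add: free_lift_def)
  qed
  then have "free_lift R B N \<phi> \<in> carrier (free_module R B) \<rightarrow>\<^sub>E carrier N"
    by (auto simp: free_lift_def extensional_def PiE_def)
  with add smult show ?thesis by (auto simp: linear_maps_def)
qed

lemma free_lift_basis:
  assumes N: "module R N" and \<phi>: "\<phi> \<in> B \<rightarrow> carrier N" and b: "b \<in> B"
  shows "free_lift R B N \<phi> (basis_elem R b) = \<phi> b"
proof -
  interpret module R N by fact
  have "free_lift R B N \<phi> (basis_elem R b) = (\<Oplus>\<^bsub>N\<^esub>c\<in>{b}. basis_elem R b c \<odot>\<^bsub>N\<^esub> \<phi> c)"
    by (rule free_lift_superset[OF N \<phi>])
       (use b basis_elem_in[OF R.is_cring b] in \<open>auto simp: basis_elem_def\<close>)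
  also have "\<dots> = \<phi> b" using \<phi> b by (simp add: basis_elem_def Pi_iff)
  finally show ?thesis .
qed

lemma list_comb_simps [simp]:
  "list_comb N \<phi> [] = \<zero>\<^bsub>N\<^esub>"
  "list_comb N \<phi> ((c, g) # ts) = c \<odot>\<^bsub>N\<^esub> \<phi> g \<oplus>\<^bsub>N\<^esub> list_comb N \<phi> ts"
  by (simp_all add: list_comb_def)

lemma list_comb_closed:
  assumes "module R N" "set ts \<subseteq> carrier R \<times> B" "\<phi> \<in> B \<rightarrow> carrier N"
  shows "list_comb N \<phi> ts \<in> carrier N"
proof -
  interpret module R N by fact
  show ?thesis using assms(2,3) by (induction ts) (auto simp: Pi_iff)
qed

lemma linear_zero:
  assumes "module R P" "module R N" "h \<in> linear_maps R P N"
  shows "h \<zero>\<^bsub>P\<^esub> = \<zero>\<^bsub>N\<^esub>"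
proof -
  interpret P: module R P by fact
  interpret N: module R N by fact
  have "h (\<zero>\<^bsub>R\<^esub> \<odot>\<^bsub>P\<^esub> \<zero>\<^bsub>P\<^esub>) = \<zero>\<^bsub>R\<^esub> \<odot>\<^bsub>N\<^esub> h \<zero>\<^bsub>P\<^esub>"
    using assms(3) P.R.zero_closed P.M.zero_closed unfolding linear_maps_def by blast
  moreover have "h \<zero>\<^bsub>P\<^esub> \<in> carrier N"
    using assms(3) P.M.zero_closed unfolding linear_maps_def by blast
  ultimately show ?thesis by simp
qed

lemma linear_list_comb:
  assumes P: "module R P" and N: "module R N" and h: "h \<in> linear_maps R P N"
    and ts: "set ts \<subseteq> carrier R \<times> B" and \<phi>: "\<phi> \<in> B \<rightarrow> carrier P"
  shows "h (list_comb P \<phi> ts) = list_comb N (\<lambda>g. h (\<phi> g)) ts"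
  using ts
proof (induction ts)
  case Nil
  then show ?case using linear_zero[OF P N h] by simp
next
  case (Cons t ts)
  obtain c g where t: "t = (c, g)" by force
  have cg: "c \<in> carrier R" "\<phi> g \<in> carrier P" "set ts \<subseteq> carrier R \<times> B" using Cons.prems t \<phi> by auto
  have "list_comb P \<phi> ts \<in> carrier P" by (rule list_comb_closed[OF P cg(3) \<phi>])
  moreover have "c \<odot>\<^bsub>P\<^esub> \<phi> g \<in> carrier P" using module.smult_closed[OF P] cg by blast
  ultimately show ?case using Cons.IH[OF cg(3)] h cg by (simp add: t linear_maps_def)
qed

lemma list_comb_cong:
  assumes "\<And>c g. (c, g) \<in> set ts \<Longrightarrow> \<phi> g = \<psi> g"
  shows "list_comb N \<phi> ts = list_comb N \<psi> ts"
  using assms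
proof (induction ts)
  case (Cons t ts)
  have "list_comb N \<phi> ts = list_comb N \<psi> ts" using Cons.prems by (intro Cons.IH) auto
  moreover have "\<phi> (snd t) = \<psi> (snd t)" using Cons.prems[of "fst t" "snd t"] by simp
  ultimately show ?case by (cases t) simp
qed simp

lemma list_comb_free: "list_comb (free_module R B) \<phi> ts = list_comb (free_module R UNIV) \<phi> ts"
  by (induction ts) (auto simp: list_comb_def free_module_def)

lemma free_as_list:
  assumes R: "cring R" and f: "f \<in> carrier (free_module R B)"
  shows "\<exists>ts. set ts \<subseteq> carrier R \<times> B \<and> f = list_comb (free_module R UNIV) (basis_elem R) ts"
proof -
  interpret cring R by fact
  have "\<exists>ts. set ts \<subseteq> carrier R \<times> B \<and> f = list_comb (free_module R UNIV) (basis_elem R) ts"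
    if "finite T" "{b. f b \<noteq> \<zero>\<^bsub>R\<^esub>} \<subseteq> T" "f \<in> carrier (free_module R B)" for T f
    using that
  proof (induction T arbitrary: f)
    case empty
    then have "f = (\<lambda>_. \<zero>\<^bsub>R\<^esub>)" by auto
    then show ?case by (intro exI[of _ "[]"]) (simp add: free_module_def)
  next
    case (insert b T)
    show ?case
    proof (cases "b \<in> B")
      case False
      then have "f b = \<zero>\<^bsub>R\<^esub>" using insert.prems by (auto simp: free_module_def)
      then show ?thesis using insert.prems by (intro insert.IH) auto
    next
      case True
      let ?g = "f(b := \<zero>\<^bsub>R\<^esub>)"
      have "{c. ?g c \<noteq> \<zero>\<^bsub>R\<^esub>} \<subseteq> T" using insert.prems by auto
      moreover from this have "finite {c. ?g c \<noteq> \<zero>\<^bsub>R\<^esub>}"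
        using insert.hyps(1) finite_subset by blast
      then have "?g \<in> carrier (free_module R B)"
        using insert.prems unfolding free_module_def by simp
      ultimately obtain ts where ts: "set ts \<subseteq> carrier R \<times> B"
        "?g = list_comb (free_module R UNIV) (basis_elem R) ts" using insert.IH by blast
      have fc: "f c \<in> carrier R" for c using insert.prems by (auto simp: free_module_def)
      have "f = list_comb (free_module R UNIV) (basis_elem R) ((f b, b) # ts)"
        using ts(2)[symmetric] fc by (auto simp: free_module_def basis_elem_def)
      moreover have "set ((f b, b) # ts) \<subseteq> carrier R \<times> B" using ts(1) fc True by auto
      ultimately show ?thesis by blast
    qed
  qed
  then show ?thesis using free_supp(1)[OF f] f by blast
qed

lemma free_lift_list_comb:
  assumes N: "module R N" and \<phi>: "\<phi> \<in> B \<rightarrow> carrier N" and ts: "set ts \<subseteq> carrier R \<times> B"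
  shows "free_lift R B N \<phi> (list_comb (free_module R UNIV) (basis_elem R) ts) = list_comb N \<phi> ts"
proof -
  have R: "cring R" using N by (simp add: module_def)
  have "free_lift R B N \<phi> (list_comb (free_module R B) (basis_elem R) ts)
      = list_comb N (\<lambda>g. free_lift R B N \<phi> (basis_elem R g)) ts"
    by (rule linear_list_comb[OF free_module_module[OF R] N free_lift_linear[OF N \<phi>] ts])
       (use basis_elem_in[OF R] in auto)
  also have "\<dots> = list_comb N \<phi> ts"
    using ts by (intro list_comb_cong) (auto simp: free_lift_basis[OF N \<phi>])
  finally show ?thesis by (simp add: list_comb_free[of R B])
qed

text \<open>The image of a free module under a lift is the kernel, provided that the basis consists
  of all formal combinations that vanish.\<close>

lemma exact_step:
  assumes R: "cring R" and N: "module R N" and \<phi>: "\<phi> \<in> B \<rightarrow> carrier N"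
    and C: "C = {Syz ts | ts. set ts \<subseteq> carrier R \<times> B \<and> list_comb N \<phi> ts = \<zero>\<^bsub>N\<^esub>}"
  shows "gen_boundary R \<in> C \<rightarrow> carrier (free_module R B)"
    and "free_lift R C (free_module R B) (gen_boundary R) ` carrier (free_module R C)
       = a_kernel (free_module R B) N (free_lift R B N \<phi>)"
proof -
  note FB = free_module_module[OF R, of B] and FC = free_module_module[OF R, of C]
  have be: "basis_elem R \<in> B \<rightarrow> carrier (free_module R B)" using basis_elem_in[OF R] by auto
  show gb: "gen_boundary R \<in> C \<rightarrow> carrier (free_module R B)"
  proof
    fix g assume "g \<in> C"
    then obtain ts where g: "g = Syz ts" and ts: "set ts \<subseteq> carrier R \<times> B" unfolding C by blast
    show "gen_boundary R g \<in> carrier (free_module R B)"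
      using list_comb_closed[OF FB ts be] by (simp add: g gen_boundary_def list_comb_free[of R B])
  qed
  note lin = free_lift_linear[OF N \<phi>] and lin2 = free_lift_linear[OF FB gb]
  show "free_lift R C (free_module R B) (gen_boundary R) ` carrier (free_module R C)
       = a_kernel (free_module R B) N (free_lift R B N \<phi>)" (is "?I = ?K")
  proof
    show "?I \<subseteq> ?K"
    proof
      fix y assume "y \<in> ?I"
      then obtain f where f: "f \<in> carrier (free_module R C)"
        and y: "y = free_lift R C (free_module R B) (gen_boundary R) f" by auto
      obtain us where us: "set us \<subseteq> carrier R \<times> C" "f = list_comb (free_module R UNIV) (basis_elem R) us"
        using free_as_list[OF R f] by blast
      have y2: "y = list_comb (free_module R B) (gen_boundary R) us"
        using free_lift_list_comb[OF FB gb us(1)] us(2) y by simp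
      have "free_lift R B N \<phi> y = list_comb N (\<lambda>g. free_lift R B N \<phi> (gen_boundary R g)) us"
        unfolding y2 by (rule linear_list_comb[OF FB N lin us(1) gb])
      also have "\<dots> = list_comb N (\<lambda>g. \<zero>\<^bsub>N\<^esub>) us"
      proof (rule list_comb_cong)
        fix c g assume "(c, g) \<in> set us"
        then obtain ts where "g = Syz ts" "set ts \<subseteq> carrier R \<times> B" "list_comb N \<phi> ts = \<zero>\<^bsub>N\<^esub>"
          using us(1) C by auto
        then show "free_lift R B N \<phi> (gen_boundary R g) = \<zero>\<^bsub>N\<^esub>"
          using free_lift_list_comb[OF N \<phi>] by (simp add: gen_boundary_def)
      qed
      also have "\<dots> = \<zero>\<^bsub>N\<^esub>"
      proof -
        interpret module R N by fact
        show ?thesis using us(1) by (induction us) (auto simp: list_comb_def)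
      qed
      finally have "free_lift R B N \<phi> y = \<zero>\<^bsub>N\<^esub>" .
      moreover have "y \<in> carrier (free_module R B)"
        unfolding y2 by (rule list_comb_closed[OF FB us(1) gb])
      ultimately show "y \<in> ?K" by (simp add: a_kernel_def kernel_def)
    qed
    show "?K \<subseteq> ?I"
    proof
      fix y assume "y \<in> ?K"
      then have y: "y \<in> carrier (free_module R B)" "free_lift R B N \<phi> y = \<zero>\<^bsub>N\<^esub>"
        by (auto simp: a_kernel_def kernel_def)
      obtain ts where ts: "set ts \<subseteq> carrier R \<times> B" "y = list_comb (free_module R UNIV) (basis_elem R) ts"
        using free_as_list[OF R y(1)] by blast
      then have S: "Syz ts \<in> C" using y(2) free_lift_list_comb[OF N \<phi>] by (auto simp: C)
      then have "free_lift R C (free_module R B) (gen_boundary R) (basis_elem R (Syz ts)) = y"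
        using free_lift_basis[OF FB gb S] ts(2) by (simp add: gen_boundary_def)
      then show "y \<in> ?I" using basis_elem_in[OF R S] by (rule image_eqI[OF sym])
    qed
  qed
qed

lemma gen_boundary_closed:
  assumes "cring R"
  shows "gen_boundary R \<in> res_basis_int R L n \<rightarrow> carrier (res R L (n - 1))"
proof (cases "n \<le> 0")
  case True
  interpret cring R by fact
  have "gen_boundary R g \<in> carrier (res R L (n - 1))" if "g \<in> res_basis_int R L n" for g
  proof -
    from that have "n = 0" "g \<in> res_basis R L 0"
      using True by (auto simp: res_basis_int_def simp del: res_basis.simps split: if_splits)
    then obtain l where "g = Gen l" by auto
    then show ?thesis by (simp add: res_def free_module_def gen_boundary_def)
  qed
  then show ?thesis by blast
next
  case False
  then obtain m where "nat n = Suc m" by (cases "nat n") auto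
  then have n: "n = int (Suc m)" by linarith
  let ?F = "free_module R (res_basis R L m)"
  have "gen_boundary R g \<in> carrier ?F" if "g \<in> res_basis R L (Suc m)" for g
  proof -
    from that obtain ts where g: "g = Syz ts" and ts: "set ts \<subseteq> carrier R \<times> res_basis R L m" by auto
    have "list_comb ?F (basis_elem R) ts \<in> carrier ?F"
      by (rule list_comb_closed[OF free_module_module[OF assms] ts])
         (intro funcsetI basis_elem_in[OF assms])
    then show ?thesis by (simp add: g gen_boundary_def list_comb_free[of R "res_basis R L m"])
  qed
  moreover have "res_basis_int R L n = res_basis R L (Suc m)" "res_basis_int R L (n - 1) = res_basis R L m"
    by (simp_all add: res_basis_int_def n nat_add_distrib del: res_basis.simps)
  ultimately show ?thesis by (simp add: res_def del: res_basis.simps)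
qed

text \<open>The complex \<open>res R L\<close>, augmented to \<open>L\<close>, is exact.\<close>

lemma res_exact:
  assumes L: "module R L"
  shows "a_kernel (res R L 0) L (res_augment R L) = res_diff R L 1 ` carrier (res R L 1)"
    and "n > 0 \<Longrightarrow> a_kernel (res R L n) (res R L (n - 1)) (res_diff R L n)
                  = res_diff R L (n + 1) ` carrier (res R L (n + 1))"
    and "res_augment R L ` carrier (res R L 0) = carrier L"
proof -
  interpret module R L by fact
  have aug: "gen_augment L \<in> res_basis R L 0 \<rightarrow> carrier L" by (auto simp: gen_augment_def)
  show "a_kernel (res R L 0) L (res_augment R L) = res_diff R L 1 ` carrier (res R L 1)"
  proof -
    have C: "res_basis R L (Suc 0) = {Syz ts | ts. set ts \<subseteq> carrier R \<times> res_basis R L 0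
        \<and> list_comb L (gen_augment L) ts = \<zero>\<^bsub>L\<^esub>}"
      unfolding res_basis.simps(2) by simp
    have "res_basis_int R L 0 = res_basis R L 0" "res_basis_int R L 1 = res_basis R L (Suc 0)"
      by (simp_all add: res_basis_int_def del: res_basis.simps)
    with exact_step(2)[OF R.is_cring L aug C] show ?thesis
      by (simp add: res_def res_diff_def res_augment_def del: res_basis.simps)
  qed
  show "a_kernel (res R L n) (res R L (n - 1)) (res_diff R L n)
      = res_diff R L (n + 1) ` carrier (res R L (n + 1))" if "n > 0"
  proof -
    obtain m where "nat n = Suc m" using \<open>n > 0\<close> by (cases "nat n") auto
    then have n: "n = int (Suc m)" by linarith
    have F: "module R (res R L (n - 1))" unfolding res_def by (rule free_module_module[OF R.is_cring])
    have z: "list_comb (res R L (n - 1)) (gen_boundary R) ts = \<zero>\<^bsub>res R L (n - 1)\<^esub>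
       \<longleftrightarrow> list_comb (free_module R UNIV) (gen_boundary R) ts = (\<lambda>_. \<zero>\<^bsub>R\<^esub>)" for ts
      unfolding res_def list_comb_free[of R "res_basis_int R L (n - 1)"] by (simp add: free_module_def)
    have "res_basis_int R L (n + 1) = res_basis R L (Suc (Suc m))"
      "res_basis_int R L n = res_basis R L (Suc m)"
      by (simp_all add: res_basis_int_def n nat_add_distrib del: res_basis.simps)
    then have E: "res_basis_int R L (n + 1) = {Syz ts | ts. set ts \<subseteq> carrier R \<times> res_basis_int R L n
        \<and> list_comb (res R L (n - 1)) (gen_boundary R) ts = \<zero>\<^bsub>res R L (n - 1)\<^esub>}"
      unfolding z res_basis.simps(2)[of R L "Suc m"] by (simp del: res_basis.simps)
    show ?thesis
      using exact_step(2)[OF R.is_cring F gen_boundary_closed[OF R.is_cring] E]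
      unfolding res_diff_def res_def[of R L n] res_def[of R L "n + 1"] add_diff_cancel_right' by (rule sym)
  qed
  show "res_augment R L ` carrier (res R L 0) = carrier L"
  proof
    show "res_augment R L ` carrier (res R L 0) \<subseteq> carrier L"
      using free_lift_linear[OF L aug]
      by (auto simp: res_augment_def res_def res_basis_int_def linear_maps_def)
    show "carrier L \<subseteq> res_augment R L ` carrier (res R L 0)"
    proof
      fix l assume "l \<in> carrier L"
      then have g: "Gen l \<in> res_basis R L 0" by simp
      have "res_augment R L (basis_elem R (Gen l)) = l"
        using free_lift_basis[OF L aug g] by (simp add: res_augment_def gen_augment_def)
      then show "l \<in> res_augment R L ` carrier (res R L 0)"
        using basis_elem_in[OF R.is_cring g] by (force simp: res_def res_basis_int_def)
    qed
  qed
qed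

definition Ext ::
  "('a, 'r) ring_scheme \<Rightarrow> nat \<Rightarrow> ('a, 'l, 'm) module_scheme \<Rightarrow> ('a, 'n, 'k) module_scheme
    \<Rightarrow> ('a, ((('a, 'l) res_gen \<Rightarrow> 'a) \<Rightarrow> 'n) set) module" where
  "Ext R i L N = hom_cohomology R (res R L) (res_diff R L) N (int i)"


section \<open>The subcategory\<close>

definition M0_cof :: "('a, 'r) ring_scheme \<Rightarrow> 'a set \<Rightarrow> ('a, 'n, 'k) module_scheme \<Rightarrow> bool" where
  "M0_cof R I N \<longleftrightarrow>
     module R N \<and>
     (\<forall>i. fin_gen_module R (Ext R i (quotient_module (self_module R) I) N))"

end

theory Submission
  imports Defs
begin

text \<open>
  Let \<open>F\<close> be the free resolution of \<open>L = A/\<aa>\<close> and \<open>K\<^sup>q = Hom (K\<^sub>q(xs), M)\<close>, with cycles \<open>Z\<^sup>q\<close> and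
  boundaries \<open>B\<^sup>q\<close>. The Koszul differential is a linear combination of maps with coefficients in \<open>\<aa>\<close>,
  and \<open>\<aa>\<close> kills \<open>Ext\<^sup>n(L, M)\<close>; so \<open>K\<^sup>0 \<rightarrow> K\<^sup>1\<close> induces zero on \<open>Ext\<^sup>n(L, -)\<close>. Modulo finitely generated
  modules this map factors as \<open>Ext\<^sup>n(L, K\<^sup>0) \<rightarrow> Ext\<^sup>n(L, B\<^sup>1) \<rightarrow> Ext\<^sup>n(L, Z\<^sup>1) \<rightarrow> Ext\<^sup>n(L, K\<^sup>1)\<close>, where the first two
  arrows have finitely generated kernel because the \<open>Ext(L, H\<^sup>q)\<close> are finitely generated, and the
  kernel of the last is a quotient of \<open>Ext\<^sup>n\<^sup>-\<^sup>1(L, B\<^sup>2)\<close>. The latter is finitely generated by induction on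
  \<open>n\<close>, since \<open>Ext\<^sup>n\<^sup>-\<^sup>1(L, K\<^sup>q)\<close> is a finite power of \<open>Ext\<^sup>n\<^sup>-\<^sup>1(L, M)\<close>. Instead of long exact sequences, the
  proof works with cochains in the double complex \<open>Hom (F\<^sub>n, K\<^sup>q)\<close>.
\<close>

text \<open>Finitely generated modules over a noetherian ring are closed under submodules, quotients
  and extensions, so a map can be studied up to finite generation of its kernel and image. The
  sequences behind the argument are 0 -> Z^q -> K^q -> B^(q+1) -> 0 and 0 -> B^q -> Z^q -> H^q -> 0.
  They trade degree n for degree n - 1 at the price of raising q, so the induction has to cover all
  q simultaneously, and finite generation of Ext^n(L, M) itself is consumed on the way from n to n +
  1. Only the first Koszul differential has to vanish on Ext: its components are the multiplications
  by the x_j, and a null homotopy on F handles each of them. Cochains suffice because every F_n is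
  projective: cochains with values in B^q are the composites of cochains with values in K^(q-1), and
  cochains with values in H^q lift to Z^q. Thus no connecting homomorphism has to be
  constructed.\<close>

section \<open>Linear maps on carriers, and submodules\<close>

text \<open>Drops the extensionality built into \<open>linear_maps\<close>, so that composites,
  differences and scalar multiplications are linear as plain lambda terms.\<close>

definition linear_on ::
  "('a, 'r) ring_scheme \<Rightarrow> ('a, 'p, 'm) module_scheme \<Rightarrow> ('a, 'n, 'k) module_scheme \<Rightarrow> ('p \<Rightarrow> 'n) \<Rightarrow> bool"
  where "linear_on R P N f \<longleftrightarrow>
     (\<forall>x\<in>carrier P. f x \<in> carrier N) \<and>
     (\<forall>x\<in>carrier P. \<forall>y\<in>carrier P. f (x \<oplus>\<^bsub>P\<^esub> y) = f x \<oplus>\<^bsub>N\<^esub> f y) \<and>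
     (\<forall>r\<in>carrier R. \<forall>x\<in>carrier P. f (r \<odot>\<^bsub>P\<^esub> x) = r \<odot>\<^bsub>N\<^esub> f x)"

lemma linear_onD:
  assumes "linear_on R P N f"
  shows "x \<in> carrier P \<Longrightarrow> f x \<in> carrier N"
    and "x \<in> carrier P \<Longrightarrow> y \<in> carrier P \<Longrightarrow> f (x \<oplus>\<^bsub>P\<^esub> y) = f x \<oplus>\<^bsub>N\<^esub> f y"
    and "r \<in> carrier R \<Longrightarrow> x \<in> carrier P \<Longrightarrow> f (r \<odot>\<^bsub>P\<^esub> x) = r \<odot>\<^bsub>N\<^esub> f x"
  using assms by (auto simp: linear_on_def)

lemma linear_maps_iff:
  "f \<in> linear_maps R P N \<longleftrightarrow> linear_on R P N f \<and> f \<in> extensional (carrier P)"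
  by (auto simp: linear_maps_def linear_on_def PiE_iff)

text \<open>Closure under negation is automatic, since the negative of x is its multiple by -1.
  Later submodule checks thereby reduce to zero, sums and scalar multiples.\<close>

lemma submodule_iff:
  assumes "module R P"
  shows "submodule N R P \<longleftrightarrow> N \<subseteq> carrier P \<and> \<zero>\<^bsub>P\<^esub> \<in> N \<and> (\<forall>x\<in>N. \<forall>y\<in>N. x \<oplus>\<^bsub>P\<^esub> y \<in> N) \<and>
    (\<forall>r\<in>carrier R. \<forall>x\<in>N. r \<odot>\<^bsub>P\<^esub> x \<in> N)"
proof -
  interpret module R P by fact
  show ?thesis
  proof
    assume N: "submodule N R P"
    show "N \<subseteq> carrier P \<and> \<zero>\<^bsub>P\<^esub> \<in> N \<and> (\<forall>x\<in>N. \<forall>y\<in>N. x \<oplus>\<^bsub>P\<^esub> y \<in> N) \<and>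
      (\<forall>r\<in>carrier R. \<forall>x\<in>N. r \<odot>\<^bsub>P\<^esub> x \<in> N)"
      using submoduleE[OF N] subgroup.one_closed[OF submodule.axioms(1)[OF N]] by auto
  next
    assume N: "N \<subseteq> carrier P \<and> \<zero>\<^bsub>P\<^esub> \<in> N \<and> (\<forall>x\<in>N. \<forall>y\<in>N. x \<oplus>\<^bsub>P\<^esub> y \<in> N) \<and>
      (\<forall>r\<in>carrier R. \<forall>x\<in>N. r \<odot>\<^bsub>P\<^esub> x \<in> N)"
    have "\<ominus>\<^bsub>P\<^esub> x \<in> N" if "x \<in> N" for x
    proof -
      have "(\<ominus>\<^bsub>R\<^esub> \<one>\<^bsub>R\<^esub>) \<odot>\<^bsub>P\<^esub> x = \<ominus>\<^bsub>P\<^esub> x" using that N by (auto simp: smult_l_minus)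
      moreover have "(\<ominus>\<^bsub>R\<^esub> \<one>\<^bsub>R\<^esub>) \<odot>\<^bsub>P\<^esub> x \<in> N" using that N R.a_inv_closed[OF R.one_closed] by blast
      ultimately show ?thesis by simp
    qed
    then show "submodule N R P" using N by (intro submoduleI) auto
  qed
qed

lemma submoduleD:
  assumes "module R P" "submodule N R P"
  shows "N \<subseteq> carrier P" "\<zero>\<^bsub>P\<^esub> \<in> N" "x \<in> N \<Longrightarrow> y \<in> N \<Longrightarrow> x \<oplus>\<^bsub>P\<^esub> y \<in> N"
    "x \<in> N \<Longrightarrow> y \<in> N \<Longrightarrow> x \<ominus>\<^bsub>P\<^esub> y \<in> N"
    "r \<in> carrier R \<Longrightarrow> x \<in> N \<Longrightarrow> r \<odot>\<^bsub>P\<^esub> x \<in> N" "x \<in> N \<Longrightarrow> x \<in> carrier P"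
proof -
  interpret module R P by fact
  show "x \<in> N \<Longrightarrow> y \<in> N \<Longrightarrow> x \<ominus>\<^bsub>P\<^esub> y \<in> N"
    using submoduleE(3,5)[OF assms(2)] by (simp add: a_minus_def)
qed (use assms submodule_iff[OF assms(1)] in auto)

context module begin

lemma minus_add_cancel:
  assumes "x \<in> carrier M" "y \<in> carrier M" shows "y \<oplus>\<^bsub>M\<^esub> (x \<ominus>\<^bsub>M\<^esub> y) = x" "(x \<ominus>\<^bsub>M\<^esub> y) \<oplus>\<^bsub>M\<^esub> y = x"
    "(y \<oplus>\<^bsub>M\<^esub> x) \<ominus>\<^bsub>M\<^esub> y = x"
  using assms by (simp_all add: a_minus_def M.a_ac M.r_neg M.r_neg1 M.r_neg2)

lemma minus_eq_zero:
  assumes "x \<in> carrier M" "y \<in> carrier M" shows "x \<ominus>\<^bsub>M\<^esub> y = \<zero>\<^bsub>M\<^esub> \<longleftrightarrow> x = y"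
  using assms minus_add_cancel(1)[of x y] by (auto simp: a_minus_def M.r_neg)

lemma smult_minus_distr:
  assumes "r \<in> carrier R" "x \<in> carrier M" "y \<in> carrier M"
  shows "r \<odot>\<^bsub>M\<^esub> (x \<ominus>\<^bsub>M\<^esub> y) = r \<odot>\<^bsub>M\<^esub> x \<ominus>\<^bsub>M\<^esub> r \<odot>\<^bsub>M\<^esub> y"
  using assms by (simp add: a_minus_def smult_r_distr smult_r_minus)

end

lemma linear_on_zero:
  assumes "module R P" "module R N" "linear_on R P N f"
  shows "f \<zero>\<^bsub>P\<^esub> = \<zero>\<^bsub>N\<^esub>"
proof -
  interpret P: module R P by fact
  interpret N: module R N by fact
  have "f (\<zero>\<^bsub>R\<^esub> \<odot>\<^bsub>P\<^esub> \<zero>\<^bsub>P\<^esub>) = \<zero>\<^bsub>R\<^esub> \<odot>\<^bsub>N\<^esub> f \<zero>\<^bsub>P\<^esub>" using linear_onD[OF assms(3)] by blast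
  then show ?thesis using linear_onD(1)[OF assms(3) P.M.zero_closed] by simp
qed

lemma linear_on_minus:
  assumes P: "module R P" and N: "module R N" and f: "linear_on R P N f"
    and x: "x \<in> carrier P" and y: "y \<in> carrier P"
  shows "f (x \<ominus>\<^bsub>P\<^esub> y) = f x \<ominus>\<^bsub>N\<^esub> f y"
proof -
  interpret P: module R P by fact
  interpret N: module R N by fact
  have "f x = f (y \<oplus>\<^bsub>P\<^esub> (x \<ominus>\<^bsub>P\<^esub> y))" using P.minus_add_cancel x y by simp
  also have "\<dots> = f y \<oplus>\<^bsub>N\<^esub> f (x \<ominus>\<^bsub>P\<^esub> y)" using x y by (simp add: linear_onD[OF f])
  finally show ?thesis using N.minus_add_cancel(3) linear_onD(1)[OF f] x y by simp
qed

lemma linear_on_zero_map: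
  assumes "module R N" shows "linear_on R P N (\<lambda>_. \<zero>\<^bsub>N\<^esub>)"
proof -
  interpret module R N by fact
  show ?thesis by (simp add: linear_on_def)
qed

lemma scalar_linear:
  assumes "module R P" "r \<in> carrier R"
  shows "linear_on R P P (\<lambda>x. r \<odot>\<^bsub>P\<^esub> x)"
proof -
  interpret module R P by fact
  show ?thesis using assms(2) by (auto simp: linear_on_def smult_r_distr smult_assoc1[symmetric] R.m_comm)
qed

lemma linear_on_diff:
  assumes P: "module R P" and N: "module R N" and f: "linear_on R P N f" and g: "linear_on R P N g"
  shows "linear_on R P N (\<lambda>x. f x \<ominus>\<^bsub>N\<^esub> g x)"
proof -
  interpret N: module R N by fact
  note f = linear_onD[OF f] and g = linear_onD[OF g]
  show ?thesis unfolding linear_on_def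
  proof (intro conjI ballI)
    fix x y assume xy: "x \<in> carrier P" "y \<in> carrier P"
    then show "f (x \<oplus>\<^bsub>P\<^esub> y) \<ominus>\<^bsub>N\<^esub> g (x \<oplus>\<^bsub>P\<^esub> y) = (f x \<ominus>\<^bsub>N\<^esub> g x) \<oplus>\<^bsub>N\<^esub> (f y \<ominus>\<^bsub>N\<^esub> g y)"
      using f(1) g(1) by (simp add: f(2) g(2) a_minus_def N.M.minus_add N.M.a_ac)
  qed (use f g in \<open>auto simp: N.smult_minus_distr\<close>)
qed

lemma linear_on_comp:
  "linear_on R P P' f \<Longrightarrow> linear_on R P' N g \<Longrightarrow> linear_on R P N (\<lambda>x. g (f x))"
  by (auto simp: linear_on_def)

lemma linear_finsum:
  assumes P: "module R P" and N: "module R N" and f: "linear_on R P N f" and g: "\<And>a. a \<in> A \<Longrightarrow> g a \<in> carrier P"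
    and fin: "finite A"
  shows "f (\<Oplus>\<^bsub>P\<^esub>a\<in>A. g a) = (\<Oplus>\<^bsub>N\<^esub>a\<in>A. f (g a))"
proof -
  interpret P: module R P by fact
  interpret N: module R N by fact
  note l = linear_onD[OF f]
  from fin g show ?thesis
  proof induction
    case empty
    then show ?case using linear_on_zero[OF P N f] by simp
  next
    case (insert a A)
    have g: "g \<in> A \<rightarrow> carrier P" "g a \<in> carrier P" using insert.prems by auto
    have fg: "(\<lambda>a. f (g a)) \<in> A \<rightarrow> carrier N" "f (g a) \<in> carrier N" using g l(1) by auto
    have "f (\<Oplus>\<^bsub>P\<^esub>a\<in>insert a A. g a) = f (g a \<oplus>\<^bsub>P\<^esub> (\<Oplus>\<^bsub>P\<^esub>a\<in>A. g a))"
      using insert.hyps g by (simp add: P.M.finsum_insert)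
    also have "\<dots> = f (g a) \<oplus>\<^bsub>N\<^esub> f (\<Oplus>\<^bsub>P\<^esub>a\<in>A. g a)" by (rule l(2)[OF g(2) P.M.finsum_closed[OF g(1)]])
    also have "f (\<Oplus>\<^bsub>P\<^esub>a\<in>A. g a) = (\<Oplus>\<^bsub>N\<^esub>a\<in>A. f (g a))" using insert.IH insert.prems by blast
    finally show ?case using insert.hyps fg by (simp add: N.M.finsum_insert)
  qed
qed

lemma self_module_module: "cring R \<Longrightarrow> module R (self_module R)"
proof -
  assume "cring R"
  then interpret cring R .
  show ?thesis
    by (rule moduleI)
       (auto simp: self_module_def is_cring l_distr r_distr m_assoc a_ac
         intro!: abelian_groupI bexI[of _ "\<ominus>\<^bsub>R\<^esub> _"] l_neg)
qed

lemma submodule_Int: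
  assumes "module R P" "submodule N R P" "submodule N' R P"
  shows "submodule (N \<inter> N') R P"
  using assms by (auto simp: submodule_iff)

lemma submodule_image:
  assumes P: "module R P" and Q: "module R Q" and f: "linear_on R P Q f" and N: "submodule N R P"
  shows "submodule (f ` N) R Q"
proof -
  note D = submoduleD[OF P N] and L = linear_onD[OF f]
  have "\<zero>\<^bsub>Q\<^esub> \<in> f ` N" using linear_on_zero[OF P Q f] D(2) by force
  moreover have "f x \<oplus>\<^bsub>Q\<^esub> f y \<in> f ` N" if "x \<in> N" "y \<in> N" for x y
    using that D(3) L(2)[symmetric] D(6) by simp
  moreover have "r \<odot>\<^bsub>Q\<^esub> f x \<in> f ` N" if "x \<in> N" "r \<in> carrier R" for x r
    using that D(5) L(3)[symmetric] D(6) by simp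
  ultimately show ?thesis using D(6) L(1) by (auto simp: submodule_iff[OF Q])
qed

lemma submodule_vimage:
  assumes P: "module R P" and Q: "module R Q" and f: "linear_on R P Q f" and N: "submodule N R Q"
  shows "submodule {x \<in> carrier P. f x \<in> N} R P"
proof -
  interpret module R P by fact
  show ?thesis using submoduleD[OF Q N] linear_onD[OF f] linear_on_zero[OF P Q f]
    by (auto simp: submodule_iff[OF P])
qed

lemma submodule_zero: "module R P \<Longrightarrow> submodule {\<zero>\<^bsub>P\<^esub>} R P"
proof -
  assume P: "module R P" then interpret module R P .
  show ?thesis by (auto simp: submodule_iff[OF P])
qed

lemma submodule_kernel:
  assumes "module R P" "module R Q" "linear_on R P Q f"
  shows "submodule {x \<in> carrier P. f x = \<zero>\<^bsub>Q\<^esub>} R P"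
  using submodule_vimage[OF assms submodule_zero[OF assms(2)]] by simp

lemma submodule_sum:
  assumes P: "module R P" and N: "submodule N R P" and N': "submodule N' R P"
  shows "submodule {x \<oplus>\<^bsub>P\<^esub> y |x y. x \<in> N \<and> y \<in> N'} R P" (is "submodule ?S R P")
proof -
  interpret module R P by fact
  note D = submoduleD[OF P N] and D' = submoduleD[OF P N']
  have "\<zero>\<^bsub>P\<^esub> \<in> ?S" using D(2) D'(2) M.l_zero[OF M.zero_closed] by force
  moreover have "a \<oplus>\<^bsub>P\<^esub> b \<in> ?S" if ab: "a \<in> ?S" "b \<in> ?S" for a b
  proof -
    from ab obtain x y x' y' where *: "x \<in> N" "y \<in> N'" "x' \<in> N" "y' \<in> N'" "a = x \<oplus>\<^bsub>P\<^esub> y" "b = x' \<oplus>\<^bsub>P\<^esub> y'"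
      by blast
    then have "a \<oplus>\<^bsub>P\<^esub> b = (x \<oplus>\<^bsub>P\<^esub> x') \<oplus>\<^bsub>P\<^esub> (y \<oplus>\<^bsub>P\<^esub> y')"
      using D(6) D'(6) by (simp add: M.a_ac)
    then show ?thesis using * D(3) D'(3) by blast
  qed
  moreover have "r \<odot>\<^bsub>P\<^esub> a \<in> ?S" if a: "a \<in> ?S" "r \<in> carrier R" for a r
  proof -
    from a obtain x y where *: "x \<in> N" "y \<in> N'" "a = x \<oplus>\<^bsub>P\<^esub> y" by blast
    then have "r \<odot>\<^bsub>P\<^esub> a = r \<odot>\<^bsub>P\<^esub> x \<oplus>\<^bsub>P\<^esub> r \<odot>\<^bsub>P\<^esub> y" using D(6) D'(6) a(2) by (simp add: smult_r_distr)
    then show ?thesis using * D(5) D'(5) a(2) by blast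
  qed
  ultimately show ?thesis using D(6) D'(6) unfolding submodule_iff[OF P] by auto
qed

lemma submodule_module: "module R P \<Longrightarrow> submodule N R P \<Longrightarrow> module R (P\<lparr>carrier := N\<rparr>)"
  by (rule submodule.submodule_is_module)

section \<open>Finite generation over a submodule\<close>

text \<open>For submodules \<open>Z\<close> and \<open>W\<close> this says that (Z + W)/W,
  equivalently Z/(Z \<inter> W), is finitely generated. \<open>W\<close> need not lie in
  \<open>Z\<close>, so no quotient has to be formed. Testing against submodules \<open>N\<close>
  instead of writing linear combinations turns most arguments into taking preimages.\<close>

definition fg_over :: "('a, 'r) ring_scheme \<Rightarrow> ('a, 'p, 'm) module_scheme \<Rightarrow> 'p set \<Rightarrow> 'p set \<Rightarrow> bool"
  where "fg_over R P Z W \<longleftrightarrow>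
    (\<exists>S\<subseteq>Z. finite S \<and> (\<forall>N. submodule N R P \<and> S \<subseteq> N \<and> W \<subseteq> N \<longrightarrow> Z \<subseteq> N))"

lemma fg_overI:
  "S \<subseteq> Z \<Longrightarrow> finite S \<Longrightarrow> (\<And>N. submodule N R P \<Longrightarrow> S \<subseteq> N \<Longrightarrow> W \<subseteq> N \<Longrightarrow> Z \<subseteq> N) \<Longrightarrow> fg_over R P Z W"
  unfolding fg_over_def by blast

lemma fg_overE:
  assumes "fg_over R P Z W"
  obtains S where "S \<subseteq> Z" "finite S" "\<And>N. submodule N R P \<Longrightarrow> S \<subseteq> N \<Longrightarrow> W \<subseteq> N \<Longrightarrow> Z \<subseteq> N"
  using assms unfolding fg_over_def by auto

lemma fg_over_weaken: "fg_over R P Z W \<Longrightarrow> W \<subseteq> W' \<Longrightarrow> fg_over R P Z W'"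
  unfolding fg_over_def by (meson subset_trans)

lemma fg_over_subset: "Z \<subseteq> W \<Longrightarrow> fg_over R P Z W"
  unfolding fg_over_def by (intro exI[of _ "{}"]) auto

text \<open>The old generators still suffice, because each element of \<open>Z'\<close> differs from
  one of \<open>Z\<close> by an element of \<open>W'\<close>. Typical use: a cocycle is corrected by
  a coboundary.\<close>

lemma fg_over_enlarge:
  assumes P: "module R P" and fg: "fg_over R P Z W" and "Z \<subseteq> Z'" "W \<subseteq> W'"
    and dec: "\<And>z. z \<in> Z' \<Longrightarrow> \<exists>y\<in>Z. \<exists>w\<in>W'. z = y \<oplus>\<^bsub>P\<^esub> w"
  shows "fg_over R P Z' W'"
proof -
  obtain S where S: "S \<subseteq> Z" "finite S" "\<And>N. submodule N R P \<Longrightarrow> S \<subseteq> N \<Longrightarrow> W \<subseteq> N \<Longrightarrow> Z \<subseteq> N"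
    using fg unfolding fg_over_def by auto
  have "Z' \<subseteq> N" if N: "submodule N R P" "S \<subseteq> N" "W' \<subseteq> N" for N
  proof
    fix z assume "z \<in> Z'"
    then obtain y w where "y \<in> Z" "w \<in> W'" "z = y \<oplus>\<^bsub>P\<^esub> w" using dec by blast
    then show "z \<in> N" using S(3)[OF N(1,2)] \<open>W \<subseteq> W'\<close> N submoduleD(3)[OF P N(1)] by blast
  qed
  then show ?thesis using S(1,2) \<open>Z \<subseteq> Z'\<close> unfolding fg_over_def by blast
qed

text \<open>The preimage of a test submodule of \<open>Q\<close> is a test submodule of
  \<open>P\<close>.\<close>

lemma fg_over_image:
  assumes P: "module R P" and Q: "module R Q" and f: "linear_on R P Q f"
    and Z: "Z \<subseteq> carrier P" and W: "W \<subseteq> carrier P" and fg: "fg_over R P Z W"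
  shows "fg_over R Q (f ` Z) (f ` W)"
proof -
  obtain S where S: "S \<subseteq> Z" "finite S" "\<And>N. submodule N R P \<Longrightarrow> S \<subseteq> N \<Longrightarrow> W \<subseteq> N \<Longrightarrow> Z \<subseteq> N"
    using fg unfolding fg_over_def by auto
  have "f ` Z \<subseteq> N" if N: "submodule N R Q" "f ` S \<subseteq> N" "f ` W \<subseteq> N" for N
    using S(3)[OF submodule_vimage[OF P Q f N(1)]] N(2,3) S(1) Z W by blast
  then show ?thesis using S unfolding fg_over_def by (intro exI[of _ "f ` S"]) auto
qed

text \<open>Generators are those of f(Z) modulo \<open>B\<close>, lifted to \<open>Z\<close>,
  together with those of the part of \<open>Z\<close> lying over \<open>B\<close>. This stands in
  for exactness of Ext sequences: each use bounds the image and the kernel of one map. The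
  restricted carrier expresses that \<open>f\<close> is linear only on \<open>Z\<close>.\<close>

lemma fg_over_extension:
  assumes P: "module R P" and Q: "module R Q" and Z: "submodule Z R P"
    and f: "linear_on R (P\<lparr>carrier := Z\<rparr>) Q f" and B: "submodule B R Q"
    and fg1: "fg_over R Q (f ` Z) B" and fg2: "fg_over R P {z \<in> Z. f z \<in> B} W"
  shows "fg_over R P Z W"
proof -
  interpret P: module R P by fact
  interpret Q: module R Q by fact
  have PZ: "module R (P\<lparr>carrier := Z\<rparr>)" by (rule submodule_module[OF P Z])
  note ZD = submoduleD[OF P Z]
  obtain T where T: "T \<subseteq> f ` Z" "finite T"
    "\<And>N. submodule N R Q \<Longrightarrow> T \<subseteq> N \<Longrightarrow> B \<subseteq> N \<Longrightarrow> f ` Z \<subseteq> N"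
    using fg1 unfolding fg_over_def by auto
  obtain T' where T': "T' \<subseteq> Z" "finite T'" "f ` T' = T"
    using T(1,2) finite_subset_image by metis
  obtain S where S: "S \<subseteq> {z \<in> Z. f z \<in> B}" "finite S"
    "\<And>N. submodule N R P \<Longrightarrow> S \<subseteq> N \<Longrightarrow> W \<subseteq> N \<Longrightarrow> {z \<in> Z. f z \<in> B} \<subseteq> N"
    using fg2 unfolding fg_over_def by auto
  have "Z \<subseteq> N" if N: "submodule N R P" "T' \<union> S \<subseteq> N" "W \<subseteq> N" for N
  proof
    fix z assume z: "z \<in> Z"
    have NZ: "submodule (N \<inter> Z) R (P\<lparr>carrier := Z\<rparr>)"
      using submodule_Int[OF P N(1) Z] by (auto simp: submodule_iff[OF P] submodule_iff[OF PZ])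
    have sub: "submodule {x \<oplus>\<^bsub>Q\<^esub> y |x y. x \<in> f ` (N \<inter> Z) \<and> y \<in> B} R Q" (is "submodule ?I R Q")
      by (rule submodule_sum[OF Q submodule_image[OF PZ Q f NZ] B])
    have "T \<subseteq> ?I"
    proof
      fix t assume "t \<in> T"
      then obtain s where s: "s \<in> T'" "t = f s" using T'(3) by blast
      then have "t = f s \<oplus>\<^bsub>Q\<^esub> \<zero>\<^bsub>Q\<^esub>" using linear_onD(1)[OF f] T'(1) by auto
      then show "t \<in> ?I" using s N(2) T'(1) submoduleD(2)[OF Q B] by blast
    qed
    moreover have "B \<subseteq> ?I"
    proof
      fix b assume b: "b \<in> B"
      have "b = f \<zero>\<^bsub>P\<^esub> \<oplus>\<^bsub>Q\<^esub> b" using linear_on_zero[OF PZ Q f] submoduleD(6)[OF Q B b] by simp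
      then show "b \<in> ?I" using b submoduleD(2)[OF P N(1)] ZD(2) by blast
    qed
    \<comment> \<open>f(N \<inter> Z) + B contains \<open>B\<close> and generators of f(Z) modulo
      \<open>B\<close>, hence all of f(Z). So \<open>z\<close> agrees with an element of
      \<open>N\<close> up to something lying over \<open>B\<close>.\<close>
    ultimately have "f z \<in> ?I" using T(3)[OF sub] z by blast
    then obtain n b where nb: "n \<in> N" "n \<in> Z" "b \<in> B" "f z = f n \<oplus>\<^bsub>Q\<^esub> b" by blast
    have c: "f n \<in> carrier Q" "f (z \<ominus>\<^bsub>P\<^esub> n) \<in> carrier Q" "b \<in> carrier Q"
      using linear_onD(1)[OF f] nb ZD(4)[OF z nb(2)] submoduleD(6)[OF Q B] by auto
    have "f z = f (n \<oplus>\<^bsub>P\<^esub> (z \<ominus>\<^bsub>P\<^esub> n))" using P.minus_add_cancel ZD(6) z nb(2) by simp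
    also have "\<dots> = f n \<oplus>\<^bsub>Q\<^esub> f (z \<ominus>\<^bsub>P\<^esub> n)" using linear_onD(2)[OF f, of n "z \<ominus>\<^bsub>P\<^esub> n"] nb(2) ZD(4)[OF z nb(2)] by simp
    finally have "f (z \<ominus>\<^bsub>P\<^esub> n) = b" using nb(4) c by simp
    then have "z \<ominus>\<^bsub>P\<^esub> n \<in> N" using S(3)[OF N(1)] N(2,3) ZD(4)[OF z nb(2)] nb(3) by blast
    then have "n \<oplus>\<^bsub>P\<^esub> (z \<ominus>\<^bsub>P\<^esub> n) \<in> N" using submoduleD(3)[OF P N(1)] nb(1) by blast
    then show "z \<in> N" using P.minus_add_cancel ZD(6) z nb(2) by simp
  qed
  moreover have "T' \<union> S \<subseteq> Z" "finite (T' \<union> S)" using T' S by auto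
  ultimately show ?thesis unfolding fg_over_def by blast
qed

text \<open>The extension principle for the inclusion of \<open>Z\<close> into
  \<open>P\<close>.\<close>

lemma fg_over_trans:
  assumes P: "module R P" and Z: "submodule Z R P" and B: "submodule B R P"
    and "fg_over R P Z B" "fg_over R P (Z \<inter> B) W"
  shows "fg_over R P Z W"
proof (rule fg_over_extension[OF P P Z _ B, of "\<lambda>x. x"])
  show "linear_on R (P\<lparr>carrier := Z\<rparr>) P (\<lambda>x. x)" using submoduleD[OF P Z] by (auto simp: linear_on_def)
qed (use assms in \<open>simp_all add: Int_def\<close>)

lemma submodule_span:
  assumes P: "module R P" and S: "S \<subseteq> carrier P"
  shows "submodule (carrier P \<inter> \<Inter>{N. submodule N R P \<and> S \<subseteq> N}) R P"
proof -
  interpret module R P by fact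
  show ?thesis unfolding submodule_iff[OF P] by (auto simp: submoduleD[OF P])
qed

text \<open>Noetherianity enters the whole proof through this lemma. Induction on the generators:
  the coefficients of one generator \<open>s\<close> in elements of \<open>Z'\<close> form an ideal;
  finitely many generators of it are lifted to \<open>Z'\<close>, and after subtracting a suitable
  element only the span of the other generators and \<open>W\<close> is left.\<close>

lemma fg_over_submodule:
  assumes "cring R" "noetherian_ring R" and P: "module R P" and W: "submodule W R P"
    and Z: "submodule Z R P" and Z': "submodule Z' R P" "Z' \<subseteq> Z" and fg: "fg_over R P Z W"
  shows "fg_over R P Z' W"
proof -
  interpret P: module R P by fact
  interpret R: noetherian_ring R by fact
  obtain S where S: "S \<subseteq> Z" "finite S" "\<And>N. submodule N R P \<Longrightarrow> S \<subseteq> N \<Longrightarrow> W \<subseteq> N \<Longrightarrow> Z \<subseteq> N"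
    using fg unfolding fg_over_def by auto
  \<comment> \<open>Here \<open>S\<close> lies in the module but not necessarily in
    \<open>Z'\<close>. This lets the induction pass to \<open>Z' \<inter> Y\<close>, which need not
    contain any of the generators.\<close>
  have "fg_over R P Z' W"
    if "finite S" "S \<subseteq> carrier P" "submodule Z' R P"
      "\<And>N. submodule N R P \<Longrightarrow> S \<subseteq> N \<Longrightarrow> W \<subseteq> N \<Longrightarrow> Z' \<subseteq> N" for S Z'
    using that
  proof (induction S arbitrary: Z')
    case empty
    then have "Z' \<subseteq> W" using W by blast
    then show ?case by (rule fg_over_subset)
  next
    case (insert s S)
    note Z'D = submoduleD[OF P insert.prems(2)]
    define Y where "Y = carrier P \<inter> \<Inter>{N. submodule N R P \<and> S \<union> W \<subseteq> N}"
    have Y: "submodule Y R P"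
      unfolding Y_def using insert.prems(1) submoduleD(1)[OF P W] by (intro submodule_span[OF P]) auto
    note YD = submoduleD[OF P Y]
    have SY: "S \<subseteq> Y" "W \<subseteq> Y" unfolding Y_def using insert.prems(1) submoduleD(1)[OF P W] by auto
    have s: "s \<in> carrier P" using insert.prems(1) by blast
    have lin: "linear_on R (self_module R) P (\<lambda>r. r \<odot>\<^bsub>P\<^esub> s)"
      using s by (auto simp: linear_on_def self_module_def P.smult_l_distr P.smult_assoc1)
    have IH: "fg_over R P (Z' \<inter> Y) W"
    proof (rule insert.IH)
      show "submodule (Z' \<inter> Y) R P" by (rule submodule_Int[OF P insert.prems(2) Y])
      show "Z' \<inter> Y \<subseteq> N" if "submodule N R P" "S \<subseteq> N" "W \<subseteq> N" for N
        unfolding Y_def using that by blast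
    qed (use insert.prems in blast)
    \<comment> \<open>The coefficients of \<open>s\<close> in elements of \<open>V\<close>, taken
      modulo \<open>Y\<close>.\<close>
    define I where "I V = {r \<in> carrier R. \<exists>y\<in>Y. y \<oplus>\<^bsub>P\<^esub> r \<odot>\<^bsub>P\<^esub> s \<in> V}" for V
    have I: "ideal (I V) R" if V: "submodule V R P" for V
    proof -
      note VD = submoduleD[OF P V]
      have add: "a \<oplus>\<^bsub>R\<^esub> b \<in> I V" if ab: "a \<in> I V" "b \<in> I V" for a b
      proof -
        from ab obtain y z where *: "y \<in> Y" "z \<in> Y" "y \<oplus>\<^bsub>P\<^esub> a \<odot>\<^bsub>P\<^esub> s \<in> V" "z \<oplus>\<^bsub>P\<^esub> b \<odot>\<^bsub>P\<^esub> s \<in> V"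
          "a \<in> carrier R" "b \<in> carrier R" unfolding I_def by blast
        have "(y \<oplus>\<^bsub>P\<^esub> a \<odot>\<^bsub>P\<^esub> s) \<oplus>\<^bsub>P\<^esub> (z \<oplus>\<^bsub>P\<^esub> b \<odot>\<^bsub>P\<^esub> s) = (y \<oplus>\<^bsub>P\<^esub> z) \<oplus>\<^bsub>P\<^esub> (a \<oplus>\<^bsub>R\<^esub> b) \<odot>\<^bsub>P\<^esub> s"
          using * s YD(6) by (simp add: P.smult_l_distr P.M.a_ac)
        then have "(y \<oplus>\<^bsub>P\<^esub> z) \<oplus>\<^bsub>P\<^esub> (a \<oplus>\<^bsub>R\<^esub> b) \<odot>\<^bsub>P\<^esub> s \<in> V" using VD(3) * by metis
        then show ?thesis unfolding I_def using * YD(3) by auto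
      qed
      have mult: "x \<otimes>\<^bsub>R\<^esub> a \<in> I V" if a: "a \<in> I V" "x \<in> carrier R" for a x
      proof -
        from a obtain y where *: "y \<in> Y" "y \<oplus>\<^bsub>P\<^esub> a \<odot>\<^bsub>P\<^esub> s \<in> V" "a \<in> carrier R" unfolding I_def by blast
        have "x \<odot>\<^bsub>P\<^esub> (y \<oplus>\<^bsub>P\<^esub> a \<odot>\<^bsub>P\<^esub> s) = x \<odot>\<^bsub>P\<^esub> y \<oplus>\<^bsub>P\<^esub> (x \<otimes>\<^bsub>R\<^esub> a) \<odot>\<^bsub>P\<^esub> s"
          using * a s YD(6) by (simp add: P.smult_r_distr P.smult_assoc1)
        then have "x \<odot>\<^bsub>P\<^esub> y \<oplus>\<^bsub>P\<^esub> (x \<otimes>\<^bsub>R\<^esub> a) \<odot>\<^bsub>P\<^esub> s \<in> V" using VD(5) * a by metis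
        then show ?thesis unfolding I_def using * YD(5) a by auto
      qed
      have zero: "\<zero>\<^bsub>R\<^esub> \<in> I V"
        unfolding I_def using VD(2) YD(2) s by (auto intro!: bexI[of _ "\<zero>\<^bsub>P\<^esub>"])
      have sub: "I V \<subseteq> carrier R" unfolding I_def by blast
      have inv: "\<ominus>\<^bsub>R\<^esub> a \<in> I V" if "a \<in> I V" for a
        using mult[OF that, of "\<ominus>\<^bsub>R\<^esub> \<one>\<^bsub>R\<^esub>"] that sub by (auto simp: P.R.l_minus)
      have "subgroup (I V) (add_monoid R)"
        using sub zero add inv by unfold_locales (auto simp: a_inv_def[symmetric])
      then show ?thesis
        using mult sub P.R.m_comm by (intro idealI P.R.ring_axioms) (auto simp: subset_iff)
    qed
    obtain T where T: "T \<subseteq> carrier R" "finite T" "I Z' = Idl\<^bsub>R\<^esub> T"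
      using R.finetely_gen[OF I[OF insert.prems(2)]] by blast
    have TI: "T \<subseteq> I Z'" using P.R.genideal_self[OF T(1)] T(3) by simp
    then have "\<forall>r\<in>T. \<exists>y\<in>Y. y \<oplus>\<^bsub>P\<^esub> r \<odot>\<^bsub>P\<^esub> s \<in> Z'" unfolding I_def by blast
    then obtain y where y: "\<And>r. r \<in> T \<Longrightarrow> y r \<in> Y \<and> y r \<oplus>\<^bsub>P\<^esub> r \<odot>\<^bsub>P\<^esub> s \<in> Z'" by metis
    define G where "G = (\<lambda>r. y r \<oplus>\<^bsub>P\<^esub> r \<odot>\<^bsub>P\<^esub> s) ` T"
    obtain S0 where S0: "S0 \<subseteq> Z' \<inter> Y" "finite S0"
      "\<And>N. submodule N R P \<Longrightarrow> S0 \<subseteq> N \<Longrightarrow> W \<subseteq> N \<Longrightarrow> Z' \<inter> Y \<subseteq> N"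
      using IH unfolding fg_over_def by auto
    have Zspan: "\<exists>v\<in>Y. \<exists>r\<in>carrier R. z = v \<oplus>\<^bsub>P\<^esub> r \<odot>\<^bsub>P\<^esub> s" if z: "z \<in> Z'" for z
    proof -
      note SM = self_module_module[OF \<open>cring R\<close>]
      have c: "submodule (carrier (self_module R)) R (self_module R)"
        using module.carrier_is_submodule[OF SM] .
      have sub: "submodule {x \<oplus>\<^bsub>P\<^esub> w |x w. x \<in> Y \<and> w \<in> (\<lambda>r. r \<odot>\<^bsub>P\<^esub> s) ` carrier (self_module R)} R P"
        (is "submodule ?V R P")
        by (rule submodule_sum[OF P Y submodule_image[OF SM P lin c]])
      have "Y \<subseteq> ?V"
      proof
        fix v assume v: "v \<in> Y"
        then have "v = v \<oplus>\<^bsub>P\<^esub> \<zero>\<^bsub>R\<^esub> \<odot>\<^bsub>P\<^esub> s" using s YD(6) by simp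
        then show "v \<in> ?V" using v by (auto simp: self_module_def)
      qed
      moreover have "s \<in> ?V"
      proof -
        have "s = \<zero>\<^bsub>P\<^esub> \<oplus>\<^bsub>P\<^esub> \<one>\<^bsub>R\<^esub> \<odot>\<^bsub>P\<^esub> s" using s by simp
        then show ?thesis using YD(2) P.R.one_closed unfolding self_module_def by (auto 0 4)
      qed
      ultimately have "z \<in> ?V" using insert.prems(3)[OF sub] SY z by blast
      then show ?thesis by (auto simp: self_module_def)
    qed
    have "Z' \<subseteq> N" if N: "submodule N R P" "G \<union> S0 \<subseteq> N" "W \<subseteq> N" for N
    proof
      fix z assume z: "z \<in> Z'"
      have N': "submodule (N \<inter> Z') R P" by (rule submodule_Int[OF P N(1) insert.prems(2)])
      obtain v r where vr: "v \<in> Y" "r \<in> carrier R" "z = v \<oplus>\<^bsub>P\<^esub> r \<odot>\<^bsub>P\<^esub> s" using Zspan[OF z] by blast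
      then have "r \<in> I Z'" unfolding I_def using z by blast
      \<comment> \<open>The lifts \<open>G\<close> of the ideal generators lie in \<open>N\<close>
        and in \<open>Z'\<close>, so the coefficient ideal of \<open>N \<inter> Z'\<close> contains
        that of \<open>Z'\<close>.\<close>
      moreover have "T \<subseteq> I (N \<inter> Z')" using y N(2) T(1) unfolding I_def G_def by blast
      then have "Idl\<^bsub>R\<^esub> T \<subseteq> I (N \<inter> Z')" by (rule P.R.genideal_minimal[OF I[OF N']])
      ultimately obtain w where w: "w \<in> Y" "w \<oplus>\<^bsub>P\<^esub> r \<odot>\<^bsub>P\<^esub> s \<in> N \<inter> Z'" using T(3) unfolding I_def by blast
      define u where "u = w \<oplus>\<^bsub>P\<^esub> r \<odot>\<^bsub>P\<^esub> s"
      have u: "u \<in> N" "u \<in> Z'" using w unfolding u_def by auto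
      \<comment> \<open>\<open>u\<close> has the same coefficient \<open>r\<close> of
        \<open>s\<close> as \<open>z\<close>, so \<open>s\<close> cancels and the difference lies in
        \<open>Y\<close>.\<close>
      have "z \<ominus>\<^bsub>P\<^esub> u = v \<ominus>\<^bsub>P\<^esub> w"
        unfolding u_def vr(3) a_minus_def using vr w s YD(6)
        by (simp add: P.M.minus_add P.M.a_ac P.M.r_neg P.M.r_neg1 P.M.r_neg2)
      then have "z \<ominus>\<^bsub>P\<^esub> u \<in> Z' \<inter> Y" using Z'D(4)[OF z u(2)] YD(4)[OF vr(1) w(1)] by simp
      then have "z \<ominus>\<^bsub>P\<^esub> u \<in> N" using S0(3)[OF N(1)] N by blast
      then have "u \<oplus>\<^bsub>P\<^esub> (z \<ominus>\<^bsub>P\<^esub> u) \<in> N" using submoduleD(3)[OF P N(1)] u(1) by blast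
      then show "z \<in> N" using P.minus_add_cancel Z'D(6) z u(2) by simp
    qed
    moreover have "G \<union> S0 \<subseteq> Z'" "finite (G \<union> S0)" using y T(2) S0 unfolding G_def by auto
    ultimately show ?case unfolding fg_over_def by blast
  qed
  from this[OF S(2) _ Z'(1)] show ?thesis using S(1,3) submoduleD(1)[OF P Z] Z'(2) by blast
qed

section \<open>Finitely generated quotients\<close>

text \<open>Bridges two descriptions of a span: explicit sums, as in \<open>fin_gen_module\<close>,
  and minimality among submodules, as in \<open>fg_over\<close>.\<close>

lemma submodule_combinations:
  assumes P: "module R P" and S: "finite S" "S \<subseteq> carrier P"
  shows "submodule {\<Oplus>\<^bsub>P\<^esub>s\<in>S. c s \<odot>\<^bsub>P\<^esub> s |c. c \<in> S \<rightarrow> carrier R} R P" (is "submodule ?N R P")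
    and "S \<subseteq> {\<Oplus>\<^bsub>P\<^esub>s\<in>S. c s \<odot>\<^bsub>P\<^esub> s |c. c \<in> S \<rightarrow> carrier R}"
proof -
  interpret module R P by fact
  have cl: "(\<lambda>s. c s \<odot>\<^bsub>P\<^esub> s) \<in> S \<rightarrow> carrier P" if "c \<in> S \<rightarrow> carrier R" for c
    using that S by auto
  have "\<zero>\<^bsub>P\<^esub> \<in> ?N"
  proof -
    have "(\<Oplus>\<^bsub>P\<^esub>s\<in>S. \<zero>\<^bsub>R\<^esub> \<odot>\<^bsub>P\<^esub> s) = \<zero>\<^bsub>P\<^esub>" using S by (intro M.add.finprod_one_eqI) auto
    then show ?thesis by (auto intro!: exI[of _ "\<lambda>_. \<zero>\<^bsub>R\<^esub>"])
  qed
  moreover have "x \<oplus>\<^bsub>P\<^esub> y \<in> ?N" if xy: "x \<in> ?N" "y \<in> ?N" for x y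
  proof -
    obtain c d where c: "c \<in> S \<rightarrow> carrier R" "d \<in> S \<rightarrow> carrier R"
      and "x = (\<Oplus>\<^bsub>P\<^esub>s\<in>S. c s \<odot>\<^bsub>P\<^esub> s)" "y = (\<Oplus>\<^bsub>P\<^esub>s\<in>S. d s \<odot>\<^bsub>P\<^esub> s)" using xy by blast
    then have "x \<oplus>\<^bsub>P\<^esub> y = (\<Oplus>\<^bsub>P\<^esub>s\<in>S. c s \<odot>\<^bsub>P\<^esub> s \<oplus>\<^bsub>P\<^esub> d s \<odot>\<^bsub>P\<^esub> s)"
      using M.finsum_addf[OF cl[OF c(1)] cl[OF c(2)]] by simp
    also have "\<dots> = (\<Oplus>\<^bsub>P\<^esub>s\<in>S. (c s \<oplus>\<^bsub>R\<^esub> d s) \<odot>\<^bsub>P\<^esub> s)"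
      by (rule M.add.finprod_cong') (use c S in \<open>auto simp: smult_l_distr Pi_iff subset_iff\<close>)
    finally show ?thesis using c by (auto intro!: exI[of _ "\<lambda>s. c s \<oplus>\<^bsub>R\<^esub> d s"])
  qed
  moreover have "r \<odot>\<^bsub>P\<^esub> x \<in> ?N" if r: "r \<in> carrier R" and x: "x \<in> ?N" for r x
  proof -
    obtain c where c: "c \<in> S \<rightarrow> carrier R" and "x = (\<Oplus>\<^bsub>P\<^esub>s\<in>S. c s \<odot>\<^bsub>P\<^esub> s)" using x by blast
    then have "r \<odot>\<^bsub>P\<^esub> x = (\<Oplus>\<^bsub>P\<^esub>s\<in>S. r \<odot>\<^bsub>P\<^esub> (c s \<odot>\<^bsub>P\<^esub> s))"
      using finsum_smult_ldistr[OF S(1) r cl[OF c]] by simp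
    also have "\<dots> = (\<Oplus>\<^bsub>P\<^esub>s\<in>S. (r \<otimes>\<^bsub>R\<^esub> c s) \<odot>\<^bsub>P\<^esub> s)"
      by (rule M.add.finprod_cong') (use c S r in \<open>auto simp: smult_assoc1 Pi_iff subset_iff\<close>)
    finally show ?thesis using c r by (auto intro!: exI[of _ "\<lambda>s. r \<otimes>\<^bsub>R\<^esub> c s"])
  qed
  ultimately show "submodule ?N R P"
    using M.finsum_closed[OF cl] unfolding submodule_iff[OF P] by auto
  show "S \<subseteq> ?N"
  proof
    fix t assume t: "t \<in> S"
    then have tc: "t \<in> carrier P" using S by blast
    have "(\<Oplus>\<^bsub>P\<^esub>s\<in>S. (if s = t then \<one>\<^bsub>R\<^esub> else \<zero>\<^bsub>R\<^esub>) \<odot>\<^bsub>P\<^esub> s) = (\<Oplus>\<^bsub>P\<^esub>s\<in>S. if t = s then s else \<zero>\<^bsub>P\<^esub>)"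
      by (rule M.add.finprod_cong') (use S in auto)
    also have "\<dots> = t" using M.add.finprod_singleton[OF t S(1), of "\<lambda>s. s"] S(2) by auto
    finally show "t \<in> ?N" by (auto intro!: exI[of _ "\<lambda>s. if s = t then \<one>\<^bsub>R\<^esub> else \<zero>\<^bsub>R\<^esub>"])
  qed
qed

lemma finsum_in_submodule:
  assumes P: "module R P" and N: "submodule N R P" and f: "\<And>s. s \<in> S \<Longrightarrow> f s \<in> N"
  shows "(\<Oplus>\<^bsub>P\<^esub>s\<in>S. f s) \<in> N"
proof -
  interpret module R P by fact
  note D = submoduleD[OF P N]
  show ?thesis
  proof (cases "finite S")
    case True
    then show ?thesis using f
    proof induction
      case (insert s S)
      then have "f \<in> S \<rightarrow> carrier P" "f s \<in> carrier P" using D(6) by auto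
      then show ?case using insert D(3) by simp
    qed (simp add: D(2))
  qed (simp add: D(2) M.add.finprod_infinite)
qed

lemma fin_gen_module_iff:
  assumes P: "module R P"
  shows "fin_gen_module R P \<longleftrightarrow> fg_over R P (carrier P) {\<zero>\<^bsub>P\<^esub>}"
proof
  assume "fin_gen_module R P"
  then obtain S where S: "S \<subseteq> carrier P" "finite S"
    "\<And>y. y \<in> carrier P \<Longrightarrow> \<exists>c\<in>S \<rightarrow> carrier R. y = (\<Oplus>\<^bsub>P\<^esub>s\<in>S. c s \<odot>\<^bsub>P\<^esub> s)"
    unfolding fin_gen_module_def by blast
  have "carrier P \<subseteq> N" if N: "submodule N R P" "S \<subseteq> N" for N
  proof
    fix y assume "y \<in> carrier P"
    then obtain c where "c \<in> S \<rightarrow> carrier R" "y = (\<Oplus>\<^bsub>P\<^esub>s\<in>S. c s \<odot>\<^bsub>P\<^esub> s)" using S(3) by blast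
    then show "y \<in> N" using N submoduleD(5)[OF P N(1)] by (auto intro!: finsum_in_submodule[OF P N(1)])
  qed
  then show "fg_over R P (carrier P) {\<zero>\<^bsub>P\<^esub>}" using S(1,2) unfolding fg_over_def by blast
next
  assume "fg_over R P (carrier P) {\<zero>\<^bsub>P\<^esub>}"
  then obtain S where S: "S \<subseteq> carrier P" "finite S"
    "\<And>N. submodule N R P \<Longrightarrow> S \<subseteq> N \<Longrightarrow> {\<zero>\<^bsub>P\<^esub>} \<subseteq> N \<Longrightarrow> carrier P \<subseteq> N" unfolding fg_over_def by auto
  have "carrier P \<subseteq> {\<Oplus>\<^bsub>P\<^esub>s\<in>S. c s \<odot>\<^bsub>P\<^esub> s |c. c \<in> S \<rightarrow> carrier R}"
    by (rule S(3)[OF submodule_combinations[OF P S(2,1)]])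
       (use submoduleD(2)[OF P submodule_combinations(1)[OF P S(2,1)]] in blast)
  then show "fin_gen_module R P" using S(1,2) unfolding fin_gen_module_def by blast
qed

lemma submodule_restrict_iff:
  assumes P: "module R P" and Z: "submodule Z R P"
  shows "submodule N R (P\<lparr>carrier := Z\<rparr>) \<longleftrightarrow> submodule N R P \<and> N \<subseteq> Z"
  using submoduleD(1)[OF P Z] by (auto simp: submodule_iff[OF P] submodule_iff[OF submodule_module[OF P Z]])

lemma fg_over_restrict:
  assumes P: "module R P" and Z: "submodule Z R P" and "Z' \<subseteq> Z" "W \<subseteq> Z"
  shows "fg_over R (P\<lparr>carrier := Z\<rparr>) Z' W \<longleftrightarrow> fg_over R P Z' W"
proof
  assume "fg_over R (P\<lparr>carrier := Z\<rparr>) Z' W"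
  then obtain S where S: "S \<subseteq> Z'" "finite S"
    "\<And>N. submodule N R (P\<lparr>carrier := Z\<rparr>) \<Longrightarrow> S \<subseteq> N \<Longrightarrow> W \<subseteq> N \<Longrightarrow> Z' \<subseteq> N"
    by (rule fg_overE) blast
  have "Z' \<subseteq> N" if N: "submodule N R P" "S \<subseteq> N" "W \<subseteq> N" for N
  proof -
    have "submodule (N \<inter> Z) R (P\<lparr>carrier := Z\<rparr>)"
      unfolding submodule_restrict_iff[OF P Z] using submodule_Int[OF P N(1) Z] by simp
    moreover have "S \<subseteq> N \<inter> Z" "W \<subseteq> N \<inter> Z" using N S(1) assms(3,4) by auto
    ultimately have "Z' \<subseteq> N \<inter> Z" by (rule S(3))
    then show ?thesis by simp
  qed
  then show "fg_over R P Z' W" using S(1,2) by (rule fg_overI[rotated 2])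
next
  assume "fg_over R P Z' W"
  then obtain S where S: "S \<subseteq> Z'" "finite S"
    "\<And>N. submodule N R P \<Longrightarrow> S \<subseteq> N \<Longrightarrow> W \<subseteq> N \<Longrightarrow> Z' \<subseteq> N"
    by (rule fg_overE) blast
  have "Z' \<subseteq> N" if "submodule N R (P\<lparr>carrier := Z\<rparr>)" "S \<subseteq> N" "W \<subseteq> N" for N
    using S(3)[OF _ that(2,3)] that(1) by (simp add: submodule_restrict_iff[OF P Z])
  then show "fg_over R (P\<lparr>carrier := Z\<rparr>) Z' W" using S(1,2) by (rule fg_overI[rotated 2])
qed

lemma quotient_projection:
  assumes P: "module R P" and B: "submodule B R P"
  shows "linear_on R P (quotient_module P B) (\<lambda>x. B +>\<^bsub>P\<^esub> x)"
    and "(\<lambda>x. B +>\<^bsub>P\<^esub> x) ` carrier P = carrier (quotient_module P B)"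
    and "x \<in> carrier P \<Longrightarrow> B +>\<^bsub>P\<^esub> x = \<zero>\<^bsub>quotient_module P B\<^esub> \<longleftrightarrow> x \<in> B"
proof -
  interpret module R P by fact
  interpret A: abelian_subgroup B P
    using B by (intro abelian_subgroupI3 additive_subgroup.intro abelian_group_axioms) (simp add: submodule_def)
  show c: "(\<lambda>x. B +>\<^bsub>P\<^esub> x) ` carrier P = carrier (quotient_module P B)"
    by (auto simp: quotient_module_def A_RCOSETS_def RCOSETS_def a_r_coset_def)
  show "linear_on R P (quotient_module P B) (\<lambda>x. B +>\<^bsub>P\<^esub> x)"
    unfolding linear_on_def
  proof (intro conjI ballI)
    fix r x assume "r \<in> carrier R" "x \<in> carrier P"
    then show "B +>\<^bsub>P\<^esub> r \<odot>\<^bsub>P\<^esub> x = r \<odot>\<^bsub>quotient_module P B\<^esub> (B +>\<^bsub>P\<^esub> x)"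
      using quotient_smult[OF P B] by simp
  qed (use c A.a_rcos_sum in \<open>auto simp: quotient_module_def\<close>)
  show "B +>\<^bsub>P\<^esub> x = \<zero>\<^bsub>quotient_module P B\<^esub> \<longleftrightarrow> x \<in> B" if x: "x \<in> carrier P"
  proof
    assume "B +>\<^bsub>P\<^esub> x = \<zero>\<^bsub>quotient_module P B\<^esub>"
    then show "x \<in> B" using A.a_rcos_self[OF x] by (simp add: quotient_module_def)
  next
    assume "x \<in> B"
    then show "B +>\<^bsub>P\<^esub> x = \<zero>\<^bsub>quotient_module P B\<^esub>"
      using A.a_rcos_const by (simp add: quotient_module_def)
  qed
qed

text \<open>Translates between cohomology modules, whose elements are cosets, and
  \<open>fg_over\<close>, which stays inside the ambient module.\<close>

lemma fin_gen_quotient_iff: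
  assumes P: "module R P" and Z: "submodule Z R P" and B: "submodule B R P" "B \<subseteq> Z"
  shows "fin_gen_module R (quotient_module (P\<lparr>carrier := Z\<rparr>) B) \<longleftrightarrow> fg_over R P Z B"
proof -
  let ?P = "P\<lparr>carrier := Z\<rparr>"
  let ?Q = "quotient_module ?P B" and ?\<pi> = "\<lambda>x. B +>\<^bsub>?P\<^esub> x"
  have P': "module R ?P" by (rule submodule_module[OF P Z])
  have B': "submodule B R ?P" using B by (simp add: submodule_restrict_iff[OF P Z])
  have Q: "module R ?Q" by (rule quotient_module_module[OF P' B'])
  note \<pi> = quotient_projection[OF P' B']
  have im: "?\<pi> ` Z = carrier ?Q" using \<pi>(2) by simp
  have imB: "?\<pi> ` B = {\<zero>\<^bsub>?Q\<^esub>}"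
  proof -
    have "?\<pi> x = \<zero>\<^bsub>?Q\<^esub>" if "x \<in> B" for x using \<pi>(3)[of x] that B(2) by auto
    then show ?thesis using submoduleD(2)[OF P B(1)] by auto
  qed
  have "fin_gen_module R ?Q \<longleftrightarrow> fg_over R ?P Z B"
    unfolding fin_gen_module_iff[OF Q]
  proof
    assume fg: "fg_over R ?Q (carrier ?Q) {\<zero>\<^bsub>?Q\<^esub>}"
    have Zs: "submodule Z R ?P" using Z by (simp add: submodule_restrict_iff[OF P Z])
    have lin: "linear_on R (?P\<lparr>carrier := Z\<rparr>) ?Q ?\<pi>" using \<pi>(1) by simp
    show "fg_over R ?P Z B"
    proof (rule fg_over_extension[OF P' Q Zs lin submodule_zero[OF Q]])
      show "fg_over R ?Q (?\<pi> ` Z) {\<zero>\<^bsub>?Q\<^esub>}" unfolding im by (rule fg)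
      show "fg_over R ?P {z \<in> Z. ?\<pi> z \<in> {\<zero>\<^bsub>?Q\<^esub>}} B" using \<pi>(3) by (intro fg_over_subset) auto
    qed
  next
    assume "fg_over R ?P Z B"
    from fg_over_image[OF P' Q \<pi>(1) _ _ this] show "fg_over R ?Q (carrier ?Q) {\<zero>\<^bsub>?Q\<^esub>}"
      using B(2) im imB by simp
  qed
  then show ?thesis using fg_over_restrict[OF P Z _ B(2)] by blast
qed

section \<open>Homomorphism modules\<close>

lemma linear_mapsD:
  assumes "f \<in> linear_maps R P N"
  shows "linear_on R P N f" "f \<in> extensional (carrier P)"
    "x \<in> carrier P \<Longrightarrow> f x \<in> carrier N"
  using assms by (auto simp: linear_maps_iff linear_on_def)

lemma hom_module_simps:
  "carrier (hom_module R P N) = linear_maps R P N"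
  "x \<in> carrier P \<Longrightarrow> \<zero>\<^bsub>hom_module R P N\<^esub> x = \<zero>\<^bsub>N\<^esub>"
  "x \<in> carrier P \<Longrightarrow> (f \<oplus>\<^bsub>hom_module R P N\<^esub> g) x = f x \<oplus>\<^bsub>N\<^esub> g x"
  "x \<in> carrier P \<Longrightarrow> (r \<odot>\<^bsub>hom_module R P N\<^esub> f) x = r \<odot>\<^bsub>N\<^esub> f x"
  by (simp_all add: hom_module_def)

lemma linear_maps_eqI:
  assumes "f \<in> linear_maps R P N" "g \<in> linear_maps R P N'" "\<And>x. x \<in> carrier P \<Longrightarrow> f x = g x"
  shows "f = g"
  using assms by (auto simp: linear_maps_iff intro: extensionalityI)

lemma hom_module_closed:
  assumes P: "module R P" and N: "module R N"
  shows "\<zero>\<^bsub>hom_module R P N\<^esub> \<in> linear_maps R P N"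
    and "f \<in> linear_maps R P N \<Longrightarrow> g \<in> linear_maps R P N \<Longrightarrow> f \<oplus>\<^bsub>hom_module R P N\<^esub> g \<in> linear_maps R P N"
    and "r \<in> carrier R \<Longrightarrow> f \<in> linear_maps R P N \<Longrightarrow> r \<odot>\<^bsub>hom_module R P N\<^esub> f \<in> linear_maps R P N"
proof -
  interpret P: module R P by fact
  interpret N: module R N by fact
  show "\<zero>\<^bsub>hom_module R P N\<^esub> \<in> linear_maps R P N"
    by (auto simp: linear_maps_iff linear_on_def hom_module_def)
  show "f \<oplus>\<^bsub>hom_module R P N\<^esub> g \<in> linear_maps R P N"
    if "f \<in> linear_maps R P N" "g \<in> linear_maps R P N"
    using linear_onD[OF linear_mapsD(1)[OF that(1)]] linear_onD[OF linear_mapsD(1)[OF that(2)]]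
    by (auto simp: linear_maps_iff linear_on_def hom_module_def N.M.a_ac N.smult_r_distr)
  show "r \<odot>\<^bsub>hom_module R P N\<^esub> f \<in> linear_maps R P N"
    if "r \<in> carrier R" "f \<in> linear_maps R P N"
    using linear_onD[OF linear_mapsD(1)[OF that(2)]] that(1)
    by (auto simp: linear_maps_iff linear_on_def hom_module_def N.smult_r_distr
        N.smult_assoc1[symmetric] P.R.m_comm)
qed

lemma hom_module_module:
  assumes P: "module R P" and N: "module R N"
  shows "module R (hom_module R P N)"
proof -
  interpret P: module R P by fact
  interpret N: module R N by fact
  let ?H = "hom_module R P N"
  note cl = hom_module_closed[OF P N] and c = linear_mapsD(3)
  note eq = linear_maps_eqI[where N' = N]
  show ?thesis
  proof (intro moduleI abelian_groupI P.R.is_cring; (unfold hom_module_simps(1))?)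
    fix f assume f: "f \<in> linear_maps R P N"
    show "\<exists>g\<in>linear_maps R P N. g \<oplus>\<^bsub>?H\<^esub> f = \<zero>\<^bsub>?H\<^esub>"
    proof
      show g: "(\<ominus>\<^bsub>R\<^esub> \<one>\<^bsub>R\<^esub>) \<odot>\<^bsub>?H\<^esub> f \<in> linear_maps R P N" using f by (intro cl) auto
      show "(\<ominus>\<^bsub>R\<^esub> \<one>\<^bsub>R\<^esub>) \<odot>\<^bsub>?H\<^esub> f \<oplus>\<^bsub>?H\<^esub> f = \<zero>\<^bsub>?H\<^esub>"
        by (rule eq[OF cl(2)[OF g f] cl(1)])
           (use c[OF f] in \<open>simp add: hom_module_simps N.smult_l_minus N.M.l_neg\<close>)
    qed
  next
    fix f g h assume "f \<in> linear_maps R P N" "g \<in> linear_maps R P N" "h \<in> linear_maps R P N"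
    then show "f \<oplus>\<^bsub>?H\<^esub> g \<oplus>\<^bsub>?H\<^esub> h = f \<oplus>\<^bsub>?H\<^esub> (g \<oplus>\<^bsub>?H\<^esub> h)"
      by (intro eq) (auto intro!: cl simp: hom_module_simps c N.M.a_assoc)
  next
    fix f g assume "f \<in> linear_maps R P N" "g \<in> linear_maps R P N"
    then show "f \<oplus>\<^bsub>?H\<^esub> g = g \<oplus>\<^bsub>?H\<^esub> f"
      by (intro eq) (auto intro!: cl simp: hom_module_simps c N.M.a_comm)
  next
    fix f assume "f \<in> linear_maps R P N"
    then show "\<zero>\<^bsub>?H\<^esub> \<oplus>\<^bsub>?H\<^esub> f = f"
      by (intro eq) (auto intro!: cl simp: hom_module_simps c)
  next
    fix f assume "f \<in> linear_maps R P N"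
    then show "\<one>\<^bsub>R\<^esub> \<odot>\<^bsub>?H\<^esub> f = f"
      by (intro eq) (auto intro!: cl simp: hom_module_simps c)
  next
    fix a b f assume "a \<in> carrier R" "b \<in> carrier R" "f \<in> linear_maps R P N"
    then show "(a \<oplus>\<^bsub>R\<^esub> b) \<odot>\<^bsub>?H\<^esub> f = a \<odot>\<^bsub>?H\<^esub> f \<oplus>\<^bsub>?H\<^esub> b \<odot>\<^bsub>?H\<^esub> f"
      by (intro eq) (auto intro!: cl simp: hom_module_simps c N.smult_l_distr)
  next
    fix a f g assume "a \<in> carrier R" "f \<in> linear_maps R P N" "g \<in> linear_maps R P N"
    then show "a \<odot>\<^bsub>?H\<^esub> (f \<oplus>\<^bsub>?H\<^esub> g) = a \<odot>\<^bsub>?H\<^esub> f \<oplus>\<^bsub>?H\<^esub> a \<odot>\<^bsub>?H\<^esub> g"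
      by (intro eq) (auto intro!: cl simp: hom_module_simps c N.smult_r_distr)
  next
    fix a b f assume "a \<in> carrier R" "b \<in> carrier R" "f \<in> linear_maps R P N"
    then show "(a \<otimes>\<^bsub>R\<^esub> b) \<odot>\<^bsub>?H\<^esub> f = a \<odot>\<^bsub>?H\<^esub> (b \<odot>\<^bsub>?H\<^esub> f)"
      by (intro eq) (auto intro!: cl simp: hom_module_simps c N.smult_assoc1)
  qed (auto intro: cl)
qed

lemma compose_linear:
  assumes "module R P" "linear_on R P P' f" "linear_on R P' N g"
  shows "compose (carrier P) g f \<in> linear_maps R P N"
proof -
  interpret module R P by fact
  note f = linear_onD[OF assms(2)] and g = linear_onD[OF assms(3)]
  show ?thesis by (auto simp: linear_maps_iff linear_on_def compose_def f g)
qed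

lemma compose_apply: "x \<in> A \<Longrightarrow> compose A g f x = g (f x)"
  by (simp add: compose_def)

lemma hom_precompose_linear:
  assumes P: "module R P" and P': "module R P'" and N: "module R N" and f: "linear_on R P P' f"
  shows "linear_on R (hom_module R P' N) (hom_module R P N) (\<lambda>g. compose (carrier P) g f)"
  unfolding linear_on_def hom_module_simps(1)
proof (intro conjI ballI)
  note cl = hom_module_closed[OF P' N] and cl' = hom_module_closed[OF P N]
  have c: "compose (carrier P) g f \<in> linear_maps R P N" if "g \<in> linear_maps R P' N" for g
    by (rule compose_linear[OF P f linear_mapsD(1)[OF that]])
  fix g assume g: "g \<in> linear_maps R P' N"
  show "compose (carrier P) g f \<in> linear_maps R P N" by (rule c[OF g])
  show "compose (carrier P) (r \<odot>\<^bsub>hom_module R P' N\<^esub> g) f = r \<odot>\<^bsub>hom_module R P N\<^esub> compose (carrier P) g f"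
    if r: "r \<in> carrier R" for r
    by (rule linear_maps_eqI[OF c[OF cl(3)[OF r g]] cl'(3)[OF r c[OF g]]])
       (simp add: hom_module_simps compose_apply linear_onD(1)[OF f])
  fix h assume h: "h \<in> linear_maps R P' N"
  show "compose (carrier P) (g \<oplus>\<^bsub>hom_module R P' N\<^esub> h) f =
     compose (carrier P) g f \<oplus>\<^bsub>hom_module R P N\<^esub> compose (carrier P) h f"
    by (rule linear_maps_eqI[OF c[OF cl(2)[OF g h]] cl'(2)[OF c[OF g] c[OF h]]])
       (simp add: hom_module_simps compose_apply linear_onD(1)[OF f])
qed

lemma hom_postcompose_linear:
  assumes P: "module R P" and N: "module R N" and N': "module R N'" and f: "linear_on R N N' f"
  shows "linear_on R (hom_module R P N) (hom_module R P N') (\<lambda>g. compose (carrier P) f g)"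
  unfolding linear_on_def hom_module_simps(1)
proof (intro conjI ballI)
  note cl = hom_module_closed[OF P N] and cl' = hom_module_closed[OF P N']
  have c: "compose (carrier P) f g \<in> linear_maps R P N'" if "g \<in> linear_maps R P N" for g
    by (rule compose_linear[OF P linear_mapsD(1)[OF that] f])
  fix g assume g: "g \<in> linear_maps R P N"
  show "compose (carrier P) f g \<in> linear_maps R P N'" by (rule c[OF g])
  show "compose (carrier P) f (r \<odot>\<^bsub>hom_module R P N\<^esub> g) = r \<odot>\<^bsub>hom_module R P N'\<^esub> compose (carrier P) f g"
    if r: "r \<in> carrier R" for r
    by (rule linear_maps_eqI[OF c[OF cl(3)[OF r g]] cl'(3)[OF r c[OF g]]])
       (simp add: hom_module_simps compose_apply linear_onD(3)[OF f r] linear_mapsD(3)[OF g])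
  fix h assume h: "h \<in> linear_maps R P N"
  show "compose (carrier P) f (g \<oplus>\<^bsub>hom_module R P N\<^esub> h) =
     compose (carrier P) f g \<oplus>\<^bsub>hom_module R P N'\<^esub> compose (carrier P) f h"
    by (rule linear_maps_eqI[OF c[OF cl(2)[OF g h]] cl'(2)[OF c[OF g] c[OF h]]])
       (simp add: hom_module_simps compose_apply linear_onD(2)[OF f] linear_mapsD(3)[OF g] linear_mapsD(3)[OF h])
qed

text \<open>Supplies the vanishing row and column of the double complex in degree -1.\<close>

lemma hom_trivial:
  assumes P: "module R P" and N: "module R N" and "carrier P = {\<zero>\<^bsub>P\<^esub>} \<or> carrier N = {\<zero>\<^bsub>N\<^esub>}"
  shows "carrier (hom_module R P N) = {\<zero>\<^bsub>hom_module R P N\<^esub>}"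
proof -
  have "f = \<zero>\<^bsub>hom_module R P N\<^esub>" if f: "f \<in> linear_maps R P N" for f
  proof (rule linear_maps_eqI[OF f hom_module_closed(1)[OF P N]])
    fix x assume x: "x \<in> carrier P"
    have "x = \<zero>\<^bsub>P\<^esub> \<or> f x = \<zero>\<^bsub>N\<^esub>" using assms(3) linear_mapsD(3)[OF f x] x by blast
    then have "f x = \<zero>\<^bsub>N\<^esub>" using linear_zero[OF P N f] by metis
    then show "f x = \<zero>\<^bsub>hom_module R P N\<^esub> x" using x by (simp add: hom_module_simps)
  qed
  then show ?thesis using hom_module_closed(1)[OF P N] unfolding hom_module_simps(1) by blast
qed

text \<open>Serves both complexes. For the resolution, the last part turns Ext into cocycles over
  coboundaries. For the Koszul complex, the third part gives that the dual differential squares to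
  zero, and the fourth identifies the cohomology modules of the hypothesis.\<close>

lemma fin_gen_hom_cohomology_iff:
  fixes F :: "int \<Rightarrow> ('a, 'p) module" and d :: "int \<Rightarrow> 'p \<Rightarrow> 'p"
  assumes F: "\<And>i. module R (F i)" and N: "module R N"
    and d: "\<And>i. linear_on R (F i) (F (i - 1)) (d i)"
    and dd: "\<And>i x. x \<in> carrier (F i) \<Longrightarrow> d (i - 1) (d i x) = \<zero>\<^bsub>F (i - 1 - 1)\<^esub>"
  defines "Z \<equiv> \<lambda>i. {f \<in> linear_maps R (F i) N.
      compose (carrier (F (i + 1))) f (d (i + 1)) = \<zero>\<^bsub>hom_module R (F (i + 1)) N\<^esub>}"
    and "B \<equiv> \<lambda>i. (\<lambda>g. compose (carrier (F i)) g (d i)) ` linear_maps R (F (i - 1)) N"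
  shows "submodule (Z i) R (hom_module R (F i) N)" "submodule (B i) R (hom_module R (F i) N)" "B i \<subseteq> Z i"
    and "hom_cohomology R F d N i = quotient_module (hom_module R (F i) N\<lparr>carrier := Z i\<rparr>) (B i)"
    and "fin_gen_module R (hom_cohomology R F d N i) \<longleftrightarrow> fg_over R (hom_module R (F i) N) (Z i) (B i)"
proof -
  have d': "linear_on R (F (i + 1)) (F i) (d (i + 1))" using d[of "i + 1"] by simp
  note H = hom_module_module[OF F N]
  show 1: "submodule (Z i) R (hom_module R (F i) N)"
    using submodule_kernel[OF H H hom_precompose_linear[OF F F N d']] by (simp add: Z_def hom_module_simps)
  show 2: "submodule (B i) R (hom_module R (F i) N)"
    using submodule_image[OF H H hom_precompose_linear[OF F F N d] module.carrier_is_submodule[OF H]]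
    by (simp add: B_def hom_module_simps)
  show 3: "B i \<subseteq> Z i"
  proof
    fix f assume "f \<in> B i"
    then obtain g where g: "g \<in> linear_maps R (F (i - 1)) N" "f = compose (carrier (F i)) g (d i)"
      unfolding B_def by blast
    have f: "f \<in> linear_maps R (F i) N" unfolding g(2) by (rule compose_linear[OF F d linear_mapsD(1)[OF g(1)]])
    have "compose (carrier (F (i + 1))) f (d (i + 1)) = \<zero>\<^bsub>hom_module R (F (i + 1)) N\<^esub>"
    proof (rule linear_maps_eqI[OF compose_linear[OF F d' linear_mapsD(1)[OF f]] hom_module_closed(1)[OF F N]])
      fix x assume x: "x \<in> carrier (F (i + 1))"
      have "d i (d (i + 1) x) = \<zero>\<^bsub>F (i - 1)\<^esub>" using dd[OF x] by simp
      then show "compose (carrier (F (i + 1))) f (d (i + 1)) x = \<zero>\<^bsub>hom_module R (F (i + 1)) N\<^esub> x"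
        using x linear_onD(1)[OF d' x] linear_on_zero[OF F N linear_mapsD(1)[OF g(1)]]
        by (simp add: compose_apply g(2) hom_module_simps)
    qed
    then show "f \<in> Z i" using f by (simp add: Z_def)
  qed
  have K: "a_kernel (hom_module R (F i) N) (hom_module R (F (i + 1)) N)
      (\<lambda>f\<in>linear_maps R (F i) N. compose (carrier (F (i + 1))) f (d (i + 1))) = Z i"
    by (auto simp: a_kernel_def kernel_def Z_def hom_module_simps)
  \<comment> \<open>The map leaving degree \<open>i\<close> is built from \<open>d (i + 1)\<close>;
    for the one arriving in degree \<open>i\<close> this yields the index
    \<open>i - 1 + 1\<close>.\<close>
  have I: "(\<lambda>f\<in>linear_maps R (F (i - 1)) N. compose (carrier (F (i - 1 + 1))) f (d (i - 1 + 1)))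
      ` carrier (hom_module R (F (i - 1)) N) = B i"
    by (auto simp: B_def hom_module_simps)
  show 4: "hom_cohomology R F d N i = quotient_module (hom_module R (F i) N\<lparr>carrier := Z i\<rparr>) (B i)"
    unfolding hom_cohomology_def cohomology_def K I ..
  show "fin_gen_module R (hom_cohomology R F d N i) \<longleftrightarrow> fg_over R (hom_module R (F i) N) (Z i) (B i)"
    unfolding 4 by (rule fin_gen_quotient_iff[OF H 1 2 3])
qed

section \<open>Projectivity of free modules\<close>

lemma linear_on_free_eqI:
  assumes "module R N" and f: "linear_on R (free_module R B) N f" and g: "linear_on R (free_module R B) N g"
    and eq: "\<And>b. b \<in> B \<Longrightarrow> f (basis_elem R b) = g (basis_elem R b)"
    and x: "x \<in> carrier (free_module R B)"
  shows "f x = g x"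
proof -
  interpret module R N by fact
  let ?F = "free_module R B"
  interpret F: module R ?F by (rule free_module_module[OF R.is_cring])
  let ?r = "\<lambda>f. restrict f (carrier ?F)"
  have l: "?r f \<in> linear_maps R ?F N" if "linear_on R ?F N f" for f
    using that F.M.add.m_closed F.smult_closed by (auto simp: linear_maps_iff linear_on_def)
  obtain ts where ts: "set ts \<subseteq> carrier R \<times> B" "x = list_comb (free_module R UNIV) (basis_elem R) ts"
    using free_as_list[OF R.is_cring x] by blast
  have x': "x = list_comb ?F (basis_elem R) ts" unfolding ts(2) list_comb_free[of R B] ..
  have be: "basis_elem R \<in> B \<rightarrow> carrier ?F" using basis_elem_in[OF R.is_cring] by auto
  have "?r f x = list_comb N (\<lambda>b. ?r f (basis_elem R b)) ts" if "linear_on R ?F N f" for f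
    unfolding x' by (rule linear_list_comb[OF F.module_axioms module_axioms l[OF that] ts(1) be])
  moreover have "list_comb N (\<lambda>b. ?r f (basis_elem R b)) ts = list_comb N (\<lambda>b. ?r g (basis_elem R b)) ts"
    using ts(1) eq be by (intro list_comb_cong) auto
  ultimately have "?r f x = ?r g x" using f g by simp
  then show ?thesis using x by simp
qed

text \<open>Preimages are chosen on the basis and extended linearly. Containment of images, in place
  of surjectivity, lets \<open>p\<close> be a differential as well as a quotient map.\<close>

lemma free_module_projective:
  assumes N: "module R N" and N': "module R N'" and p: "linear_on R N N' p"
    and f: "linear_on R (free_module R B) N' f" and im: "f ` carrier (free_module R B) \<subseteq> p ` carrier N"
  shows "\<exists>g\<in>linear_maps R (free_module R B) N. \<forall>x\<in>carrier (free_module R B). p (g x) = f x"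
proof -
  interpret module R N by fact
  let ?F = "free_module R B"
  have F: "module R ?F" by (rule free_module_module[OF R.is_cring])
  have "f (basis_elem R b) \<in> p ` carrier N" if "b \<in> B" for b
    using im basis_elem_in[OF R.is_cring that] by (rule subsetD[OF _ imageI])
  then have "\<forall>b\<in>B. \<exists>n. n \<in> carrier N \<and> f (basis_elem R b) = p n" by (auto elim!: imageE)
  from bchoice[OF this] obtain \<phi> where \<phi>: "\<And>b. b \<in> B \<Longrightarrow> \<phi> b \<in> carrier N \<and> f (basis_elem R b) = p (\<phi> b)"
    by blast
  then have \<phi>c: "\<phi> \<in> B \<rightarrow> carrier N" by blast
  note g = free_lift_linear[OF N \<phi>c]
  have pg: "linear_on R ?F N' (compose (carrier ?F) p (free_lift R B N \<phi>))"
    by (rule linear_mapsD(1)[OF compose_linear[OF F linear_mapsD(1)[OF g] p]])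
  have "p (free_lift R B N \<phi> x) = f x" if x: "x \<in> carrier ?F" for x
  proof -
    have "compose (carrier ?F) p (free_lift R B N \<phi>) x = f x"
      by (rule linear_on_free_eqI[OF N' pg f _ x])
         (use \<phi> in \<open>simp add: compose_apply basis_elem_in[OF R.is_cring] free_lift_basis[OF N \<phi>c]\<close>)
    then show ?thesis using x by (simp add: compose_apply)
  qed
  then show ?thesis using g by blast
qed

text \<open>This is how finite generation of \<open>Ext\<close> with values in the cohomology of \<open>K \<rightarrow> K' \<rightarrow> K''\<close> at
  \<open>K'\<close> is expressed inside the double complex \<open>Hom (F, K)\<close>.\<close>

lemma fg_over_hom_cohomology_module:
  fixes R :: "('a, 'r) ring_scheme" and K :: "('a, 'k) module" and K' :: "('a, 'k') module"
    and Bs Bs' Bs'' :: "'b set"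
  defines "F \<equiv> free_module R Bs" and "F' \<equiv> free_module R Bs'" and "F'' \<equiv> free_module R Bs''"
  assumes R: "cring R" "noetherian_ring R"
    and K: "module R K" and K': "module R K'"
    and d: "linear_on R F F' d" and d': "linear_on R F' F'' d'"
    and dd: "\<And>x. x \<in> carrier F \<Longrightarrow> d' (d x) = \<zero>\<^bsub>F''\<^esub>"
    and u: "linear_on R K K' u" and Z: "submodule Z R K'" and uZ: "u ` carrier K \<subseteq> Z"
  defines "Q \<equiv> quotient_module (K'\<lparr>carrier := Z\<rparr>) (u ` carrier K)"
  assumes fg: "fg_over R (hom_module R F' Q)
      {f \<in> linear_maps R F' Q. compose (carrier F) f d = \<zero>\<^bsub>hom_module R F Q\<^esub>}
      ((\<lambda>g. compose (carrier F') g d') ` linear_maps R F'' Q)"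
  shows "fg_over R (hom_module R F' K')
      {c \<in> linear_maps R F' K'. c ` carrier F' \<subseteq> Z \<and>
         compose (carrier F) c d \<in> (\<lambda>w. compose (carrier F) u w) ` linear_maps R F K}
      {v \<oplus>\<^bsub>hom_module R F' K'\<^esub> h |v h.
         v \<in> (\<lambda>e. compose (carrier F') e d') ` {e \<in> linear_maps R F'' K'. e ` carrier F'' \<subseteq> Z} \<and>
         h \<in> (\<lambda>w. compose (carrier F') u w) ` linear_maps R F' K}"
    (is "fg_over R ?H ?Z ?W")
proof -
  let ?K = "K'\<lparr>carrier := Z\<rparr>" and ?B = "u ` carrier K"
  have F: "module R F" "module R F'" "module R F''" unfolding F_def F'_def F''_def by (rule free_module_module[OF R(1)])+
  have B: "submodule ?B R K'" by (rule submodule_image[OF K K' u module.carrier_is_submodule[OF K]])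
  have ZK: "module R ?K" by (rule submodule_module[OF K' Z])
  have B': "submodule ?B R ?K" using B uZ by (simp add: submodule_restrict_iff[OF K' Z])
  have Q: "module R Q" unfolding Q_def by (rule quotient_module_module[OF ZK B'])
  define \<pi> where "\<pi> = (\<lambda>x. ?B +>\<^bsub>?K\<^esub> x)"
  have \<pi>: "linear_on R ?K Q \<pi>" "\<pi> ` Z = carrier Q" "\<And>x. x \<in> Z \<Longrightarrow> \<pi> x = \<zero>\<^bsub>Q\<^esub> \<longleftrightarrow> x \<in> ?B"
    using quotient_projection[OF ZK B'] unfolding \<pi>_def Q_def by simp_all
  have H: "module R ?H" by (rule hom_module_module[OF F(2) K'])
  interpret H: module R ?H by (rule H)
  interpret K': module R K' by (rule K')
  interpret Q: module R Q by (rule Q)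
  have toZ: "linear_on R P ?K c" if "linear_on R P K' c" "c ` carrier P \<subseteq> Z" for P :: "('a, 'b \<Rightarrow> 'a) module" and c
    using that by (auto simp: linear_on_def)
  have fromZ: "linear_on R P K' c" if "linear_on R P ?K c" for P :: "('a, 'b \<Rightarrow> 'a) module" and c
    using that submoduleD(1)[OF K' Z] by (auto simp: linear_on_def)
  have Zsub: "submodule ?Z R ?H"
  proof -
    have 1: "submodule {c \<in> linear_maps R F' K'. c ` carrier F' \<subseteq> Z} R ?H"
    proof -
      have "\<zero>\<^bsub>?H\<^esub> \<in> {c \<in> linear_maps R F' K'. c ` carrier F' \<subseteq> Z}"
        using hom_module_closed(1)[OF F(2) K'] submoduleD(2)[OF K' Z] by (auto simp: hom_module_simps image_subset_iff)
      moreover have "f \<oplus>\<^bsub>?H\<^esub> g \<in> {c \<in> linear_maps R F' K'. c ` carrier F' \<subseteq> Z}"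
        if "f \<in> {c \<in> linear_maps R F' K'. c ` carrier F' \<subseteq> Z}" "g \<in> {c \<in> linear_maps R F' K'. c ` carrier F' \<subseteq> Z}" for f g
        using that hom_module_closed(2)[OF F(2) K'] submoduleD(3)[OF K' Z] by (auto simp: hom_module_simps image_subset_iff)
      moreover have "r \<odot>\<^bsub>?H\<^esub> g \<in> {c \<in> linear_maps R F' K'. c ` carrier F' \<subseteq> Z}"
        if "r \<in> carrier R" "g \<in> {c \<in> linear_maps R F' K'. c ` carrier F' \<subseteq> Z}" for r g
        using that hom_module_closed(3)[OF F(2) K'] submoduleD(5)[OF K' Z] by (auto simp: hom_module_simps image_subset_iff)
      ultimately show ?thesis by (auto simp: submodule_iff[OF H] hom_module_simps(1))
    qed
    have "submodule ((\<lambda>w. compose (carrier F) u w) ` linear_maps R F K) R (hom_module R F K')"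
      using submodule_image[OF hom_module_module[OF F(1) K] hom_module_module[OF F(1) K']
          hom_postcompose_linear[OF F(1) K K' u] module.carrier_is_submodule[OF hom_module_module[OF F(1) K]]]
      by (simp add: hom_module_simps)
    from submodule_Int[OF H 1 submodule_vimage[OF H hom_module_module[OF F(1) K'] hom_precompose_linear[OF F(1,2) K' d] this]]
    show ?thesis by (rule back_subst[of "\<lambda>S. submodule S R ?H"]) (auto simp: hom_module_simps)
  qed
  have Hq: "module R (hom_module R P Q)" if "module R P" for P :: "('a, 'b \<Rightarrow> 'a) module"
    by (rule hom_module_module[OF that Q])
  have lin: "linear_on R (?H\<lparr>carrier := ?Z\<rparr>) (hom_module R F' Q) (\<lambda>c. compose (carrier F') \<pi> c)"
  proof -
    have "linear_on R (hom_module R F' ?K) (hom_module R F' Q) (\<lambda>c. compose (carrier F') \<pi> c)"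
      by (rule hom_postcompose_linear[OF F(2) ZK Q \<pi>(1)])
    moreover have "c \<in> linear_maps R F' ?K" if "c \<in> ?Z" for c using that toZ by (auto simp: linear_maps_iff)
    ultimately show ?thesis by (auto simp: linear_on_def hom_module_def)
  qed
  let ?Y = "{f \<in> linear_maps R F' Q. compose (carrier F) f d = \<zero>\<^bsub>hom_module R F Q\<^esub>}"
    and ?X = "(\<lambda>g. compose (carrier F') g d') ` linear_maps R F'' Q"
  have X: "submodule ?X R (hom_module R F' Q)"
    using submodule_image[OF Hq[OF F(3)] Hq[OF F(2)] hom_precompose_linear[OF F(2,3) Q d']
       module.carrier_is_submodule[OF Hq[OF F(3)]]] by (simp add: hom_module_simps)
  have Y: "submodule ?Y R (hom_module R F' Q)"
    using submodule_kernel[OF Hq[OF F(2)] Hq[OF F(1)] hom_precompose_linear[OF F(1,2) Q d]]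
    by (simp add: hom_module_simps)
  note im = submodule_image[OF submodule_module[OF H Zsub] Hq[OF F(2)] lin]
  have Zs: "submodule ?Z R (?H\<lparr>carrier := ?Z\<rparr>)" using Zsub by (simp add: submodule_restrict_iff[OF H Zsub])
  show ?thesis
  \<comment> \<open>Composition with the projection onto \<open>Q\<close> sends \<open>?Z\<close>
    into the \<open>Q\<close>-valued cocycles, where \<open>fg\<close> applies. It remains to see
    that whatever becomes a coboundary in \<open>Q\<close> already lies in
    \<open>?W\<close>.\<close>
  proof (rule fg_over_extension[OF H Hq[OF F(2)] Zsub lin X])
    have "(\<lambda>c. compose (carrier F') \<pi> c) ` ?Z \<subseteq> ?Y"
    proof (clarify, intro conjI)
      fix c w assume c: "c \<in> linear_maps R F' K'" "c ` carrier F' \<subseteq> Z"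
        and w: "compose (carrier F) c d = compose (carrier F) u w" "w \<in> linear_maps R F K"
      show l: "compose (carrier F') \<pi> c \<in> linear_maps R F' Q"
        by (rule compose_linear[OF F(2) toZ[OF linear_mapsD(1)[OF c(1)] c(2)] \<pi>(1)])
      show "compose (carrier F) (compose (carrier F') \<pi> c) d = \<zero>\<^bsub>hom_module R F Q\<^esub>"
      proof (rule linear_maps_eqI[OF compose_linear[OF F(1) d linear_mapsD(1)[OF l]] hom_module_closed(1)[OF F(1) Q]])
        fix x assume x: "x \<in> carrier F"
        have "c (d x) = u (w x)" using fun_cong[OF w(1), of x] x by (simp add: compose_apply)
        then have "c (d x) \<in> ?B" using linear_mapsD(3)[OF w(2) x] by blast
        then have "\<pi> (c (d x)) = \<zero>\<^bsub>Q\<^esub>" using \<pi>(3) uZ by blast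
        then show "compose (carrier F) (compose (carrier F') \<pi> c) d x = \<zero>\<^bsub>hom_module R F Q\<^esub> x"
          using x linear_onD(1)[OF d x] by (simp add: compose_apply hom_module_simps)
      qed
    qed
    then show "fg_over R (hom_module R F' Q) ((\<lambda>c. compose (carrier F') \<pi> c) ` ?Z) ?X"
      by (rule fg_over_submodule[OF R Hq[OF F(2)] X Y im[OF Zs] _ fg])
    have "c \<in> ?W" if c: "c \<in> ?Z" "compose (carrier F') \<pi> c \<in> ?X" for c
    proof -
      obtain g where g: "g \<in> linear_maps R F'' Q" "compose (carrier F') \<pi> c = compose (carrier F') g d'"
        using c(2) by blast
      have cl: "c \<in> linear_maps R F' K'" "c ` carrier F' \<subseteq> Z" using c(1) by auto
      \<comment> \<open>Projectivity of \<open>F''\<close>: the \<open>Q\<close>-valued primitive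
        \<open>g\<close> lifts to a \<open>Z\<close>-valued \<open>e\<close>, so \<open>c\<close>
        differs from the coboundary of \<open>e\<close> by a map \<open>h\<close> with values in the
        image of \<open>u\<close>.\<close>
      have "\<exists>e\<in>linear_maps R F'' ?K. \<forall>x\<in>carrier F''. \<pi> (e x) = g x"
        using free_module_projective[OF ZK Q \<pi>(1) linear_mapsD(1)[OF g(1)[unfolded F''_def]]]
          linear_mapsD(3)[OF g(1)] \<pi>(2) by (auto simp: F''_def)
      then obtain e where e: "e \<in> linear_maps R F'' ?K" "\<And>x. x \<in> carrier F'' \<Longrightarrow> \<pi> (e x) = g x" by blast
      have e': "e \<in> linear_maps R F'' K'" "e ` carrier F'' \<subseteq> Z"
        using e(1) fromZ linear_mapsD(3)[OF e(1)] by (auto simp: linear_maps_iff)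
      define v where "v = compose (carrier F') e d'"
      have v: "v \<in> linear_maps R F' K'" unfolding v_def by (rule compose_linear[OF F(2) d' linear_mapsD(1)[OF e'(1)]])
      define h where "h = c \<ominus>\<^bsub>?H\<^esub> v"
      have h: "h \<in> linear_maps R F' K'" using H.M.minus_closed[of c v] cl(1) v by (simp add: h_def hom_module_simps)
      have c_eq: "c = v \<oplus>\<^bsub>?H\<^esub> h" unfolding h_def using H.minus_add_cancel(1)[of c v] cl(1) v by (simp add: hom_module_simps)
      have "h x \<in> ?B" if x: "x \<in> carrier F'" for x
      proof -
        have vx: "v x = e (d' x)" "d' x \<in> carrier F''" using x linear_onD(1)[OF d' x] by (simp_all add: v_def compose_apply)
        have zz: "c x \<in> Z" "v x \<in> Z" using cl(2) x e'(2) vx by auto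
        have "c x = v x \<oplus>\<^bsub>K'\<^esub> h x" using fun_cong[OF c_eq, of x] x by (simp add: hom_module_simps)
        then have hx: "h x = c x \<ominus>\<^bsub>K'\<^esub> v x"
          using K'.minus_add_cancel(3)[of "h x" "v x"] linear_mapsD(3)[OF h x] linear_mapsD(3)[OF v x] by simp
        have hz: "h x \<in> Z" unfolding hx by (rule submoduleD(4)[OF K' Z zz])
        have "\<pi> (c x) = g (d' x)" using fun_cong[OF g(2), of x] x by (simp add: compose_apply)
        then have "\<pi> (c x) = \<pi> (v x)" using e(2) vx by simp
        moreover have "\<pi> (c x) = \<pi> (v x) \<oplus>\<^bsub>Q\<^esub> \<pi> (h x)"
          unfolding \<open>c x = v x \<oplus>\<^bsub>K'\<^esub> h x\<close> using linear_onD(2)[OF \<pi>(1), of "v x" "h x"] zz hz by simp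
        moreover have "\<pi> (v x) \<in> carrier Q" "\<pi> (h x) \<in> carrier Q" using zz hz \<pi>(2) by auto
        ultimately have "\<pi> (h x) = \<zero>\<^bsub>Q\<^esub>"
          by (metis Q.M.add.l_cancel_one')
        then show ?thesis using \<pi>(3) hz by blast
      qed
      then have "h ` carrier F' \<subseteq> u ` carrier K" by blast
      \<comment> \<open>Projectivity of \<open>F'\<close> factors \<open>h\<close> through
        \<open>u\<close>.\<close>
      then have "\<exists>w\<in>linear_maps R F' K. \<forall>x\<in>carrier F'. u (w x) = h x"
        using free_module_projective[OF K K' u linear_mapsD(1)[OF h[unfolded F'_def]]] by (simp add: F'_def)
      then obtain w where w: "w \<in> linear_maps R F' K" "\<And>x. x \<in> carrier F' \<Longrightarrow> u (w x) = h x" by blast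
      have "h = compose (carrier F') u w"
        by (rule linear_maps_eqI[OF h compose_linear[OF F(2) linear_mapsD(1)[OF w(1)] u]])
           (simp add: compose_apply w(2))
      then show ?thesis using c_eq v_def e' w(1) by blast
    qed
    then show "fg_over R ?H {c \<in> ?Z. compose (carrier F') \<pi> c \<in> ?X} ?W" by (intro fg_over_subset) blast
  qed
qed

section \<open>Multiplication by an annihilating scalar on the resolution\<close>

lemma res_module: "cring R \<Longrightarrow> module R (res R L n)"
  unfolding res_def by (rule free_module_module)

lemma res_diff_linear:
  assumes "cring R" shows "linear_on R (res R L n) (res R L (n - 1)) (res_diff R L n)"
  using linear_mapsD(1)[OF free_lift_linear[OF res_module[OF assms] gen_boundary_closed[OF assms]]]
  unfolding res_diff_def res_def[of R L n] .

lemma res_negative: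
  assumes "cring R" "n < 0"
  shows "carrier (res R L n) = {\<zero>\<^bsub>res R L n\<^esub>}"
proof -
  interpret cring R by fact
  show ?thesis using assms(2) by (auto simp: res_def free_module_def res_basis_int_def)
qed

text \<open>Exactness gives this for n > 1. For smaller n the target has negative degree and
  vanishes, because the augmentation to \<open>L\<close> is not part of the complex.\<close>

lemma res_diff_diff:
  assumes L: "module R L" and x: "x \<in> carrier (res R L n)"
  shows "res_diff R L (n - 1) (res_diff R L n x) = \<zero>\<^bsub>res R L (n - 1 - 1)\<^esub>"
proof -
  interpret module R L by fact
  note d = linear_onD(1)[OF res_diff_linear[OF R.is_cring]]
  show ?thesis
  proof (cases "n > 1")
    case True
    then have "a_kernel (res R L (n - 1)) (res R L (n - 1 - 1)) (res_diff R L (n - 1))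
        = res_diff R L n ` carrier (res R L n)"
      using res_exact(2)[OF L, of "n - 1"] by simp
    then have "res_diff R L n x \<in> a_kernel (res R L (n - 1)) (res R L (n - 1 - 1)) (res_diff R L (n - 1))"
      using x by blast
    then show ?thesis by (simp add: a_kernel_def kernel_def)
  next
    case False
    then have "carrier (res R L (n - 1 - 1)) = {\<zero>\<^bsub>res R L (n - 1 - 1)\<^esub>}"
      by (intro res_negative[OF R.is_cring]) auto
    then show ?thesis using d[OF d[OF x]] by blast
  qed
qed

text \<open>A scalar annihilating \<open>L\<close> acts null-homotopically on the resolution; the homotopy is constructed
  degree by degree from projectivity and exactness.\<close>

lemma res_null_homotopy:
  assumes L: "module R L" and r: "r \<in> carrier R" and ann: "\<And>l. l \<in> carrier L \<Longrightarrow> r \<odot>\<^bsub>L\<^esub> l = \<zero>\<^bsub>L\<^esub>"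
  shows "\<exists>h\<in>linear_maps R (res R L (int n - 1)) (res R L (int n)).
    \<exists>k\<in>linear_maps R (res R L (int n)) (res R L (int n + 1)). \<forall>y\<in>carrier (res R L (int n)).
      r \<odot>\<^bsub>res R L (int n)\<^esub> y =
        res_diff R L (int n + 1) (k y) \<oplus>\<^bsub>res R L (int n)\<^esub> h (res_diff R L (int n) y)"
proof (induction n)
  interpret L: module R L by fact
  note RM = res_module[OF L.R.is_cring] and d = res_diff_linear[OF L.R.is_cring]
  case 0
  interpret F: module R "res R L 0" by (rule RM)
  \<comment> \<open>Multiples by \<open>r\<close> lie in the kernel of the augmentation, as
    \<open>r\<close> annihilates \<open>L\<close>; exactness makes them boundaries.\<close>
  have "(\<lambda>y. r \<odot>\<^bsub>res R L 0\<^esub> y) ` carrier (res R L 0) \<subseteq> res_diff R L 1 ` carrier (res R L 1)"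
  proof
    fix z assume "z \<in> (\<lambda>y. r \<odot>\<^bsub>res R L 0\<^esub> y) ` carrier (res R L 0)"
    then obtain y where y: "y \<in> carrier (res R L 0)" "z = r \<odot>\<^bsub>res R L 0\<^esub> y" by blast
    have aug: "linear_on R (res R L 0) L (res_augment R L)"
    proof -
      have "gen_augment L \<in> res_basis R L 0 \<rightarrow> carrier L" by (auto simp: gen_augment_def)
      from linear_mapsD(1)[OF free_lift_linear[OF L this]] show ?thesis
        by (simp add: res_augment_def res_def res_basis_int_def)
    qed
    have "res_augment R L z = \<zero>\<^bsub>L\<^esub>"
      using linear_onD[OF aug] y r ann by simp
    then have "z \<in> a_kernel (res R L 0) L (res_augment R L)"
      using y r F.smult_closed by (simp add: a_kernel_def kernel_def)
    then show "z \<in> res_diff R L 1 ` carrier (res R L 1)" unfolding res_exact(1)[OF L] .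
  qed
  then have "\<exists>k\<in>linear_maps R (res R L 0) (res R L 1).
      \<forall>y\<in>carrier (res R L 0). res_diff R L 1 (k y) = r \<odot>\<^bsub>res R L 0\<^esub> y"
    using free_module_projective[OF RM RM, of L 1 L 0 "res_diff R L 1" "res_basis_int R L 0"] d[of L 1]
      scalar_linear[OF RM r, of L 0] unfolding res_def[of R L 0, symmetric] by simp
  then obtain k where k: "k \<in> linear_maps R (res R L 0) (res R L 1)"
    "\<And>y. y \<in> carrier (res R L 0) \<Longrightarrow> res_diff R L 1 (k y) = r \<odot>\<^bsub>res R L 0\<^esub> y" by blast
  \<comment> \<open>The component starting in degree -1 is zero, its source being the zero
    module.\<close>
  let ?h = "\<zero>\<^bsub>hom_module R (res R L (0 - 1)) (res R L 0)\<^esub>"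
  have h: "?h \<in> linear_maps R (res R L (0 - 1)) (res R L 0)" by (rule hom_module_closed(1)[OF RM RM])
  have "r \<odot>\<^bsub>res R L 0\<^esub> y = res_diff R L (0 + 1) (k y) \<oplus>\<^bsub>res R L 0\<^esub> ?h (res_diff R L 0 y)"
    if y: "y \<in> carrier (res R L 0)" for y
  proof -
    have "?h (res_diff R L 0 y) = \<zero>\<^bsub>res R L 0\<^esub>"
      by (rule hom_module_simps(2)[OF linear_onD(1)[OF d y]])
    then show ?thesis using k(2)[OF y] y r by simp
  qed
  then show ?case using k(1) h by (intro bexI[of _ ?h] bexI[of _ k]) simp_all
next
  interpret L: module R L by fact
  note RM = res_module[OF L.R.is_cring] and d = res_diff_linear[OF L.R.is_cring]
  case (Suc n)
  let ?F = "\<lambda>i. res R L i"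
  define m where "m = int (Suc n)"
  have idx: "m - 1 = int n" "int n + 1 = m" "m > 0" by (simp_all add: m_def)
  have dn: "linear_on R (?F m) (?F (int n)) (res_diff R L m)" using d[of L m] unfolding idx(1) .
  obtain h k where h: "h \<in> linear_maps R (?F (int n - 1)) (?F (int n))"
    and k: "k \<in> linear_maps R (?F (int n)) (?F m)"
    and hk: "\<And>y. y \<in> carrier (?F (int n)) \<Longrightarrow>
      r \<odot>\<^bsub>?F (int n)\<^esub> y = res_diff R L m (k y) \<oplus>\<^bsub>?F (int n)\<^esub> h (res_diff R L (int n) y)"
    using Suc unfolding idx(2) by blast
  interpret F: module R "?F m" by (rule RM)
  interpret F': module R "?F (int n)" by (rule RM)
  \<comment> \<open>The defect r - kd of the homotopy so far is killed by d: d(ry - kdy) = r dy -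
    dk(dy) = h(ddy) = 0. By exactness it lifts through the next differential.\<close>
  let ?f = "\<lambda>y. r \<odot>\<^bsub>?F m\<^esub> y \<ominus>\<^bsub>?F m\<^esub> k (res_diff R L m y)"
  have f: "linear_on R (?F m) (?F m) ?f"
    by (rule linear_on_diff[OF RM RM scalar_linear[OF RM r] linear_on_comp[OF dn linear_mapsD(1)[OF k]]])
  have "?f ` carrier (?F m) \<subseteq> res_diff R L (m + 1) ` carrier (?F (m + 1))"
  proof
    fix z assume "z \<in> ?f ` carrier (?F m)"
    then obtain y where y: "y \<in> carrier (?F m)" "z = ?f y" by blast
    define w where "w = res_diff R L m y"
    have w: "w \<in> carrier (?F (int n))" unfolding w_def by (rule linear_onD(1)[OF dn y(1)])
    have kw: "k w \<in> carrier (?F m)" by (rule linear_mapsD(3)[OF k w])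
    have dkw: "res_diff R L m (k w) \<in> carrier (?F (int n))" by (rule linear_onD(1)[OF dn kw])
    have ry: "r \<odot>\<^bsub>?F m\<^esub> y \<in> carrier (?F m)" using r y(1) by simp
    have "res_diff R L m z = res_diff R L m (r \<odot>\<^bsub>?F m\<^esub> y) \<ominus>\<^bsub>?F (int n)\<^esub> res_diff R L m (k w)"
      unfolding y(2) w_def[symmetric] by (rule linear_on_minus[OF RM RM dn ry kw])
    also have "res_diff R L m (r \<odot>\<^bsub>?F m\<^esub> y) = r \<odot>\<^bsub>?F (int n)\<^esub> w"
      unfolding w_def by (rule linear_onD(3)[OF dn r y(1)])
    also have "\<dots> = res_diff R L m (k w) \<oplus>\<^bsub>?F (int n)\<^esub> h (res_diff R L (int n) w)" by (rule hk[OF w])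
    also have "res_diff R L (int n) w = \<zero>\<^bsub>?F (int n - 1)\<^esub>"
      using res_diff_diff[OF L y(1)] unfolding w_def idx(1) .
    also have "h \<zero>\<^bsub>?F (int n - 1)\<^esub> = \<zero>\<^bsub>?F (int n)\<^esub>" by (rule linear_zero[OF RM RM h])
    finally have "res_diff R L m z = \<zero>\<^bsub>?F (int n)\<^esub>"
      using dkw F'.minus_eq_zero[OF dkw dkw] by simp
    then have "z \<in> a_kernel (?F m) (?F (m - 1)) (res_diff R L m)"
      unfolding idx(1) using linear_onD(1)[OF f y(1)] y(2) by (simp add: a_kernel_def kernel_def)
    then show "z \<in> res_diff R L (m + 1) ` carrier (?F (m + 1))"
      using res_exact(2)[OF L idx(3)] by simp
  qed
  then have "\<exists>k'\<in>linear_maps R (?F m) (?F (m + 1)).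
      \<forall>y\<in>carrier (?F m). res_diff R L (m + 1) (k' y) = ?f y"
    using free_module_projective[OF RM RM, of L "m + 1" L m "res_diff R L (m + 1)" "res_basis_int R L m" ?f]
      d[of L "m + 1"] f unfolding res_def[of R L m, symmetric] by simp
  then obtain k' where k': "k' \<in> linear_maps R (?F m) (?F (m + 1))"
    "\<And>y. y \<in> carrier (?F m) \<Longrightarrow> res_diff R L (m + 1) (k' y) = ?f y" by blast
  have "r \<odot>\<^bsub>?F m\<^esub> y = res_diff R L (m + 1) (k' y) \<oplus>\<^bsub>?F m\<^esub> k (res_diff R L m y)"
    if y: "y \<in> carrier (?F m)" for y
  proof -
    have "k (res_diff R L m y) \<in> carrier (?F m)" by (rule linear_mapsD(3)[OF k linear_onD(1)[OF dn y]])
    then show ?thesis unfolding k'(2)[OF y] using F.minus_add_cancel(2) r y by simp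
  qed
  \<comment> \<open>The old \<open>k\<close> becomes the new \<open>h\<close>.\<close>
  then show ?case unfolding m_def[symmetric] idx(1) using k k'(1) by (intro bexI[of _ k] bexI[of _ k']) simp_all
qed

text \<open>In r = dk + hd the first summand dies under the cocycle \<open>f\<close>, so the
  composite of \<open>h\<close> and \<open>f\<close> is the required primitive. This is the cochain
  form of the fact that \<open>r\<close> annihilates Ext(L, N).\<close>

lemma res_cocycle_scalar:
  assumes L: "module R L" and N: "module R N" and r: "r \<in> carrier R"
    and ann: "\<And>l. l \<in> carrier L \<Longrightarrow> r \<odot>\<^bsub>L\<^esub> l = \<zero>\<^bsub>L\<^esub>"
    and f: "f \<in> linear_maps R (res R L (int n)) N"
    and cocycle: "\<And>y. y \<in> carrier (res R L (int n + 1)) \<Longrightarrow> f (res_diff R L (int n + 1) y) = \<zero>\<^bsub>N\<^esub>"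
  shows "\<exists>e\<in>linear_maps R (res R L (int n - 1)) N. \<forall>y\<in>carrier (res R L (int n)).
    r \<odot>\<^bsub>N\<^esub> f y = e (res_diff R L (int n) y)"
proof -
  interpret N: module R N by fact
  note RM = res_module[OF N.R.is_cring] and d = res_diff_linear[OF N.R.is_cring]
  obtain h k where h: "h \<in> linear_maps R (res R L (int n - 1)) (res R L (int n))"
    and k: "k \<in> linear_maps R (res R L (int n)) (res R L (int n + 1))"
    and hk: "\<And>y. y \<in> carrier (res R L (int n)) \<Longrightarrow> r \<odot>\<^bsub>res R L (int n)\<^esub> y =
        res_diff R L (int n + 1) (k y) \<oplus>\<^bsub>res R L (int n)\<^esub> h (res_diff R L (int n) y)"
    using res_null_homotopy[OF L r ann, where n = n] by blast
  note fl = linear_onD[OF linear_mapsD(1)[OF f]]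
  show ?thesis
  proof (intro bexI ballI)
    show "compose (carrier (res R L (int n - 1))) f h \<in> linear_maps R (res R L (int n - 1)) N"
      by (rule compose_linear[OF RM linear_mapsD(1)[OF h] linear_mapsD(1)[OF f]])
    fix y assume y: "y \<in> carrier (res R L (int n))"
    have dy: "res_diff R L (int n) y \<in> carrier (res R L (int n - 1))" by (rule linear_onD(1)[OF d y])
    have ky: "k y \<in> carrier (res R L (int n + 1))" by (rule linear_mapsD(3)[OF k y])
    have dky: "res_diff R L (int n + 1) (k y) \<in> carrier (res R L (int n))"
      using linear_onD(1)[OF d ky] by simp
    have hdy: "h (res_diff R L (int n) y) \<in> carrier (res R L (int n))" by (rule linear_mapsD(3)[OF h dy])
    have "r \<odot>\<^bsub>N\<^esub> f y = f (r \<odot>\<^bsub>res R L (int n)\<^esub> y)" using fl(3)[OF r y] by simp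
    also have "\<dots> = f (res_diff R L (int n + 1) (k y)) \<oplus>\<^bsub>N\<^esub> f (h (res_diff R L (int n) y))"
      unfolding hk[OF y] by (rule fl(2)[OF dky hdy])
    also have "\<dots> = f (h (res_diff R L (int n) y))" using cocycle[OF ky] fl(1)[OF hdy] by simp
    finally show "r \<odot>\<^bsub>N\<^esub> f y = compose (carrier (res R L (int n - 1))) f h (res_diff R L (int n) y)"
      using dy by (simp add: compose_apply)
  qed
qed

section \<open>The Koszul complex\<close>

text \<open>Induction on \<open>S\<close>: the terms having the new element as first index cancel
  those having it as second index, pair by pair. An argument by swapping indices would only show
  that twice the sum is zero.\<close>

lemma (in abelian_group) antisymmetric_finsum:
  assumes "finite S" "\<And>j k. j \<in> S \<Longrightarrow> k \<in> S \<Longrightarrow> j \<noteq> k \<Longrightarrow> g j k \<in> carrier G"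
    and "\<And>j k. j \<in> S \<Longrightarrow> k \<in> S \<Longrightarrow> j \<noteq> k \<Longrightarrow> g j k \<oplus> g k j = \<zero>"
  shows "(\<Oplus>j\<in>S. \<Oplus>k\<in>S - {j}. g j k) = \<zero>"
  using assms
proof induction
  case (insert a S)
  have c: "g j k \<in> carrier G" if "j \<in> insert a S" "k \<in> insert a S" "j \<noteq> k" for j k
    using insert.prems(1) that .
  have in_c: "(\<Oplus>k\<in>S - {j}. g j k) \<in> carrier G" if "j \<in> S" for j
    by (rule finsum_closed) (use c that in auto)
  have ins: "(\<Oplus>k\<in>insert a S - {j}. g j k) = g j a \<oplus> (\<Oplus>k\<in>S - {j}. g j k)" if j: "j \<in> S" for j
  proof -
    have "insert a S - {j} = insert a (S - {j})" using j insert.hyps by auto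
    moreover have "g j \<in> S - {j} \<rightarrow> carrier G" "g j a \<in> carrier G" using c j insert.hyps by auto
    ultimately show ?thesis using insert.hyps by (simp add: finsum_insert)
  qed
  have ca: "g j a \<in> carrier G" "g a j \<in> carrier G" if "j \<in> S" for j using c that insert.hyps by auto
  have Sa: "insert a S - {a} = S" using insert.hyps by auto
  have "(\<Oplus>j\<in>insert a S. \<Oplus>k\<in>insert a S - {j}. g j k) =
      (\<Oplus>k\<in>S. g a k) \<oplus> (\<Oplus>j\<in>S. \<Oplus>k\<in>insert a S - {j}. g j k)"
    using insert.hyps c by (subst finsum_insert) (auto simp: Sa intro!: finsum_closed)
  also have "(\<Oplus>j\<in>S. \<Oplus>k\<in>insert a S - {j}. g j k) = (\<Oplus>j\<in>S. g j a \<oplus> (\<Oplus>k\<in>S - {j}. g j k))"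
  proof (rule finsum_cong'[OF refl])
    show "(\<lambda>j. g j a \<oplus> (\<Oplus>k\<in>S - {j}. g j k)) \<in> S \<rightarrow> carrier G"
    proof
      fix j assume j: "j \<in> S"
      have "g j a \<in> carrier G" by (rule c) (use j insert.hyps in auto)
      then show "g j a \<oplus> (\<Oplus>k\<in>S - {j}. g j k) \<in> carrier G" using in_c[OF j] by simp
    qed
  qed (rule ins)
  also have "\<dots> = (\<Oplus>j\<in>S. g j a) \<oplus> (\<Oplus>j\<in>S. \<Oplus>k\<in>S - {j}. g j k)"
    by (rule finsum_addf) (use in_c ca in auto)
  also have "(\<Oplus>j\<in>S. \<Oplus>k\<in>S - {j}. g j k) = \<zero>" using insert.IH insert.prems by auto
  also have "(\<Oplus>j\<in>S. g j a) \<oplus> \<zero> = (\<Oplus>j\<in>S. g j a)"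
    by (rule r_zero, rule finsum_closed) (use ca in auto)
  also have "(\<Oplus>k\<in>S. g a k) \<oplus> (\<Oplus>j\<in>S. g j a) = (\<Oplus>k\<in>S. g a k \<oplus> g k a)"
    by (rule finsum_addf[symmetric]) (use ca in auto)
  also have "\<dots> = \<zero>"
    by (rule add.finprod_one_eqI) (use insert in auto)
  finally show ?case .
qed simp

text \<open>The coefficient occurring in \<open>koszul_diff\<close>, named so that signs can be
  treated apart from the module sums.\<close>

definition koszul_coeff :: "('a, 'r) ring_scheme \<Rightarrow> 'a list \<Rightarrow> nat set \<Rightarrow> nat \<Rightarrow> 'a" where
  "koszul_coeff R xs S j = (\<ominus>\<^bsub>R\<^esub> \<one>\<^bsub>R\<^esub>) [^]\<^bsub>R\<^esub> card {k\<in>S. k < j} \<otimes>\<^bsub>R\<^esub> xs ! j"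

context
  fixes R :: "('a, 'r) ring_scheme" (structure) and xs :: "'a list"
  assumes R: "cring R" and xs: "set xs \<subseteq> carrier R"
begin

interpretation cring R by (rule R)

lemma nth_closed: "S \<subseteq> {..<length xs} \<Longrightarrow> j \<in> S \<Longrightarrow> xs ! j \<in> carrier R"
  using xs by (meson lessThan_iff nth_mem subsetD)

lemma koszul_coeff_closed: "S \<subseteq> {..<length xs} \<Longrightarrow> j \<in> S \<Longrightarrow> koszul_coeff R xs S j \<in> carrier R"
  using nth_closed by (simp add: koszul_coeff_def)

text \<open>Deleting \<open>j\<close> lowers by one the number of elements in front of
  \<open>k\<close>, while deleting \<open>k\<close> leaves those in front of \<open>j\<close> alone.
  The two orders of deletion therefore carry opposite signs.\<close>

lemma koszul_coeff_less:
  assumes S: "S \<subseteq> {..<length xs}" and jk: "j \<in> S" "k \<in> S" "j < k"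
  shows "koszul_coeff R xs S j \<otimes> koszul_coeff R xs (S - {j}) k \<oplus>
    koszul_coeff R xs S k \<otimes> koszul_coeff R xs (S - {k}) j = \<zero>"
proof -
  have fin: "finite S" using S finite_subset by blast
  have 1: "{l \<in> S - {k}. l < j} = {l \<in> S. l < j}" using jk by auto
  have "{l \<in> S. l < k} = insert j {l \<in> S - {j}. l < k}" using jk by auto
  then have 2: "card {l \<in> S. l < k} = Suc (card {l \<in> S - {j}. l < k})" using fin by simp
  have c: "xs ! j \<in> carrier R" "xs ! k \<in> carrier R" using nth_closed[OF S] jk by auto
  define a b where "a = (\<ominus> \<one>) [^] card {l \<in> S. l < j}" and "b = (\<ominus> \<one>) [^] card {l \<in> S - {j}. l < k}"
  have ab: "a \<in> carrier R" "b \<in> carrier R" by (simp_all add: a_def b_def)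
  have "koszul_coeff R xs S k \<otimes> koszul_coeff R xs (S - {k}) j = (b \<otimes> \<ominus> \<one> \<otimes> xs ! k) \<otimes> (a \<otimes> xs ! j)"
    by (simp only: koszul_coeff_def 1 2 a_def b_def nat_pow_Suc)
  also have "\<dots> = \<ominus> ((a \<otimes> xs ! j) \<otimes> (b \<otimes> xs ! k))"
    using ab c by (simp add: r_minus l_minus m_ac)
  also have "(a \<otimes> xs ! j) \<otimes> (b \<otimes> xs ! k) = koszul_coeff R xs S j \<otimes> koszul_coeff R xs (S - {j}) k"
    by (simp add: koszul_coeff_def a_def b_def)
  finally show ?thesis using koszul_coeff_closed[OF S jk(1)] koszul_coeff_closed[of "S - {j}" k] S jk
    by (simp add: r_neg subset_iff)
qed

lemma koszul_coeff_antisymmetric: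
  assumes S: "S \<subseteq> {..<length xs}" and jk: "j \<in> S" "k \<in> S" "j \<noteq> k"
  shows "koszul_coeff R xs S j \<otimes> koszul_coeff R xs (S - {j}) k \<oplus>
    koszul_coeff R xs S k \<otimes> koszul_coeff R xs (S - {k}) j = \<zero>"
proof (cases "j < k")
  case False
  then have "k < j" using jk(3) by simp
  have "koszul_coeff R xs S j \<otimes> koszul_coeff R xs (S - {j}) k \<in> carrier R"
     "koszul_coeff R xs S k \<otimes> koszul_coeff R xs (S - {k}) j \<in> carrier R"
    using koszul_coeff_closed[OF S] koszul_coeff_closed[OF subset_trans[OF Diff_subset S]] jk by auto
  then show ?thesis using koszul_coeff_less[OF S jk(2,1) \<open>k < j\<close>] by (simp add: a_comm)
qed (rule koszul_coeff_less[OF S jk(1,2)])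

lemma koszul_module: "module R (koszul R xs p)"
  unfolding koszul_def by (rule free_module_module[OF R])

text \<open>The boundary of the basis element of \<open>S\<close>; \<open>p\<close> is the degree of
  the target, one less than that of \<open>S\<close>.\<close>

definition koszul_bd :: "int \<Rightarrow> nat set \<Rightarrow> nat set \<Rightarrow> 'a" where
  "koszul_bd p S = (\<Oplus>\<^bsub>koszul R xs p\<^esub>j\<in>S. koszul_coeff R xs S j \<odot>\<^bsub>koszul R xs p\<^esub> basis_elem R (S - {j}))"

lemma koszul_basisD:
  assumes "S \<in> koszul_basis xs p"
  shows "finite S" "S \<subseteq> {..<length xs}" "j \<in> S \<Longrightarrow> S - {j} \<in> koszul_basis xs (p - 1)"
proof -
  show fin: "finite S" and "S \<subseteq> {..<length xs}" using assms finite_subset by (auto simp: koszul_basis_def)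
  show "S - {j} \<in> koszul_basis xs (p - 1)" if "j \<in> S"
    using assms that card_Suc_Diff1[OF fin that] by (auto simp: koszul_basis_def)
qed

lemma koszul_term_closed:
  assumes "S \<in> koszul_basis xs p" "j \<in> S"
  shows "basis_elem R (S - {j}) \<in> carrier (koszul R xs (p - 1))"
    "koszul_coeff R xs S j \<odot>\<^bsub>koszul R xs (p - 1)\<^esub> basis_elem R (S - {j}) \<in> carrier (koszul R xs (p - 1))"
proof -
  interpret K: module R "koszul R xs (p - 1)" by (rule koszul_module)
  show b: "basis_elem R (S - {j}) \<in> carrier (koszul R xs (p - 1))"
    unfolding koszul_def by (rule basis_elem_in[OF R koszul_basisD(3)[OF assms]])
  then show "koszul_coeff R xs S j \<odot>\<^bsub>koszul R xs (p - 1)\<^esub> basis_elem R (S - {j}) \<in> carrier (koszul R xs (p - 1))"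
    using koszul_coeff_closed koszul_basisD(2) assms by blast
qed

lemma koszul_bd_closed: "koszul_bd (p - 1) \<in> koszul_basis xs p \<rightarrow> carrier (koszul R xs (p - 1))"
proof
  interpret K: module R "koszul R xs (p - 1)" by (rule koszul_module)
  fix S assume "S \<in> koszul_basis xs p"
  then show "koszul_bd (p - 1) S \<in> carrier (koszul R xs (p - 1))"
    unfolding koszul_bd_def using koszul_term_closed by (intro K.M.finsum_closed) auto
qed

lemma koszul_diff_eq: "koszul_diff R xs p = free_lift R (koszul_basis xs p) (koszul R xs (p - 1)) (koszul_bd (p - 1))"
  unfolding koszul_diff_def koszul_bd_def koszul_coeff_def ..

lemma koszul_diff_linear: "linear_on R (koszul R xs p) (koszul R xs (p - 1)) (koszul_diff R xs p)"
  unfolding koszul_diff_eq koszul_def[of R xs p]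
  by (rule linear_mapsD(1)[OF free_lift_linear[OF koszul_module koszul_bd_closed]])

lemma koszul_diff_basis:
  "S \<in> koszul_basis xs p \<Longrightarrow> koszul_diff R xs p (basis_elem R S) = koszul_bd (p - 1) S"
  unfolding koszul_diff_eq by (rule free_lift_basis[OF koszul_module koszul_bd_closed])

lemma koszul_diff_bd:
  assumes S: "S \<in> koszul_basis xs p"
  shows "koszul_diff R xs (p - 1) (koszul_bd (p - 1) S) = \<zero>\<^bsub>koszul R xs (p - 1 - 1)\<^esub>"
proof -
  define q r where qr: "q = p - 1" "r = q - 1"
  let ?K = "koszul R xs q" and ?L = "koszul R xs r" and ?c = "koszul_coeff R xs"
  interpret K: module R ?K by (rule koszul_module)
  interpret L: module R ?L by (rule koszul_module)
  note SD = koszul_basisD[OF S, folded qr(1)] and lin = koszul_diff_linear[of q, folded qr(2)]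
    and tc = koszul_term_closed[OF S, folded qr(1)]
  have c: "?c S j \<in> carrier R" if "j \<in> S" for j by (rule koszul_coeff_closed[OF SD(2) that])
  have c': "?c (S - {j}) k \<in> carrier R" if "j \<in> S" "k \<in> S - {j}" for j k
    using koszul_coeff_closed[of "S - {j}" k] that SD(2) by blast
  have b: "basis_elem R (S - {j} - {k}) \<in> carrier ?L" if "j \<in> S" "k \<in> S - {j}" for j k
    by (rule koszul_term_closed(1)[OF SD(3)[OF that(1)] that(2), folded qr(2)])
  have "koszul_diff R xs q (koszul_bd q S) =
      (\<Oplus>\<^bsub>?L\<^esub>j\<in>S. koszul_diff R xs q (?c S j \<odot>\<^bsub>?K\<^esub> basis_elem R (S - {j})))"
    unfolding koszul_bd_def
    by (rule linear_finsum[OF koszul_module koszul_module lin tc(2) SD(1)])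
  also have "\<dots> = (\<Oplus>\<^bsub>?L\<^esub>j\<in>S. \<Oplus>\<^bsub>?L\<^esub>k\<in>S - {j}. (?c S j \<otimes> ?c (S - {j}) k) \<odot>\<^bsub>?L\<^esub> basis_elem R (S - {j} - {k}))"
  proof (rule L.M.finsum_cong')
    fix j assume j: "j \<in> S"
    have "koszul_diff R xs q (?c S j \<odot>\<^bsub>?K\<^esub> basis_elem R (S - {j})) = ?c S j \<odot>\<^bsub>?L\<^esub> koszul_bd r (S - {j})"
      using linear_onD(3)[OF lin c[OF j] tc(1)[OF j]]
        koszul_diff_basis[OF SD(3)[OF j], folded qr(2)] by simp
    also have "\<dots> = (\<Oplus>\<^bsub>?L\<^esub>k\<in>S - {j}. ?c S j \<odot>\<^bsub>?L\<^esub> (?c (S - {j}) k \<odot>\<^bsub>?L\<^esub> basis_elem R (S - {j} - {k})))"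
      unfolding koszul_bd_def by (rule L.finsum_smult_ldistr) (use SD(1) c[OF j] b[OF j] c'[OF j] in auto)
    also have "\<dots> = (\<Oplus>\<^bsub>?L\<^esub>k\<in>S - {j}. (?c S j \<otimes> ?c (S - {j}) k) \<odot>\<^bsub>?L\<^esub> basis_elem R (S - {j} - {k}))"
      by (rule L.M.finsum_cong') (use c[OF j] b[OF j] c'[OF j] in \<open>auto simp: L.smult_assoc1\<close>)
    finally show "koszul_diff R xs q (?c S j \<odot>\<^bsub>?K\<^esub> basis_elem R (S - {j})) =
      (\<Oplus>\<^bsub>?L\<^esub>k\<in>S - {j}. (?c S j \<otimes> ?c (S - {j}) k) \<odot>\<^bsub>?L\<^esub> basis_elem R (S - {j} - {k}))" .
  qed (use b c c' in \<open>auto intro!: L.M.finsum_closed\<close>)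
  \<comment> \<open>Exchanging j and k yields the same basis element with the opposite
    coefficient.\<close>
  also have "\<dots> = \<zero>\<^bsub>?L\<^esub>"
  proof (rule L.M.antisymmetric_finsum[OF SD(1)])
    fix j k assume jk: "j \<in> S" "k \<in> S" "j \<noteq> k"
    show "(?c S j \<otimes> ?c (S - {j}) k) \<odot>\<^bsub>?L\<^esub> basis_elem R (S - {j} - {k}) \<in> carrier ?L"
      using jk b c c' by auto
    have eq: "S - {k} - {j} = S - {j} - {k}" by auto
    show "(?c S j \<otimes> ?c (S - {j}) k) \<odot>\<^bsub>?L\<^esub> basis_elem R (S - {j} - {k}) \<oplus>\<^bsub>?L\<^esub>
        (?c S k \<otimes> ?c (S - {k}) j) \<odot>\<^bsub>?L\<^esub> basis_elem R (S - {k} - {j}) = \<zero>\<^bsub>?L\<^esub>"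
      unfolding eq using jk b[of j k] c c'[of j k] c'[of k j] koszul_coeff_antisymmetric[OF SD(2) jk]
      by (simp add: L.smult_l_distr[symmetric])
  qed
  finally show ?thesis unfolding qr .
qed

lemma koszul_diff_diff:
  assumes x: "x \<in> carrier (koszul R xs p)"
  shows "koszul_diff R xs (p - 1) (koszul_diff R xs p x) = \<zero>\<^bsub>koszul R xs (p - 1 - 1)\<^esub>"
proof -
  show ?thesis
  proof (rule linear_on_free_eqI[OF koszul_module, where B = "koszul_basis xs p" and x = x
        and g = "\<lambda>_. \<zero>\<^bsub>koszul R xs (p - 1 - 1)\<^esub>"])
    show "linear_on R (free_module R (koszul_basis xs p)) (koszul R xs (p - 1 - 1))
        (\<lambda>x. koszul_diff R xs (p - 1) (koszul_diff R xs p x))"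
      by (rule linear_on_comp[OF koszul_diff_linear[of p, unfolded koszul_def[of R xs p]] koszul_diff_linear])
    show "linear_on R (free_module R (koszul_basis xs p)) (koszul R xs (p - 1 - 1)) (\<lambda>x. \<zero>\<^bsub>koszul R xs (p - 1 - 1)\<^esub>)"
      by (rule linear_on_zero_map[OF koszul_module])
    show "koszul_diff R xs (p - 1) (koszul_diff R xs p (basis_elem R S)) = \<zero>\<^bsub>koszul R xs (p - 1 - 1)\<^esub>"
      if "S \<in> koszul_basis xs p" for S
      using koszul_diff_basis[OF that] koszul_diff_bd[OF that] by simp
    show "x \<in> carrier (free_module R (koszul_basis xs p))" using x by (simp add: koszul_def)
  qed
qed

lemma koszul_negative: "p < 0 \<Longrightarrow> carrier (koszul R xs p) = {\<zero>\<^bsub>koszul R xs p\<^esub>}"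
  by (auto simp: koszul_def free_module_def koszul_basis_def)

lemma finite_koszul_basis: "finite (koszul_basis xs p)"
  by (rule finite_subset[of _ "Pow {..<length xs}"]) (auto simp: koszul_basis_def)

text \<open>Rank one in degree 0: this is how \<open>M\<close> is recovered from K^0.\<close>

lemma koszul_basis_0: "koszul_basis xs 0 = {{}}"
  by (auto simp: koszul_basis_def finite_subset[of _ "{..<length xs}"])

text \<open>No sign occurs, as nothing in a singleton precedes its element. Dually, the components
  of the map from K^0 to K^1 are the multiplications by the entries of \<open>xs\<close>.\<close>

lemma koszul_basis_1:
  assumes "S \<in> koszul_basis xs 1"
  shows "\<exists>j<length xs. S = {j} \<and> koszul_diff R xs 1 (basis_elem R S) = xs ! j \<odot>\<^bsub>koszul R xs 0\<^esub> basis_elem R {}"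
proof -
  interpret K: module R "koszul R xs 0" by (rule koszul_module)
  have "card S = 1" using assms by (auto simp: koszul_basis_def)
  then obtain j where j: "S = {j}" by (auto simp: card_1_singleton_iff)
  have jl: "j < length xs" using koszul_basisD(2)[OF assms] j by simp
  have b: "basis_elem R {} \<in> carrier (koszul R xs 0)"
    using basis_elem_in[OF R, of "{}" "koszul_basis xs 0"] by (simp add: koszul_basis_0 koszul_def)
  have e: "{k. k = j \<and> k < j} = {}" by auto
  have xj: "xs ! j \<in> carrier R" using xs jl by (meson nth_mem subsetD)
  have c: "koszul_coeff R xs {j} j = xs ! j" using xj by (simp add: koszul_coeff_def e)
  have "koszul_bd 0 S = xs ! j \<odot>\<^bsub>koszul R xs 0\<^esub> basis_elem R {}"
    using b xj by (simp add: koszul_bd_def j c)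
  then show ?thesis using koszul_diff_basis[OF assms] j jl by auto
qed

end

section \<open>Homomorphisms into the dual of a free module\<close>

lemma evaluation_linear:
  assumes M: "module R M" and b: "b \<in> B"
  shows "linear_on R (hom_module R (free_module R B) M) M (\<lambda>f. f (basis_elem R b))"
proof -
  interpret module R M by fact
  have "basis_elem R b \<in> carrier (free_module R B)" by (rule basis_elem_in[OF R.is_cring b])
  then show ?thesis by (auto simp: linear_on_def hom_module_simps linear_mapsD(3))
qed

lemma hom_free_eqI:
  assumes M: "module R M" and "f \<in> linear_maps R (free_module R B) M" "g \<in> linear_maps R (free_module R B) M"
    and "\<And>b. b \<in> B \<Longrightarrow> f (basis_elem R b) = g (basis_elem R b)"
  shows "f = g"
  using linear_on_free_eqI[OF M linear_mapsD(1)[OF assms(2)] linear_mapsD(1)[OF assms(3)] assms(4)]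
  by (rule linear_maps_eqI[OF assms(2,3)])

text \<open>A map into Hom(free module on \<open>B\<close>, M) amounts to a family of maps into
  \<open>M\<close> indexed by \<open>B\<close>. Evaluation at basis elements gives the components,
  and \<open>free_lift\<close> at each point reassembles the map.\<close>

lemma hom_into_dual_exists:
  assumes P: "module R P" and M: "module R M" and e: "\<And>b. b \<in> B \<Longrightarrow> e b \<in> linear_maps R P M"
  shows "\<exists>c\<in>linear_maps R P (hom_module R (free_module R B) M).
    \<forall>y\<in>carrier P. \<forall>b\<in>B. c y (basis_elem R b) = e b y"
proof -
  interpret M: module R M by fact
  interpret P: module R P by fact
  let ?E = "free_module R B"
  have E: "module R ?E" by (rule free_module_module[OF M.R.is_cring])
  have be: "basis_elem R b \<in> carrier ?E" if "b \<in> B" for b by (rule basis_elem_in[OF M.R.is_cring that])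
  define c where "c = (\<lambda>y\<in>carrier P. free_lift R B M (\<lambda>b. e b y))"
  have ec: "(\<lambda>b. e b y) \<in> B \<rightarrow> carrier M" if "y \<in> carrier P" for y
    using linear_mapsD(3)[OF e that] by blast
  have lin: "c y \<in> linear_maps R ?E M" if "y \<in> carrier P" for y
    using free_lift_linear[OF M ec[OF that]] that by (simp add: c_def)
  have val: "c y (basis_elem R b) = e b y" if "y \<in> carrier P" "b \<in> B" for y b
    using free_lift_basis[OF M ec[OF that(1)] that(2)] that by (simp add: c_def)
  note cl = hom_module_closed[OF E M]
  have "c \<in> linear_maps R P (hom_module R ?E M)"
    unfolding linear_maps_iff[of c] linear_on_def hom_module_simps(1)
  proof (intro conjI ballI)
    show "c \<in> extensional (carrier P)" by (simp add: c_def)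
    fix x assume x: "x \<in> carrier P"
    show "c x \<in> linear_maps R ?E M" by (rule lin[OF x])
    show "c (x \<oplus>\<^bsub>P\<^esub> y) = c x \<oplus>\<^bsub>hom_module R ?E M\<^esub> c y" if y: "y \<in> carrier P" for y
    proof (rule hom_free_eqI[OF M lin[OF P.M.add.m_closed[OF x y]] cl(2)[OF lin[OF x] lin[OF y]]])
      fix b assume b: "b \<in> B"
      show "c (x \<oplus>\<^bsub>P\<^esub> y) (basis_elem R b) = (c x \<oplus>\<^bsub>hom_module R ?E M\<^esub> c y) (basis_elem R b)"
        using val b x y be[OF b] linear_onD(2)[OF linear_mapsD(1)[OF e[OF b]] x y] by (simp add: hom_module_simps)
    qed
    show "c (r \<odot>\<^bsub>P\<^esub> x) = r \<odot>\<^bsub>hom_module R ?E M\<^esub> c x" if r: "r \<in> carrier R" for r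
    proof (rule hom_free_eqI[OF M lin[OF P.smult_closed[OF r x]] cl(3)[OF r lin[OF x]]])
      fix b assume b: "b \<in> B"
      show "c (r \<odot>\<^bsub>P\<^esub> x) (basis_elem R b) = (r \<odot>\<^bsub>hom_module R ?E M\<^esub> c x) (basis_elem R b)"
        using val b x r be[OF b] linear_onD(3)[OF linear_mapsD(1)[OF e[OF b]] r x] by (simp add: hom_module_simps)
    qed
  qed
  then show ?thesis using val by blast
qed

section \<open>Cohomology of Hom with values in a module and in powers of it\<close>

text \<open>F -> F' -> F'' are three consecutive terms of a chain complex. Hom reverses the arrows,
  so cocycles on \<open>F'\<close> are tested along \<open>d\<close> and coboundaries arrive from
  \<open>F''\<close>.\<close>

definition cocycles ::
  "('a, 'r) ring_scheme \<Rightarrow> ('a, 'p, 'm) module_scheme \<Rightarrow> ('a, 'q, 'k) module_scheme \<Rightarrow> ('p \<Rightarrow> 'q) \<Rightarrow>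
    ('a, 'n, 'l) module_scheme \<Rightarrow> ('q \<Rightarrow> 'n) set" where
  "cocycles R F F' d N = {f \<in> linear_maps R F' N. compose (carrier F) f d = \<zero>\<^bsub>hom_module R F N\<^esub>}"

definition coboundaries ::
  "('a, 'r) ring_scheme \<Rightarrow> ('a, 'q, 'm) module_scheme \<Rightarrow> ('a, 's, 'k) module_scheme \<Rightarrow> ('q \<Rightarrow> 's) \<Rightarrow>
    ('a, 'n, 'l) module_scheme \<Rightarrow> ('q \<Rightarrow> 'n) set" where
  "coboundaries R F' F'' d' N = (\<lambda>g. compose (carrier F') g d') ` linear_maps R F'' N"

lemma cocycles_iff:
  assumes "module R F" "module R N" "linear_on R F F' d"
  shows "f \<in> cocycles R F F' d N \<longleftrightarrow> f \<in> linear_maps R F' N \<and> (\<forall>x\<in>carrier F. f (d x) = \<zero>\<^bsub>N\<^esub>)"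
proof -
  have "compose (carrier F) f d = \<zero>\<^bsub>hom_module R F N\<^esub> \<longleftrightarrow> (\<forall>x\<in>carrier F. f (d x) = \<zero>\<^bsub>N\<^esub>)"
    if f: "f \<in> linear_maps R F' N"
  proof
    assume "compose (carrier F) f d = \<zero>\<^bsub>hom_module R F N\<^esub>"
    then show "\<forall>x\<in>carrier F. f (d x) = \<zero>\<^bsub>N\<^esub>"
      using fun_cong[of "compose (carrier F) f d" "\<zero>\<^bsub>hom_module R F N\<^esub>"]
      by (metis compose_apply hom_module_simps(2))
  next
    assume "\<forall>x\<in>carrier F. f (d x) = \<zero>\<^bsub>N\<^esub>"
    then show "compose (carrier F) f d = \<zero>\<^bsub>hom_module R F N\<^esub>"
      by (intro linear_maps_eqI[OF compose_linear[OF assms(1,3) linear_mapsD(1)[OF f]] hom_module_closed(1)[OF assms(1,2)]])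
         (simp add: compose_apply hom_module_simps)
  qed
  then show ?thesis unfolding cocycles_def by blast
qed

lemma coboundaries_iff:
  assumes "module R F'" "linear_on R F' F'' d'"
  shows "f \<in> coboundaries R F' F'' d' N \<longleftrightarrow>
    f \<in> linear_maps R F' N \<and> (\<exists>g\<in>linear_maps R F'' N. \<forall>x\<in>carrier F'. f x = g (d' x))"
proof
  assume "f \<in> coboundaries R F' F'' d' N"
  then obtain g where g: "g \<in> linear_maps R F'' N" "f = compose (carrier F') g d'"
    unfolding coboundaries_def by blast
  then show "f \<in> linear_maps R F' N \<and> (\<exists>g\<in>linear_maps R F'' N. \<forall>x\<in>carrier F'. f x = g (d' x))"
    using compose_linear[OF assms linear_mapsD(1)[OF g(1)]] by (auto simp: compose_apply)
next
  assume f: "f \<in> linear_maps R F' N \<and> (\<exists>g\<in>linear_maps R F'' N. \<forall>x\<in>carrier F'. f x = g (d' x))"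
  then obtain g where g: "g \<in> linear_maps R F'' N" "\<And>x. x \<in> carrier F' \<Longrightarrow> f x = g (d' x)" by blast
  have "f = compose (carrier F') g d'"
    by (rule linear_maps_eqI[OF _ compose_linear[OF assms linear_mapsD(1)[OF g(1)]]])
       (use f g(2) in \<open>auto simp: compose_apply\<close>)
  then show "f \<in> coboundaries R F' F'' d' N" using g(1) unfolding coboundaries_def by blast
qed

context
  fixes R :: "('a, 'r) ring_scheme" and F :: "('a, 'p) module" and F' :: "('a, 'q) module" and F'' :: "('a, 's) module"
    and d d'
  assumes R: "cring R" "noetherian_ring R"
    and F: "module R F" "module R F'" "module R F''"
    and d: "linear_on R F F' d" "linear_on R F' F'' d'"
    and d_d: "\<forall>x\<in>carrier F. d' (d x) = \<zero>\<^bsub>F''\<^esub>"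
begin

lemmas dd = bspec[OF d_d]

abbreviation "Zc \<equiv> cocycles R F F' d"
abbreviation "Bc \<equiv> coboundaries R F' F'' d'"

lemmas Zc_iff = cocycles_iff[OF F(1) _ d(1)] and Bc_iff = coboundaries_iff[OF F(2) d(2)]

lemma cocycles_submodule: "module R N \<Longrightarrow> submodule (Zc N) R (hom_module R F' N)"
  using submodule_kernel[OF hom_module_module[OF F(2)] hom_module_module[OF F(1)] hom_precompose_linear[OF F(1,2) _ d(1)]]
  by (simp add: cocycles_def hom_module_simps)

lemma coboundaries_submodule: "module R N \<Longrightarrow> submodule (Bc N) R (hom_module R F' N)"
  using submodule_image[OF hom_module_module[OF F(3)] hom_module_module[OF F(2)] hom_precompose_linear[OF F(2,3) _ d(2)]
    module.carrier_is_submodule[OF hom_module_module[OF F(3)]]]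
  by (simp add: coboundaries_def hom_module_simps)

lemma coboundaries_cocycles:
  assumes N: "module R N" shows "Bc N \<subseteq> Zc N"
proof
  fix f assume "f \<in> Bc N"
  then obtain g where g: "f \<in> linear_maps R F' N" "g \<in> linear_maps R F'' N" "\<And>x. x \<in> carrier F' \<Longrightarrow> f x = g (d' x)"
    unfolding Bc_iff by blast
  have "f (d x) = \<zero>\<^bsub>N\<^esub>" if "x \<in> carrier F" for x
    using g(3)[OF linear_onD(1)[OF d(1) that]] dd[OF that] linear_zero[OF F(3) N g(2)] by simp
  then show "f \<in> Zc N" using g(1) Zc_iff[OF N] by blast
qed

lemma evaluation_cocycle:
  assumes M: "module R M" and b: "b \<in> B" and c: "c \<in> Zc (hom_module R (free_module R B) M)"
  shows "compose (carrier F') (\<lambda>f. f (basis_elem R b)) c \<in> Zc M"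
proof -
  let ?K = "hom_module R (free_module R B) M"
  note E = free_module_module[OF R(1)]
  have K: "module R ?K" by (rule hom_module_module[OF E M])
  have c': "c \<in> linear_maps R F' ?K" "\<And>x. x \<in> carrier F \<Longrightarrow> c (d x) = \<zero>\<^bsub>?K\<^esub>" using c Zc_iff[OF K] by blast+
  show ?thesis unfolding Zc_iff[OF M]
  proof (intro conjI ballI)
    show "compose (carrier F') (\<lambda>f. f (basis_elem R b)) c \<in> linear_maps R F' M"
      by (rule compose_linear[OF F(2) linear_mapsD(1)[OF c'(1)] evaluation_linear[OF M b]])
    fix x assume x: "x \<in> carrier F"
    show "compose (carrier F') (\<lambda>f. f (basis_elem R b)) c (d x) = \<zero>\<^bsub>M\<^esub>"
      using c'(2)[OF x] linear_onD(1)[OF d(1) x] basis_elem_in[OF R(1) b]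
      by (simp add: compose_apply hom_module_simps)
  qed
qed

text \<open>Values in the dual of a free module of finite rank are tuples of values in
  \<open>M\<close>. Cocycles are filtered by \<open>Z T\<close>, those whose components outside
  \<open>T\<close> vanish, and evaluation at one new basis element bounds each step of the
  filtration.\<close>

lemma fg_cohomology_dual:
  assumes M: "module R M" and B: "finite B" and fg: "fg_over R (hom_module R F' M) (Zc M) (Bc M)"
  defines "K \<equiv> hom_module R (free_module R B) M"
  shows "fg_over R (hom_module R F' K) (Zc K) (Bc K)"
proof -
  interpret M: module R M by fact
  have E: "module R (free_module R B)" by (rule free_module_module[OF R(1)])
  have K: "module R K" unfolding K_def by (rule hom_module_module[OF E M])
  have H: "module R (hom_module R F' K)" "module R (hom_module R F' M)"
    by (rule hom_module_module[OF F(2)] K M)+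
  interpret H: module R "hom_module R F' K" by (rule H)
  let ?H = "hom_module R F' K"
  let ?ev = "\<lambda>b c. compose (carrier F') (\<lambda>f. f (basis_elem R b)) c"
  define Z where "Z T = {c \<in> Zc K. \<forall>b\<in>B - T. \<forall>y\<in>carrier F'. c y (basis_elem R b) = \<zero>\<^bsub>M\<^esub>}" for T
  have be: "basis_elem R b \<in> carrier (free_module R B)" if "b \<in> B" for b by (rule basis_elem_in[OF R(1) that])
  note ZcD = submoduleD[OF H(1) cocycles_submodule[OF K]]
  have plus: "(c \<oplus>\<^bsub>?H\<^esub> e) y (basis_elem R b) = c y (basis_elem R b) \<oplus>\<^bsub>M\<^esub> e y (basis_elem R b)"
    if "y \<in> carrier F'" "b \<in> B" for c e y b
    using that be by (simp add: hom_module_simps K_def)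
  have val: "c y (basis_elem R b) \<in> carrier M" if "c \<in> linear_maps R F' K" "y \<in> carrier F'" "b \<in> B" for c y b
    using linear_mapsD(3)[OF _ be[OF that(3)]] linear_mapsD(3)[OF that(1,2)] unfolding K_def hom_module_simps(1) by blast
  have Zsub: "submodule (Z T) R ?H" for T
  proof -
    have "\<zero>\<^bsub>?H\<^esub> \<in> Z T" unfolding Z_def using ZcD(2) be by (auto simp: hom_module_simps K_def)
    moreover have "c \<oplus>\<^bsub>?H\<^esub> e \<in> Z T" if "c \<in> Z T" "e \<in> Z T" for c e
      using that ZcD(3) plus unfolding Z_def by auto
    moreover have "r \<odot>\<^bsub>?H\<^esub> c \<in> Z T" if "r \<in> carrier R" "c \<in> Z T" for r c
    proof -
      have "(r \<odot>\<^bsub>?H\<^esub> c) y (basis_elem R b) = r \<odot>\<^bsub>M\<^esub> c y (basis_elem R b)" if "y \<in> carrier F'" "b \<in> B" for y b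
        using that be by (simp add: hom_module_simps K_def)
      then show ?thesis using that ZcD(5) unfolding Z_def by auto
    qed
    moreover have "Z T \<subseteq> carrier ?H" using ZcD(1) unfolding Z_def by blast
    ultimately show ?thesis unfolding submodule_iff[OF H(1)] by blast
  qed
  have "fg_over R ?H (Z T) (Bc K)" if "finite T" "T \<subseteq> B" for T
    using that
  proof (induction T)
    case empty
    have "Z {} \<subseteq> Bc K"
    proof
      fix c assume c: "c \<in> Z {}"
      then have cl: "c \<in> linear_maps R F' K" unfolding Z_def Zc_iff[OF K] by blast
      have "c = \<zero>\<^bsub>?H\<^esub>"
      proof (rule linear_maps_eqI[OF cl hom_module_closed(1)[OF F(2) K]])
        fix y assume y: "y \<in> carrier F'"
        have "c y = \<zero>\<^bsub>K\<^esub>"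
        proof (rule hom_free_eqI[OF M])
          show "c y \<in> linear_maps R (free_module R B) M" using linear_mapsD(3)[OF cl y] by (simp add: K_def hom_module_simps)
          show "\<zero>\<^bsub>K\<^esub> \<in> linear_maps R (free_module R B) M" unfolding K_def by (rule hom_module_closed(1)[OF E M])
          show "c y (basis_elem R b) = \<zero>\<^bsub>K\<^esub> (basis_elem R b)" if "b \<in> B" for b
            using c y that be[OF that] unfolding Z_def by (auto simp: K_def hom_module_simps)
        qed
        then show "c y = \<zero>\<^bsub>?H\<^esub> y" using y by (simp add: hom_module_simps)
      qed
      then show "c \<in> Bc K" using submoduleD(2)[OF H(1) coboundaries_submodule[OF K]] by simp
    qed
    then show ?case by (rule fg_over_subset)
  next
    case (insert s T)
    then have s: "s \<in> B" by blast
    have ev: "linear_on R (hom_module R F' K) (hom_module R F' M) (?ev s)"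
      by (rule hom_postcompose_linear[OF F(2) K M evaluation_linear[OF M s, folded K_def]])
    have evZ: "linear_on R (?H\<lparr>carrier := Z (insert s T)\<rparr>) (hom_module R F' M) (?ev s)"
      using ev submoduleD(6)[OF H(1) Zsub] by (auto simp: linear_on_def)
    show ?case
    proof (rule fg_over_extension[OF H Zsub evZ coboundaries_submodule[OF M]])
      have "?ev s ` Z (insert s T) \<subseteq> Zc M"
        using evaluation_cocycle[OF M s] unfolding Z_def K_def by blast
      then show "fg_over R (hom_module R F' M) (?ev s ` Z (insert s T)) (Bc M)"
        by (rule fg_over_submodule[OF R H(2) coboundaries_submodule[OF M] cocycles_submodule[OF M]
              submodule_image[OF H ev Zsub] _ fg])
      have "fg_over R ?H (Z T) (Bc K)" using insert by blast
      then show "fg_over R ?H {z \<in> Z (insert s T). ?ev s z \<in> Bc M} (Bc K)"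
      proof (rule fg_over_enlarge[OF H(1) _ _ order_refl])
        show "Z T \<subseteq> {z \<in> Z (insert s T). ?ev s z \<in> Bc M}"
        proof
          fix c assume c: "c \<in> Z T"
          then have cl: "c \<in> linear_maps R F' K" unfolding Z_def Zc_iff[OF K] by blast
          have "?ev s c = \<zero>\<^bsub>hom_module R F' M\<^esub>"
            by (rule linear_maps_eqI[OF linear_onD(1)[OF ev, unfolded hom_module_simps(1), OF cl] hom_module_closed(1)[OF F(2) M]])
               (use c insert.hyps s in \<open>auto simp: Z_def compose_apply hom_module_simps\<close>)
          then have "?ev s c \<in> Bc M" using submoduleD(2)[OF H(2) coboundaries_submodule[OF M]] by simp
          then show "c \<in> {z \<in> Z (insert s T). ?ev s z \<in> Bc M}" using c unfolding Z_def by blast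
        qed
        fix c assume c: "c \<in> {z \<in> Z (insert s T). ?ev s z \<in> Bc M}"
        then have cZ: "c \<in> Zc K" and cl: "c \<in> linear_maps R F' K" unfolding Z_def Zc_iff[OF K] by blast+
        obtain g where g: "g \<in> linear_maps R F'' M" "\<And>y. y \<in> carrier F' \<Longrightarrow> c y (basis_elem R s) = g (d' y)"
          using c unfolding Bc_iff by (auto simp: compose_apply)
        \<comment> \<open>The primitive \<open>g\<close> of the \<open>s\<close>-component is
          extended by zero, so subtracting the resulting coboundary removes that component and
          leaves the others unchanged.\<close>
        define e where "e b = (if b = s then g else \<zero>\<^bsub>hom_module R F'' M\<^esub>)" for b
        have el: "e b \<in> linear_maps R F'' M" for b using g(1) hom_module_closed(1)[OF F(3) M] by (simp add: e_def)
        have "\<exists>w\<in>linear_maps R F'' K. \<forall>y\<in>carrier F''. \<forall>b\<in>B. w y (basis_elem R b) = e b y"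
          unfolding K_def by (rule hom_into_dual_exists[OF F(3) M el])
        then obtain w where
          w: "w \<in> linear_maps R F'' K" "\<And>y b. y \<in> carrier F'' \<Longrightarrow> b \<in> B \<Longrightarrow> w y (basis_elem R b) = e b y" by blast
        define v where "v = compose (carrier F') w d'"
        have vB: "v \<in> Bc K" unfolding v_def coboundaries_def using w(1) by blast
        then have vZ: "v \<in> Zc K" using coboundaries_cocycles[OF K] by blast
        then have vl: "v \<in> linear_maps R F' K" unfolding Zc_iff[OF K] by blast
        have vval: "v y (basis_elem R b) = e b (d' y)" if "y \<in> carrier F'" "b \<in> B" for y b
          using w(2)[OF linear_onD(1)[OF d(2) that(1)] that(2)] that(1) by (simp add: v_def compose_apply)
        define h where "h = c \<ominus>\<^bsub>?H\<^esub> v"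
        have h: "h \<in> Zc K" unfolding h_def by (rule ZcD(4)[OF cZ vZ])
        then have hl: "h \<in> linear_maps R F' K" unfolding Zc_iff[OF K] by blast
        have ch: "c = h \<oplus>\<^bsub>?H\<^esub> v" unfolding h_def using H.minus_add_cancel(2)[of c v] cl vl by (simp add: hom_module_simps)
        have "h y (basis_elem R b) = \<zero>\<^bsub>M\<^esub>" if b: "b \<in> B - T" and y: "y \<in> carrier F'" for b y
        proof -
          have "c y (basis_elem R b) = e b (d' y)"
          proof (cases "b = s")
            case False
            then show ?thesis using c b y linear_onD(1)[OF d(2) y] unfolding Z_def by (simp add: e_def hom_module_simps)
          qed (use g(2)[OF y] in \<open>simp add: e_def\<close>)
          then have "h y (basis_elem R b) \<oplus>\<^bsub>M\<^esub> v y (basis_elem R b) = v y (basis_elem R b)"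
            using plus[OF y, of b h v] b vval[OF y] ch by simp
          then show ?thesis using val[OF hl y] val[OF vl y] b by (metis DiffD1 M.M.add.r_cancel_one)
        qed
        then have "h \<in> Z T" unfolding Z_def using h by blast
        then show "\<exists>y\<in>Z T. \<exists>w\<in>Bc K. c = y \<oplus>\<^bsub>?H\<^esub> w" using ch vB by blast
      qed
    qed
  qed
  moreover have "Z B = Zc K" unfolding Z_def by simp
  ultimately show ?thesis using B by fastforce
qed

text \<open>Evaluation at \<open>b\<close> has a section on cocycles: a cocycle in \<open>M\<close>
  is put into the component \<open>b\<close>, with zeros elsewhere. Hence cocycles map onto
  cocycles, while coboundaries map into coboundaries.\<close>

lemma fg_cohomology_of_dual:
  assumes M: "module R M" and b: "b \<in> B"
  defines "K \<equiv> hom_module R (free_module R B) M"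
  assumes fg: "fg_over R (hom_module R F' K) (Zc K) (Bc K)"
  shows "fg_over R (hom_module R F' M) (Zc M) (Bc M)"
proof -
  have K: "module R K" unfolding K_def by (rule hom_module_module[OF free_module_module[OF R(1)] M])
  note H = hom_module_module[OF F(2)]
  let ?ev = "\<lambda>c. compose (carrier F') (\<lambda>f. f (basis_elem R b)) c"
  have ev: "linear_on R (hom_module R F' K) (hom_module R F' M) ?ev"
    by (rule hom_postcompose_linear[OF F(2) K M evaluation_linear[OF M b, folded K_def]])
  have fg': "fg_over R (hom_module R F' M) (?ev ` Zc K) (?ev ` Bc K)"
    by (rule fg_over_image[OF H[OF K] H[OF M] ev submoduleD(1)[OF H[OF K] cocycles_submodule[OF K]]
          submoduleD(1)[OF H[OF K] coboundaries_submodule[OF K]] fg])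
  have "?ev ` Zc K = Zc M"
  proof
    show "?ev ` Zc K \<subseteq> Zc M" using evaluation_cocycle[OF M b] unfolding K_def by blast
    show "Zc M \<subseteq> ?ev ` Zc K"
    proof
      fix f assume f: "f \<in> Zc M"
      then have fl: "f \<in> linear_maps R F' M" and f0: "\<And>x. x \<in> carrier F \<Longrightarrow> f (d x) = \<zero>\<^bsub>M\<^esub>"
        unfolding Zc_iff[OF M] by blast+
      define e where "e a = (if a = b then f else \<zero>\<^bsub>hom_module R F' M\<^esub>)" for a
      have el: "e a \<in> linear_maps R F' M" for a using fl hom_module_closed(1)[OF F(2) M] by (simp add: e_def)
      have "\<exists>c\<in>linear_maps R F' K. \<forall>y\<in>carrier F'. \<forall>a\<in>B. c y (basis_elem R a) = e a y"
        unfolding K_def by (rule hom_into_dual_exists[OF F(2) M el])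
      then obtain c where
        c: "c \<in> linear_maps R F' K" "\<And>y a. y \<in> carrier F' \<Longrightarrow> a \<in> B \<Longrightarrow> c y (basis_elem R a) = e a y" by blast
      have "c (d x) = \<zero>\<^bsub>K\<^esub>" if x: "x \<in> carrier F" for x
      proof (rule hom_free_eqI[OF M])
        have dx: "d x \<in> carrier F'" by (rule linear_onD(1)[OF d(1) x])
        show "c (d x) \<in> linear_maps R (free_module R B) M"
          using linear_mapsD(3)[OF c(1) dx] by (simp add: K_def hom_module_simps)
        show "\<zero>\<^bsub>K\<^esub> \<in> linear_maps R (free_module R B) M"
          unfolding K_def by (rule hom_module_closed(1)[OF free_module_module[OF R(1)] M])
        show "c (d x) (basis_elem R a) = \<zero>\<^bsub>K\<^esub> (basis_elem R a)" if a: "a \<in> B" for a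
          using c(2)[OF dx a] f0[OF x] dx basis_elem_in[OF R(1) a] by (simp add: e_def K_def hom_module_simps)
      qed
      then have cZ: "c \<in> Zc K" unfolding Zc_iff[OF K] using c(1) by blast
      have "f = ?ev c"
        by (rule linear_maps_eqI[OF fl linear_onD(1)[OF ev, unfolded hom_module_simps(1), OF c(1)]])
           (simp add: compose_apply c(2) b e_def)
      then show "f \<in> ?ev ` Zc K" using cZ by (rule image_eqI)
    qed
  qed
  with fg' have fg'': "fg_over R (hom_module R F' M) (Zc M) (?ev ` Bc K)" by simp
  have "?ev ` Bc K \<subseteq> Bc M"
  proof
    fix f assume "f \<in> ?ev ` Bc K"
    then obtain c where c: "c \<in> Bc K" "f = ?ev c" by blast
    then obtain g where g: "c \<in> linear_maps R F' K" "g \<in> linear_maps R F'' K" "\<And>x. x \<in> carrier F' \<Longrightarrow> c x = g (d' x)"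
      unfolding Bc_iff by blast
    let ?g = "compose (carrier F'') (\<lambda>f. f (basis_elem R b)) g"
    have gl: "?g \<in> linear_maps R F'' M"
      by (rule compose_linear[OF F(3) linear_mapsD(1)[OF g(2)] evaluation_linear[OF M b, folded K_def]])
    have "\<forall>x\<in>carrier F'. f x = ?g (d' x)"
    proof
      fix x assume that: "x \<in> carrier F'"
      show "f x = ?g (d' x)"
        using that g(3)[OF that] linear_onD(1)[OF d(2) that] c(2) by (simp add: compose_apply)
    qed
    then have ex: "\<exists>g\<in>linear_maps R F'' M. \<forall>x\<in>carrier F'. f x = g (d' x)" using gl by (rule bexI)
    have "f \<in> linear_maps R F' M"
      unfolding c(2) by (rule linear_onD(1)[OF ev, unfolded hom_module_simps(1), OF g(1)])
    then show "f \<in> Bc M" using ex by (intro iffD2[OF Bc_iff] conjI)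
  qed
  with fg'' show ?thesis by (rule fg_over_weaken)
qed

text \<open>Primitives chosen for the single components assemble to one primitive.\<close>

lemma coboundary_into_dual:
  fixes B :: "'b set"
  assumes M: "module R M"
  defines "K \<equiv> hom_module R (free_module R B) M"
  assumes c: "c \<in> linear_maps R F' K"
    and ex: "\<And>b. b \<in> B \<Longrightarrow> \<exists>g\<in>linear_maps R F'' M. \<forall>y\<in>carrier F'. c y (basis_elem R b) = g (d' y)"
  shows "c \<in> Bc K"
proof -
  have "\<forall>b\<in>B. \<exists>g. g \<in> linear_maps R F'' M \<and> (\<forall>y\<in>carrier F'. c y (basis_elem R b) = g (d' y))"
    using ex by blast
  from bchoice[OF this] obtain e where e: "\<And>b. b \<in> B \<Longrightarrow> e b \<in> linear_maps R F'' M"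
    "\<And>b y. b \<in> B \<Longrightarrow> y \<in> carrier F' \<Longrightarrow> c y (basis_elem R b) = e b (d' y)" by blast
  have "\<exists>w\<in>linear_maps R F'' K. \<forall>y\<in>carrier F''. \<forall>b\<in>B. w y (basis_elem R b) = e b y"
    unfolding K_def by (rule hom_into_dual_exists[OF F(3) M e(1)])
  then obtain w where
    w: "w \<in> linear_maps R F'' K" "\<And>y b. y \<in> carrier F'' \<Longrightarrow> b \<in> B \<Longrightarrow> w y (basis_elem R b) = e b y" by blast
  have "c y = w (d' y)" if y: "y \<in> carrier F'" for y
  proof (rule hom_free_eqI[OF M])
    have dy: "d' y \<in> carrier F''" by (rule linear_onD(1)[OF d(2) y])
    show "c y \<in> linear_maps R (free_module R B) M" using linear_mapsD(3)[OF c y] by (simp add: K_def hom_module_simps)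
    show "w (d' y) \<in> linear_maps R (free_module R B) M"
      using linear_mapsD(3)[OF w(1) dy] by (simp add: K_def hom_module_simps)
    show "c y (basis_elem R b) = w (d' y) (basis_elem R b)" if "b \<in> B" for b
      using e(2)[OF that y] w(2)[OF dy that] by simp
  qed
  then have "\<exists>w\<in>linear_maps R F'' K. \<forall>y\<in>carrier F'. c y = w (d' y)" using w(1) by blast
  with c show ?thesis by (intro iffD2[OF Bc_iff] conjI)
qed

end

section \<open>Double complexes\<close>

text \<open>Both indices are shifted by one: index \<open>0\<close> stands for degree \<open>-1\<close>, where everything vanishes.\<close>

locale double_complex =
  fixes R :: "('a, 'r) ring_scheme" and C :: "nat \<Rightarrow> nat \<Rightarrow> ('a, 'c) module"
    and V H :: "nat \<Rightarrow> nat \<Rightarrow> 'c \<Rightarrow> 'c"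
  assumes cring: "cring R" and noetherian: "noetherian_ring R"
    and module: "module R (C n q)"
    and V: "linear_on R (C n q) (C (Suc n) q) (V n q)"
    and H: "linear_on R (C n q) (C n (Suc q)) (H n q)"
    and commute: "x \<in> carrier (C n q) \<Longrightarrow> H (Suc n) q (V n q x) = V n (Suc q) (H n q x)"
    and VV: "x \<in> carrier (C n q) \<Longrightarrow> V (Suc n) q (V n q x) = \<zero>\<^bsub>C (Suc (Suc n)) q\<^esub>"
    and HH: "x \<in> carrier (C n q) \<Longrightarrow> H n (Suc q) (H n q x) = \<zero>\<^bsub>C n (Suc (Suc q))\<^esub>"
    and row0: "carrier (C 0 q) = {\<zero>\<^bsub>C 0 q\<^esub>}"
    and col0: "carrier (C n 0) = {\<zero>\<^bsub>C n 0\<^esub>}"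
begin

text \<open>In the application \<open>V\<close> comes from the resolution and \<open>H\<close> from
  the Koszul complex. Thus \<open>kerV\<close> and \<open>imV\<close> compute Ext with values in
  K^q, \<open>kerH\<close> consists of the cochains with values in Z^q, and \<open>imH\<close> of
  those with values in the boundaries.\<close>

definition kerV where "kerV n q = {c \<in> carrier (C n q). V n q c = \<zero>\<^bsub>C (Suc n) q\<^esub>}"
definition kerH where "kerH n q = {c \<in> carrier (C n q). H n q c = \<zero>\<^bsub>C n (Suc q)\<^esub>}"
definition imV where "imV n q = V n q ` carrier (C n q)"
definition imH where "imH n q = H n q ` carrier (C n q)"

text \<open>With the shift of indices, \<open>V_finite n (Suc q)\<close> says that Ext^n(L, K^q) is
  finitely generated: the row index is raised in the body, the column index is not.\<close>

definition V_finite where "V_finite n q \<longleftrightarrow> fg_over R (C (Suc n) q) (kerV (Suc n) q) (imV n q)"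

text \<open>If \<open>C n\<close> is the complex \<open>Hom (F\<^sub>n, K)\<close> with \<open>F\<^sub>n\<close> projective, this is finite generation of the
  cohomology of \<open>Hom (F, H\<^sup>q\<^sup>+\<^sup>1 K)\<close> at index \<open>n + 1\<close>.\<close>

definition E2_finite where
  "E2_finite n q \<longleftrightarrow> fg_over R (C (Suc n) (Suc q))
     {c \<in> kerH (Suc n) (Suc q). V (Suc n) (Suc q) c \<in> imH (Suc (Suc n)) q}
     {v \<oplus>\<^bsub>C (Suc n) (Suc q)\<^esub> h | v h. v \<in> V n (Suc q) ` kerH n (Suc q) \<and> h \<in> imH (Suc n) q}"

text \<open>Finite generation of the kernel of Ext^n(L, B^q) -> Ext^n(L, K^q): cochains into B^q
  that are coboundaries in K^q, modulo coboundaries of cochains into B^q.\<close>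

definition mixed_finite where
  "mixed_finite n q \<longleftrightarrow> fg_over R (C (Suc n) (Suc q))
     (imV n (Suc q) \<inter> imH (Suc n) q) (V n (Suc q) ` imH n q)"

text \<open>Finite generation of Ext^n(L, B^q), with cochains into B^q written as horizontal
  images.\<close>

definition boundary_finite where
  "boundary_finite n q \<longleftrightarrow> fg_over R (C (Suc n) (Suc q))
     (kerV (Suc n) (Suc q) \<inter> imH (Suc n) q) (V n (Suc q) ` imH n q)"

lemmas Vc = linear_onD(1)[OF V] and Hc = linear_onD(1)[OF H]

lemma V0: "V n q \<zero>\<^bsub>C n q\<^esub> = \<zero>\<^bsub>C (Suc n) q\<^esub>" and H0: "H n q \<zero>\<^bsub>C n q\<^esub> = \<zero>\<^bsub>C n (Suc q)\<^esub>"
  using linear_on_zero[OF module module] V H by blast+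

lemma sub:
  "submodule (kerV n q) R (C n q)" "submodule (kerH n q) R (C n q)"
  "submodule (imV n q) R (C (Suc n) q)" "submodule (imH n q) R (C n (Suc q))"
  "submodule (V n (Suc q) ` imH n q) R (C (Suc n) (Suc q))"
  "submodule (V n q ` kerH n q) R (C (Suc n) q)"
proof -
  note c = module.carrier_is_submodule[OF module]
  show 1: "submodule (kerH n q) R (C n q)" "submodule (imH n q) R (C n (Suc q))"
    unfolding kerH_def imH_def by (rule submodule_kernel[OF module module H] submodule_image[OF module module H c])+
  show "submodule (kerV n q) R (C n q)" "submodule (imV n q) R (C (Suc n) q)"
    unfolding kerV_def imV_def by (rule submodule_kernel[OF module module V] submodule_image[OF module module V c])+
  show "submodule (V n (Suc q) ` imH n q) R (C (Suc n) (Suc q))" "submodule (V n q ` kerH n q) R (C (Suc n) q)"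
    by (rule submodule_image[OF module module V] 1)+
qed

lemmas fg_over_sub = fg_over_submodule[OF cring noetherian module]

lemma linear_on_restrict:
  assumes "submodule Z R (C n q)" "linear_on R (C n q) P f"
  shows "linear_on R (C n q\<lparr>carrier := Z\<rparr>) P f"
  using assms(2) submoduleD(6)[OF module assms(1)] by (auto simp: linear_on_def)

text \<open>The image of Ext^n(L, B^q) in Ext^n(L, K^q) is finitely generated as a submodule, and
  \<open>mixed_finite\<close> bounds the kernel.\<close>

lemma boundary_finiteI:
  assumes "V_finite n (Suc q)" "mixed_finite n q"
  shows "boundary_finite n q"
  unfolding boundary_finite_def
proof (rule fg_over_trans[OF module _ sub(3)])
  show s: "submodule (kerV (Suc n) (Suc q) \<inter> imH (Suc n) q) R (C (Suc n) (Suc q))"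
    by (rule submodule_Int[OF module sub(1) sub(4)])
  show "fg_over R (C (Suc n) (Suc q)) (kerV (Suc n) (Suc q) \<inter> imH (Suc n) q) (imV n (Suc q))"
    by (rule fg_over_sub[OF sub(3) sub(1) s _ assms(1)[unfolded V_finite_def]]) blast
  have "imV n (Suc q) \<subseteq> kerV (Suc n) (Suc q)" using VV Vc by (auto simp: imV_def kerV_def)
  then have "kerV (Suc n) (Suc q) \<inter> imH (Suc n) q \<inter> imV n (Suc q) = imV n (Suc q) \<inter> imH (Suc n) q" by blast
  then show "fg_over R (C (Suc n) (Suc q)) (kerV (Suc n) (Suc q) \<inter> imH (Suc n) q \<inter> imV n (Suc q)) (V n (Suc q) ` imH n q)"
    using assms(2) by (simp add: mixed_finite_def)
qed

text \<open>Row 0 vanishes, so there are no nonzero coboundaries in degree 0.\<close>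

lemma mixed_finite_0: "mixed_finite 0 q"
proof -
  have "imV 0 (Suc q) = {\<zero>\<^bsub>C (Suc 0) (Suc q)\<^esub>}" by (simp add: imV_def row0 V0)
  moreover have "V 0 (Suc q) ` imH 0 q = {\<zero>\<^bsub>C (Suc 0) (Suc q)\<^esub>}"
    by (simp add: imH_def row0 V0 H0)
  ultimately show ?thesis unfolding mixed_finite_def by (intro fg_over_subset) auto
qed

text \<open>Factor Ext^(n+1)(L, B^q) -> Ext^(n+1)(L, K^q) through Ext^(n+1)(L, Z^q). The kernel of
  the second map is covered by Ext^n(L, B^(q+1)), that of the first by Ext^n(L, H^q); on cochains
  both connecting maps are given by \<open>V\<close>.\<close>

lemma mixed_finite_Suc:
  assumes B: "boundary_finite n (Suc q)" and E: "E2_finite n q"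
  shows "mixed_finite (Suc n) q"
proof -
  let ?C = "C (Suc n) (Suc q)" and ?C' = "C (Suc (Suc n)) (Suc q)"
  let ?V = "V (Suc n) (Suc q)" and ?H = "H (Suc n) (Suc q)"
  let ?ker = "kerH (Suc n) (Suc q)"
  interpret M: module R ?C by (rule module)
  interpret M': module R ?C' by (rule module)
  \<comment> \<open>Lifts to K^q of cocycles with values in B^(q+1). Since the differentials
    commute, \<open>V\<close> sends them to cochains with values in Z^q.\<close>
  define Y where "Y = {e \<in> carrier ?C. ?H e \<in> kerV (Suc n) (Suc (Suc q))}"
  have Y: "submodule Y R ?C" unfolding Y_def by (rule submodule_vimage[OF module module H sub(1)])
  have Yc: "Y \<subseteq> carrier ?C" unfolding Y_def by blast
  \<comment> \<open>\<open>V\<close> kills the first summand, so the image of \<open>W\<close> is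
    that of \<open>?ker\<close>: the coboundaries of cochains into Z^q.\<close>
  define W where "W = {x \<oplus>\<^bsub>?C\<^esub> y |x y. x \<in> imV n (Suc q) \<and> y \<in> ?ker}"
  have "submodule W R ?C" unfolding W_def by (rule submodule_sum[OF module sub(3) sub(2)])
  note WD = submoduleD[OF module this]
  have "fg_over R ?C Y W"
  proof (rule fg_over_extension[OF module module Y linear_on_restrict[OF Y H]])
    show "submodule (V n (Suc (Suc q)) ` imH n (Suc q)) R (C (Suc n) (Suc (Suc q)))" by (rule sub(5))
    have s: "submodule (?H ` Y) R (C (Suc n) (Suc (Suc q)))" by (rule submodule_image[OF module module H Y])
    show "fg_over R (C (Suc n) (Suc (Suc q))) (?H ` Y) (V n (Suc (Suc q)) ` imH n (Suc q))"
      by (rule fg_over_sub[OF sub(5) submodule_Int[OF module sub(1) sub(4)] s _ B[unfolded boundary_finite_def]])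
         (auto simp: Y_def imH_def)
    \<comment> \<open>The horizontal image of \<open>c\<close> is the coboundary of a cochain that
      itself comes from some \<open>e\<close> under \<open>H\<close>. Subtracting the vertical image
      of \<open>e\<close> leaves an element of \<open>?ker\<close>.\<close>
    have "c \<in> W" if c: "c \<in> Y" "?H c \<in> V n (Suc (Suc q)) ` imH n (Suc q)" for c
    proof -
      obtain e where e: "e \<in> carrier (C n (Suc q))" "?H c = V n (Suc (Suc q)) (H n (Suc q) e)"
        using c(2) unfolding imH_def by blast
      define v where "v = V n (Suc q) e"
      have v: "v \<in> carrier ?C" using Vc[OF e(1)] unfolding v_def .
      have cc: "c \<in> carrier ?C" using c(1) Yc by blast
      have Hv: "?H v \<in> carrier (C (Suc n) (Suc (Suc q)))" using Hc[OF v] .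
      have "?H (c \<ominus>\<^bsub>?C\<^esub> v) = ?H c \<ominus>\<^bsub>C (Suc n) (Suc (Suc q))\<^esub> ?H v"
        by (rule linear_on_minus[OF module module H cc v])
      also have "?H c = ?H v" unfolding v_def commute[OF e(1)] by (rule e(2))
      also have "?H v \<ominus>\<^bsub>C (Suc n) (Suc (Suc q))\<^esub> ?H v = \<zero>\<^bsub>C (Suc n) (Suc (Suc q))\<^esub>"
        using module.minus_eq_zero[OF module Hv Hv] by simp
      finally have "c \<ominus>\<^bsub>?C\<^esub> v \<in> ?ker" unfolding kerH_def using cc v by simp
      moreover have "v \<in> imV n (Suc q)" using e unfolding imV_def v_def by blast
      moreover have "c = v \<oplus>\<^bsub>?C\<^esub> (c \<ominus>\<^bsub>?C\<^esub> v)" using M.minus_add_cancel[OF cc v] by simp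
      ultimately show ?thesis unfolding W_def by blast
    qed
    then show "fg_over R ?C {c \<in> Y. ?H c \<in> V n (Suc (Suc q)) ` imH n (Suc q)} W"
      by (intro fg_over_subset) blast
  qed
  then have "fg_over R ?C' (?V ` Y) (?V ` W)"
    by (rule fg_over_image[OF module module V Yc WD(1)])
  moreover have VW: "?V ` W = ?V ` ?ker"
  proof
    show "?V ` W \<subseteq> ?V ` ?ker"
    proof
      fix z assume "z \<in> ?V ` W"
      then obtain e y where e: "e \<in> carrier (C n (Suc q))" "y \<in> ?ker" "z = ?V (V n (Suc q) e \<oplus>\<^bsub>?C\<^esub> y)"
        unfolding W_def imV_def by blast
      have y: "y \<in> carrier ?C" using e(2) unfolding kerH_def by blast
      have "z = ?V (V n (Suc q) e) \<oplus>\<^bsub>?C'\<^esub> ?V y" unfolding e(3) by (rule linear_onD(2)[OF V Vc[OF e(1)] y])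
      then have "z = ?V y" using VV[OF e(1)] Vc[OF y] by simp
      then show "z \<in> ?V ` ?ker" using e(2) by blast
    qed
    have "?ker \<subseteq> W"
    proof
      fix y assume y: "y \<in> ?ker"
      then have "y = \<zero>\<^bsub>?C\<^esub> \<oplus>\<^bsub>?C\<^esub> y" unfolding kerH_def by simp
      then show "y \<in> W" unfolding W_def using y submoduleD(2)[OF module sub(3)] by blast
    qed
    then show "?V ` ?ker \<subseteq> ?V ` W" by blast
  qed
  ultimately have fgY: "fg_over R ?C' (?V ` Y) (?V ` ?ker)" by simp
  let ?Z = "imV (Suc n) (Suc q) \<inter> imH (Suc (Suc n)) q"
  have Z: "submodule ?Z R ?C'" by (rule submodule_Int[OF module sub(3) sub(4)])
  have ZY: "?Z \<subseteq> ?V ` Y"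
  proof
    fix z assume z: "z \<in> ?Z"
    then obtain e where e: "e \<in> carrier ?C" "z = ?V e" unfolding imV_def by blast
    from z obtain u where u: "u \<in> carrier (C (Suc (Suc n)) q)" "z = H (Suc (Suc n)) q u" unfolding imH_def by blast
    have "V (Suc n) (Suc (Suc q)) (?H e) = H (Suc (Suc n)) (Suc q) z"
      using commute[OF e(1)] e(2) by simp
    also have "\<dots> = \<zero>\<^bsub>C (Suc (Suc n)) (Suc (Suc q))\<^esub>" using HH[OF u(1)] u(2) by simp
    finally have "e \<in> Y" unfolding Y_def kerV_def using e(1) Hc by blast
    then show "z \<in> ?V ` Y" using e(2) by blast
  qed
  have "fg_over R ?C' ?Z (?V ` ?ker)"
    by (rule fg_over_sub[OF sub(6) submodule_image[OF module module V Y] Z ZY fgY])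
  \<comment> \<open>A cochain into Z^q whose coboundary has values in B^q is a cocycle modulo B^q,
    which is what \<open>E2_finite\<close> bounds. Under \<open>V\<close> the first summand of its
    denominator vanishes.\<close>
  moreover have "fg_over R ?C' (?Z \<inter> ?V ` ?ker) (?V ` imH (Suc n) q)"
  proof -
    let ?E = "{c \<in> ?ker. ?V c \<in> imH (Suc (Suc n)) q}"
    let ?D = "{v \<oplus>\<^bsub>?C\<^esub> h | v h. v \<in> V n (Suc q) ` kerH n (Suc q) \<and> h \<in> imH (Suc n) q}"
    have Dc: "submodule ?D R ?C" by (rule submodule_sum[OF module sub(6) sub(4)])
    have fg: "fg_over R ?C' (?V ` ?E) (?V ` ?D)"
      by (rule fg_over_image[OF module module V _ _ E[unfolded E2_finite_def]])
         (use submoduleD(1)[OF module Dc] in \<open>auto simp: kerH_def\<close>)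
    have "?V ` ?E = ?Z \<inter> ?V ` ?ker" by (auto simp: imV_def kerH_def)
    with fg have "fg_over R ?C' (?Z \<inter> ?V ` ?ker) (?V ` ?D)" by simp
    moreover have "?V ` ?D \<subseteq> ?V ` imH (Suc n) q"
    proof
      fix z assume "z \<in> ?V ` ?D"
      then obtain e h where e: "e \<in> kerH n (Suc q)" "h \<in> imH (Suc n) q" "z = ?V (V n (Suc q) e \<oplus>\<^bsub>?C\<^esub> h)" by blast
      have ec: "e \<in> carrier (C n (Suc q))" using e(1) unfolding kerH_def by blast
      have h: "h \<in> carrier ?C" using submoduleD(6)[OF module sub(4) e(2)] .
      have "z = ?V (V n (Suc q) e) \<oplus>\<^bsub>?C'\<^esub> ?V h" unfolding e(3) by (rule linear_onD(2)[OF V Vc[OF ec] h])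
      then have "z = ?V h" using VV[OF ec] Vc[OF h] by simp
      then show "z \<in> ?V ` imH (Suc n) q" using e(2) by blast
    qed
    ultimately show ?thesis by (rule fg_over_weaken)
  qed
  ultimately show ?thesis
    unfolding mixed_finite_def by (rule fg_over_trans[OF module Z sub(6)])
qed

text \<open>By \<open>ann\<close>, the map Ext^n(L, K^0) -> Ext^n(L, B^1) lands in the kernel of
  Ext^n(L, B^1) -> Ext^n(L, K^1), which is finitely generated by
  \<open>mixed_finite n (Suc 0)\<close>. What it kills comes from cocycles with values in Z^0 = H^0,
  bounded by \<open>E2_finite n 0\<close>.\<close>

lemma V_finiteI:
  assumes X: "mixed_finite n (Suc 0)" and E: "E2_finite n 0"
    and ann: "\<And>c. c \<in> kerV (Suc n) (Suc 0) \<Longrightarrow> H (Suc n) (Suc 0) c \<in> imV n (Suc (Suc 0))"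
  shows "V_finite n (Suc 0)"
proof -
  let ?C = "C (Suc n) (Suc 0)" and ?H = "H (Suc n) (Suc 0)" and ?Z = "kerV (Suc n) (Suc 0)"
  interpret M: module R ?C by (rule module)
  let ?B = "V n (Suc (Suc 0)) ` imH n (Suc 0)"
  have ZV: "submodule ?Z R ?C" by (rule sub(1))
  show ?thesis
    unfolding V_finite_def
  proof (rule fg_over_extension[OF module module ZV linear_on_restrict[OF ZV H] sub(5)])
    show "fg_over R (C (Suc n) (Suc (Suc 0))) (?H ` ?Z) ?B"
      by (rule fg_over_sub[OF sub(5) submodule_Int[OF module sub(3) sub(4)] submodule_image[OF module module H ZV] _
            X[unfolded mixed_finite_def]]) (use ann in \<open>auto simp: imH_def kerV_def\<close>)
    let ?E = "{c \<in> kerH (Suc n) (Suc 0). V (Suc n) (Suc 0) c \<in> imH (Suc (Suc n)) 0}"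
    \<comment> \<open>Column 0 stands for K^(-1) = 0: there are no boundaries in K^0.\<close>
    have imH0: "imH m 0 = {\<zero>\<^bsub>C m (Suc 0)\<^esub>}" for m by (simp add: imH_def col0 H0)
    have E_eq: "?E = kerH (Suc n) (Suc 0) \<inter> ?Z" by (auto simp: imH0 kerV_def kerH_def)
    have D_eq: "{v \<oplus>\<^bsub>?C\<^esub> h | v h. v \<in> V n (Suc 0) ` kerH n (Suc 0) \<and> h \<in> imH (Suc n) 0} = V n (Suc 0) ` kerH n (Suc 0)"
      (is "?D = ?K")
    proof
      have z: "v \<oplus>\<^bsub>?C\<^esub> \<zero>\<^bsub>?C\<^esub> = v" if "v \<in> ?K" for v
        using submoduleD(6)[OF module sub(6) that] by simp
      show "?D \<subseteq> ?K"
      proof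
        fix x assume "x \<in> ?D"
        then obtain v where "v \<in> ?K" "x = v \<oplus>\<^bsub>?C\<^esub> \<zero>\<^bsub>?C\<^esub>" unfolding imH0 by blast
        then show "x \<in> ?K" using z by simp
      qed
      show "?K \<subseteq> ?D"
      proof
        fix v assume v: "v \<in> ?K"
        then show "v \<in> ?D" unfolding imH0 using z[OF v, symmetric] by blast
      qed
    qed
    have "fg_over R ?C (kerH (Suc n) (Suc 0) \<inter> ?Z) (V n (Suc 0) ` kerH n (Suc 0))"
      using E unfolding E2_finite_def E_eq D_eq .
    then show "fg_over R ?C {z \<in> ?Z. ?H z \<in> ?B} (imV n (Suc 0))"
    proof (rule fg_over_enlarge[OF module])
      show "kerH (Suc n) (Suc 0) \<inter> ?Z \<subseteq> {z \<in> ?Z. ?H z \<in> ?B}"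
        using submoduleD(2)[OF module sub(5)] by (auto simp: kerH_def)
      show "V n (Suc 0) ` kerH n (Suc 0) \<subseteq> imV n (Suc 0)" by (auto simp: kerH_def imV_def)
      fix c assume c: "c \<in> {z \<in> ?Z. ?H z \<in> ?B}"
      then obtain e where e: "e \<in> carrier (C n (Suc 0))" "?H c = V n (Suc (Suc 0)) (H n (Suc 0) e)"
        unfolding imH_def by blast
      \<comment> \<open>Correcting \<open>c\<close> by this coboundary makes its horizontal image
        vanish and keeps it a cocycle.\<close>
      define v where "v = V n (Suc 0) e"
      have v: "v \<in> carrier ?C" "v \<in> ?Z" "v \<in> imV n (Suc 0)"
        using Vc[OF e(1)] VV[OF e(1)] e(1) unfolding v_def kerV_def imV_def by auto
      have cc: "c \<in> carrier ?C" "c \<in> ?Z" using c unfolding kerV_def by auto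
      have "?H (c \<ominus>\<^bsub>?C\<^esub> v) = ?H c \<ominus>\<^bsub>C (Suc n) (Suc (Suc 0))\<^esub> ?H v"
        by (rule linear_on_minus[OF module module H cc(1) v(1)])
      also have "?H c = ?H v" unfolding v_def commute[OF e(1)] by (rule e(2))
      also have "?H v \<ominus>\<^bsub>C (Suc n) (Suc (Suc 0))\<^esub> ?H v = \<zero>\<^bsub>C (Suc n) (Suc (Suc 0))\<^esub>"
        using module.minus_eq_zero[OF module Hc[OF v(1)] Hc[OF v(1)]] by simp
      finally have "c \<ominus>\<^bsub>?C\<^esub> v \<in> kerH (Suc n) (Suc 0) \<inter> ?Z"
        using cc v submoduleD(4)[OF module ZV cc(2) v(2)] by (simp add: kerH_def)
      moreover have "c = (c \<ominus>\<^bsub>?C\<^esub> v) \<oplus>\<^bsub>?C\<^esub> v" using M.minus_add_cancel[OF cc(1) v(1)] by simp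
      ultimately show "\<exists>y\<in>kerH (Suc n) (Suc 0) \<inter> ?Z. \<exists>w\<in>imV n (Suc 0). c = y \<oplus>\<^bsub>?C\<^esub> w"
        using v(3) by blast
    qed
  qed
qed

text \<open>The induction carries \<open>mixed_finite n q\<close> for all \<open>q\<close>, because
  the step for \<open>q\<close> calls on \<open>q + 1\<close>. Within a step the first column is
  settled from \<open>ann\<close>, and \<open>copies\<close> transfers it to the other
  columns.\<close>

theorem V_finite_first_column:
  assumes E: "\<And>n q. E2_finite n q"
    and ann: "\<And>n c. c \<in> kerV (Suc n) (Suc 0) \<Longrightarrow> H (Suc n) (Suc 0) c \<in> imV n (Suc (Suc 0))"
    and copies: "\<And>n q. V_finite n (Suc 0) \<Longrightarrow> V_finite n (Suc q)"
  shows "V_finite n (Suc 0)"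
proof -
  have "mixed_finite n q" for q
  proof (induction n arbitrary: q)
    case 0
    show ?case by (rule mixed_finite_0)
  next
    case (Suc n)
    have "V_finite n (Suc 0)" using Suc E ann by (rule V_finiteI)
    then show ?case using Suc E copies by (intro mixed_finite_Suc boundary_finiteI)
  qed
  then show ?thesis using E ann by (rule V_finiteI)
qed

end

section \<open>The double complex of maps from a free resolution\<close>

text \<open>Index 0 is degree -1 in both families, whence \<open>F_0\<close> and \<open>K_0\<close>.
  The maps \<open>u q\<close> raise the index, as \<open>K\<close> is a cochain complex, while
  \<open>dF n\<close> lowers it.\<close>

locale hom_double_complex =
  fixes R :: "('a, 'r) ring_scheme" and Bs :: "nat \<Rightarrow> 'b set" and dF :: "nat \<Rightarrow> ('b \<Rightarrow> 'a) \<Rightarrow> 'b \<Rightarrow> 'a"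
    and K :: "nat \<Rightarrow> ('a, 'k) module" and u :: "nat \<Rightarrow> 'k \<Rightarrow> 'k"
  assumes R: "cring R" "noetherian_ring R"
    and dF: "linear_on R (free_module R (Bs (Suc n))) (free_module R (Bs n)) (dF n)"
    and dF_dF: "x \<in> carrier (free_module R (Bs (Suc (Suc n)))) \<Longrightarrow> dF n (dF (Suc n) x) = \<zero>\<^bsub>free_module R (Bs n)\<^esub>"
    and F_0: "carrier (free_module R (Bs 0)) = {\<zero>\<^bsub>free_module R (Bs 0)\<^esub>}"
    and K: "module R (K q)"
    and u: "linear_on R (K q) (K (Suc q)) (u q)"
    and u_u: "k \<in> carrier (K q) \<Longrightarrow> u (Suc q) (u q k) = \<zero>\<^bsub>K (Suc (Suc q))\<^esub>"
    and K_0: "carrier (K 0) = {\<zero>\<^bsub>K 0\<^esub>}"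
begin

abbreviation "F n \<equiv> free_module R (Bs n)"

lemma F: "module R (F n)"
  by (rule free_module_module[OF R(1)])

sublocale double_complex R "\<lambda>n q. hom_module R (F n) (K q)"
  "\<lambda>n q c. compose (carrier (F (Suc n))) c (dF n)" "\<lambda>n q c. compose (carrier (F n)) (u q) c"
proof (rule double_complex.intro)
  note comp = compose_linear[OF F]
  show "cring R" "noetherian_ring R" by (rule R)+
  show "module R (hom_module R (F n) (K q))" for n q by (rule hom_module_module[OF F K])
  show "linear_on R (hom_module R (F n) (K q)) (hom_module R (F (Suc n)) (K q)) (\<lambda>c. compose (carrier (F (Suc n))) c (dF n))" for n q
    by (rule hom_precompose_linear[OF F F K dF])
  show "linear_on R (hom_module R (F n) (K q)) (hom_module R (F n) (K (Suc q))) (\<lambda>c. compose (carrier (F n)) (u q) c)" for n q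
    by (rule hom_postcompose_linear[OF F K K u])
  show "carrier (hom_module R (F 0) (K q)) = {\<zero>\<^bsub>hom_module R (F 0) (K q)\<^esub>}" for q
    using F_0 by (intro hom_trivial F K) simp
  show "carrier (hom_module R (F n) (K 0)) = {\<zero>\<^bsub>hom_module R (F n) (K 0)\<^esub>}" for n
    using K_0 by (intro hom_trivial F K) simp
  fix c n q assume "c \<in> carrier (hom_module R (F n) (K q))"
  then have c: "c \<in> linear_maps R (F n) (K q)" by (simp add: hom_module_simps)
  note cl = linear_mapsD(1)[OF c]
  show "compose (carrier (F (Suc n))) (u q) (compose (carrier (F (Suc n))) c (dF n)) =
      compose (carrier (F (Suc n))) (compose (carrier (F n)) (u q) c) (dF n)"
    using linear_onD(1)[OF dF] by (auto simp: compose_def fun_eq_iff)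
  show "compose (carrier (F (Suc (Suc n)))) (compose (carrier (F (Suc n))) c (dF n)) (dF (Suc n)) =
      \<zero>\<^bsub>hom_module R (F (Suc (Suc n))) (K q)\<^esub>"
  proof (rule linear_maps_eqI[OF comp[OF dF linear_mapsD(1)[OF comp[OF dF cl]]] hom_module_closed(1)[OF F K]])
    fix x assume x: "x \<in> carrier (F (Suc (Suc n)))"
    show "compose (carrier (F (Suc (Suc n)))) (compose (carrier (F (Suc n))) c (dF n)) (dF (Suc n)) x =
        \<zero>\<^bsub>hom_module R (F (Suc (Suc n))) (K q)\<^esub> x"
      using x linear_onD(1)[OF dF x] dF_dF[OF x] linear_zero[OF F K c] by (simp add: compose_apply hom_module_simps)
  qed
  show "compose (carrier (F n)) (u (Suc q)) (compose (carrier (F n)) (u q) c) = \<zero>\<^bsub>hom_module R (F n) (K (Suc (Suc q)))\<^esub>"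
  proof (rule linear_maps_eqI[OF comp[OF linear_mapsD(1)[OF comp[OF cl u]] u] hom_module_closed(1)[OF F K]])
    fix x assume x: "x \<in> carrier (F n)"
    show "compose (carrier (F n)) (u (Suc q)) (compose (carrier (F n)) (u q) c) x = \<zero>\<^bsub>hom_module R (F n) (K (Suc (Suc q)))\<^esub> x"
      using x u_u[OF linear_mapsD(3)[OF c x]] by (simp add: compose_apply hom_module_simps)
  qed
qed

lemma kerV_eq: "kerV (Suc n) q = cocycles R (F (Suc (Suc n))) (F (Suc n)) (dF (Suc n)) (K q)"
  by (simp add: kerV_def cocycles_def hom_module_simps)

lemma imV_eq: "imV n q = coboundaries R (F (Suc n)) (F n) (dF n) (K q)"
  by (simp add: imV_def coboundaries_def hom_module_simps)

text \<open>Left exactness of Hom.\<close>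

lemma kerH_eq: "kerH n q = {c \<in> linear_maps R (F n) (K q). c ` carrier (F n) \<subseteq> {x \<in> carrier (K q). u q x = \<zero>\<^bsub>K (Suc q)\<^esub>}}"
proof -
  have "compose (carrier (F n)) (u q) c = \<zero>\<^bsub>hom_module R (F n) (K (Suc q))\<^esub> \<longleftrightarrow> (\<forall>x\<in>carrier (F n). u q (c x) = \<zero>\<^bsub>K (Suc q)\<^esub>)"
    if c: "c \<in> linear_maps R (F n) (K q)" for c
  proof
    assume *: "compose (carrier (F n)) (u q) c = \<zero>\<^bsub>hom_module R (F n) (K (Suc q))\<^esub>"
    show "\<forall>x\<in>carrier (F n). u q (c x) = \<zero>\<^bsub>K (Suc q)\<^esub>"
    proof
      fix x assume "x \<in> carrier (F n)"
      then show "u q (c x) = \<zero>\<^bsub>K (Suc q)\<^esub>" using fun_cong[OF *, of x] by (simp add: compose_apply hom_module_simps)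
    qed
  next
    assume "\<forall>x\<in>carrier (F n). u q (c x) = \<zero>\<^bsub>K (Suc q)\<^esub>"
    then show "compose (carrier (F n)) (u q) c = \<zero>\<^bsub>hom_module R (F n) (K (Suc q))\<^esub>"
      by (intro linear_maps_eqI[OF compose_linear[OF F linear_mapsD(1)[OF c] u] hom_module_closed(1)[OF F K]])
         (simp add: compose_apply hom_module_simps)
  qed
  then show ?thesis unfolding kerH_def hom_module_simps(1)
    using linear_mapsD(3)[of _ R "F n" "K q"] by (auto simp: image_subset_iff)
qed

text \<open>\<open>Q q\<close> has the shape produced by \<open>cohomology\<close>, so the
  hypothesis on Ext(L, H^q) can be inserted literally.\<close>

lemma E2_finiteI:
  defines "Q q \<equiv> quotient_module (K (Suc q)\<lparr>carrier := {x \<in> carrier (K (Suc q)). u (Suc q) x = \<zero>\<^bsub>K (Suc (Suc q))\<^esub>}\<rparr>)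
    (u q ` carrier (K q))"
  assumes fg: "fg_over R (hom_module R (F (Suc n)) (Q q))
    (cocycles R (F (Suc (Suc n))) (F (Suc n)) (dF (Suc n)) (Q q)) (coboundaries R (F (Suc n)) (F n) (dF n) (Q q))"
  shows "E2_finite n q"
proof -
  have sub: "submodule {x \<in> carrier (K (Suc q)). u (Suc q) x = \<zero>\<^bsub>K (Suc (Suc q))\<^esub>} R (K (Suc q))"
    by (rule submodule_kernel[OF K K u])
  have im: "u q ` carrier (K q) \<subseteq> {x \<in> carrier (K (Suc q)). u (Suc q) x = \<zero>\<^bsub>K (Suc (Suc q))\<^esub>}"
    using linear_onD(1)[OF u] u_u by auto
  note * = fg_over_hom_cohomology_module[OF R K K dF dF dF_dF u sub im fg[unfolded Q_def cocycles_def coboundaries_def]]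
  have E: "{c \<in> kerH (Suc n) (Suc q). compose (carrier (F (Suc (Suc n)))) c (dF (Suc n)) \<in> imH (Suc (Suc n)) q} =
    {c \<in> linear_maps R (F (Suc n)) (K (Suc q)).
      c ` carrier (F (Suc n)) \<subseteq> {x \<in> carrier (K (Suc q)). u (Suc q) x = \<zero>\<^bsub>K (Suc (Suc q))\<^esub>} \<and>
      compose (carrier (F (Suc (Suc n)))) c (dF (Suc n)) \<in>
        (\<lambda>w. compose (carrier (F (Suc (Suc n)))) (u q) w) ` linear_maps R (F (Suc (Suc n))) (K q)}"
    unfolding kerH_eq imH_def hom_module_simps(1) by blast
  show ?thesis
    unfolding E2_finite_def E unfolding kerH_eq imH_def hom_module_simps(1) by (rule *)
qed

lemma dF_dF': "\<forall>x\<in>carrier (F (Suc (Suc n))). dF n (dF (Suc n) x) = \<zero>\<^bsub>F n\<^esub>"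
  using dF_dF by blast

lemmas row_cohomology_dual = fg_cohomology_dual[OF R F[of "Suc (Suc n)"] F[of "Suc n"] F[of n] dF[of "Suc n"] dF[of n], OF dF_dF'[of n]]
  and row_cohomology_of_dual = fg_cohomology_of_dual[OF R F[of "Suc (Suc n)"] F[of "Suc n"] F[of n] dF[of "Suc n"] dF[of n], OF dF_dF'[of n]]
  and row_coboundary_into_dual = coboundary_into_dual[OF R F[of "Suc (Suc n)"] F[of "Suc n"] F[of n] dF[of "Suc n"] dF[of n], OF dF_dF'[of n]] for n

end

section \<open>The quotient by the ideal, Ext, and the conclusion\<close>

lemma ideal_submodule_self:
  assumes "cring R" "ideal I R" shows "submodule I R (self_module R)"
proof -
  interpret ideal I R by fact
  show ?thesis
    unfolding submodule_iff[OF self_module_module[OF assms(1)]]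
    using a_subset I_l_closed by (auto simp: self_module_def)
qed

text \<open>Supplies the annihilation hypothesis of \<open>res_cocycle_scalar\<close> for the
  quotient by the ideal.\<close>

lemma ideal_annihilates_quotient:
  assumes R: "cring R" and I: "ideal I R" and r: "r \<in> I" and l: "l \<in> carrier (quotient_module (self_module R) I)"
  shows "r \<odot>\<^bsub>quotient_module (self_module R) I\<^esub> l = \<zero>\<^bsub>quotient_module (self_module R) I\<^esub>"
proof -
  interpret ideal I R by fact
  note S = self_module_module[OF R] and IS = ideal_submodule_self[OF R I]
  note \<pi> = quotient_projection[OF S IS]
  obtain s where s: "s \<in> carrier (self_module R)" "l = I +>\<^bsub>self_module R\<^esub> s" using l \<pi>(2) by blast
  have "r \<in> carrier R" using r a_subset by blast
  then have "r \<odot>\<^bsub>quotient_module (self_module R) I\<^esub> l = I +>\<^bsub>self_module R\<^esub> (r \<odot>\<^bsub>self_module R\<^esub> s)"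
    unfolding s(2) by (rule quotient_smult[OF S IS _ s(1)])
  also have "r \<odot>\<^bsub>self_module R\<^esub> s \<in> I" using s(1) r I_r_closed by (simp add: self_module_def)
  then have "I +>\<^bsub>self_module R\<^esub> (r \<odot>\<^bsub>self_module R\<^esub> s) = \<zero>\<^bsub>quotient_module (self_module R) I\<^esub>"
    using \<pi>(3) submoduleD(6)[OF S IS] by blast
  finally show ?thesis .
qed

text \<open>Uses \<open>int (Suc n)\<close> for the neighbouring degree, to match the natural-number
  indices of the double complex.\<close>

lemma ext_module_fg_iff:
  assumes L: "module R L" and N: "module R N"
  shows "fin_gen_module R (Ext R n L N) \<longleftrightarrow> fg_over R (hom_module R (res R L (int n)) N)
    (cocycles R (res R L (int (Suc n))) (res R L (int n)) (res_diff R L (int (Suc n))) N)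
    (coboundaries R (res R L (int n)) (res R L (int n - 1)) (res_diff R L (int n)) N)"
proof -
  have R: "cring R" using L by (simp add: module_def)
  have e: "int n + 1 = int (Suc n)" by simp
  show ?thesis
    unfolding Ext_def cocycles_def coboundaries_def e[symmetric]
    by (rule fin_gen_hom_cohomology_iff(5)[where F = "res R L" and d = "res_diff R L", OF res_module[OF R] N res_diff_linear[OF R] res_diff_diff[OF L]])
qed

theorem corollary2p7:
  fixes A :: "('a, 'r) ring_scheme"
    and \<aa> :: "'a set"
    and xs :: "'a list"
    and M :: "('a, 'm, 's) module_scheme"
  assumes "cring A"
    and "noetherian_ring A"
    and "ideal \<aa> A"
    and "set xs \<subseteq> \<aa>"
    and "module A M"
    and "\<And>i :: int. M0_cof A \<aa> (koszul_cohomology A xs M i)"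
  shows "M0_cof A \<aa> M"
proof -
  note A = assms(1,2) and M = assms(5)
  interpret M: module A M by (rule M)
  define L where "L = quotient_module (self_module A) \<aa>"
  have L: "module A L" unfolding L_def
    by (rule quotient_module_module[OF self_module_module[OF A(1)] ideal_submodule_self[OF A(1) assms(3)]])
  have xs: "set xs \<subseteq> carrier A"
    using assms(4) additive_subgroup.a_subset[OF ideal.axioms(1)[OF assms(3)]] by blast
  \<comment> \<open>Index n stands for degree n - 1. So \<open>dF n\<close> leaves degree n, which
    is index n + 1, and \<open>u q\<close> leaves K^(q-1) and is dual to the Koszul differential
    from degree q to q - 1.\<close>
  define Bs where "Bs n = res_basis_int A L (int n - 1)" for n
  define dF where "dF n = res_diff A L (int n)" for n
  define K where "K q = hom_module A (koszul A xs (int q - 1)) M" for q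
  define u :: "nat \<Rightarrow> ((nat set \<Rightarrow> 'a) \<Rightarrow> 'm) \<Rightarrow> (nat set \<Rightarrow> 'a) \<Rightarrow> 'm" where "u q = (\<lambda>f. compose (carrier (koszul A xs (int q))) f (koszul_diff A xs (int q)))" for q
  have F_eq: "free_module A (Bs n) = res A L (int n - 1)" for n by (simp add: Bs_def res_def)
  have F_Suc: "free_module A (Bs (Suc n)) = res A L (int n)" for n by (simp add: F_eq)
  have K_Suc: "K (Suc q) = hom_module A (koszul A xs (int q)) M" for q by (simp add: K_def)
  have idx: "int (Suc n) - 1 = int n" for n by simp
  note KM = koszul_module[OF A(1) xs] and kd = koszul_diff_linear[OF A(1) xs]
  note coh = fin_gen_hom_cohomology_iff[where F = "koszul A xs" and d = "koszul_diff A xs", OF KM M kd koszul_diff_diff[OF A(1) xs]]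
  interpret hom_double_complex A Bs dF K u
  proof (rule hom_double_complex.intro)
    show "cring A" "noetherian_ring A" by (rule A)+
    show "linear_on A (free_module A (Bs (Suc n))) (free_module A (Bs n)) (dF n)" for n
      unfolding F_eq idx dF_def by (rule res_diff_linear[OF A(1)])
    show "dF n (dF (Suc n) x) = \<zero>\<^bsub>free_module A (Bs n)\<^esub>" if "x \<in> carrier (free_module A (Bs (Suc (Suc n))))" for x n
      using res_diff_diff[OF L that[unfolded F_Suc]] unfolding F_eq dF_def idx .
    show "carrier (free_module A (Bs 0)) = {\<zero>\<^bsub>free_module A (Bs 0)\<^esub>}"
      unfolding F_eq by (rule res_negative[OF A(1)]) simp
    show Km: "module A (K q)" for q unfolding K_def by (rule hom_module_module[OF KM M])
    show "linear_on A (K q) (K (Suc q)) (u q)" for q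
      unfolding K_Suc unfolding K_def u_def by (rule hom_precompose_linear[OF KM KM M kd])
    show "u (Suc q) (u q f) = \<zero>\<^bsub>K (Suc (Suc q))\<^esub>" if f: "f \<in> carrier (K q)" for f q
    proof -
      have "u q f \<in> (\<lambda>g. compose (carrier (koszul A xs (int q))) g (koszul_diff A xs (int q))) `
          linear_maps A (koszul A xs (int q - 1)) M"
        using f unfolding u_def K_def hom_module_simps(1) by blast
      then have "compose (carrier (koszul A xs (int q + 1))) (u q f) (koszul_diff A xs (int q + 1)) =
          \<zero>\<^bsub>hom_module A (koszul A xs (int q + 1)) M\<^esub>"
        using coh(3)[of "int q"] by blast
      moreover have "int q + 1 = int (Suc q)" by simp
      ultimately show ?thesis unfolding K_Suc u_def[of "Suc q"] by simp
    qed
    have "carrier (koszul A xs (int 0 - 1)) = {\<zero>\<^bsub>koszul A xs (int 0 - 1)\<^esub>}"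
      by (rule koszul_negative[OF A(1) xs]) simp
    then show "carrier (K 0) = {\<zero>\<^bsub>K 0\<^esub>}"
      unfolding K_def by (intro hom_trivial KM M) simp
  qed
  \<comment> \<open>Because of the shift, the kernel at index \<open>Suc q\<close> modulo the image
    from index \<open>q\<close> is the Koszul cohomology in degree q.\<close>
  have E: "E2_finite n q" for n q
  proof (rule E2_finiteI)
    let ?Q = "koszul_cohomology A xs M (int q)"
    let ?Q' = "quotient_module (K (Suc q)\<lparr>carrier := {x \<in> carrier (K (Suc q)). u (Suc q) x = \<zero>\<^bsub>K (Suc (Suc q))\<^esub>}\<rparr>)
       (u q ` carrier (K q))"
    have e: "int q + 1 = int (Suc q)" by simp
    have Q: "?Q = ?Q'"
      using coh(4)[of "int q"]
      unfolding koszul_cohomology_def K_Suc unfolding K_def u_def hom_module_simps(1) e .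
    have "module A ?Q" "fin_gen_module A (Ext A n L ?Q)"
      using assms(6)[of "int q"] unfolding M0_cof_def L_def by blast+
    then show "fg_over A (hom_module A (free_module A (Bs (Suc n))) ?Q')
      (cocycles A (free_module A (Bs (Suc (Suc n)))) (free_module A (Bs (Suc n))) (dF (Suc n)) ?Q')
      (coboundaries A (free_module A (Bs (Suc n))) (free_module A (Bs n)) (dF n) ?Q')"
      using ext_module_fg_iff[OF L] unfolding Q F_Suc unfolding F_eq dF_def by blast
  qed
  have K_dual: "K q = hom_module A (free_module A (koszul_basis xs (int q - 1))) M" for q
    by (simp add: K_def koszul_def)
  have K1_dual: "K (Suc 0) = hom_module A (free_module A (koszul_basis xs 0)) M"
    by (simp add: K_def koszul_def)
  \<comment> \<open>K^0 has the single component \<open>{}\<close>, so evaluating there passes from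
    K^0 to \<open>M\<close>.\<close>
  have to_M: "fg_over A (hom_module A (free_module A (Bs (Suc n))) M)
      (cocycles A (free_module A (Bs (Suc (Suc n)))) (free_module A (Bs (Suc n))) (dF (Suc n)) M)
      (coboundaries A (free_module A (Bs (Suc n))) (free_module A (Bs n)) (dF n) M)"
    if fin: "V_finite n (Suc 0)" for n
  proof (rule row_cohomology_of_dual[OF M, of "{}" "koszul_basis xs 0"])
    show "{} \<in> koszul_basis xs 0" using koszul_basis_0[OF A(1) xs] by simp
  qed (use fin[unfolded V_finite_def kerV_eq imV_eq, unfolded K1_dual] in simp_all)
  have "V_finite n (Suc 0)" for n
  proof (rule V_finite_first_column[OF E])
    \<comment> \<open>The transfer from K^0 to K^q goes through \<open>M\<close>.\<close>
    fix n q assume "V_finite n (Suc 0)"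
    from row_cohomology_dual[OF M finite_koszul_basis[OF A(1) xs] to_M[OF this]] show "V_finite n (Suc q)"
      unfolding V_finite_def kerV_eq imV_eq unfolding K_dual .
  next
    fix n c assume c: "c \<in> kerV (Suc n) (Suc 0)"
    let ?c = "compose (carrier (free_module A (Bs (Suc n)))) (u (Suc 0)) c"
    have cl: "c \<in> linear_maps A (res A L (int n)) (K (Suc 0))"
      and c0: "\<And>y. y \<in> carrier (res A L (int (Suc n))) \<Longrightarrow> c (dF (Suc n) y) = \<zero>\<^bsub>K (Suc 0)\<^esub>"
      using cocycles_iff[OF F[of "Suc (Suc n)"] K[of "Suc 0"] dF[of "Suc n"], THEN iffD1, OF c[unfolded kerV_eq]]
      unfolding F_Suc by blast+
    have uc: "?c \<in> linear_maps A (free_module A (Bs (Suc n))) (K (Suc (Suc 0)))"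
      unfolding F_Suc by (rule compose_linear[OF res_module[OF A(1)] linear_mapsD(1)[OF cl]
          u])
    have ev0: "{} \<in> koszul_basis xs 0" using koszul_basis_0[OF A(1) xs] by simp
    note b0 = basis_elem_in[OF A(1) ev0, folded koszul_def]
    \<comment> \<open>The only component of \<open>c\<close>, a cocycle with values in
      \<open>M\<close>.\<close>
    let ?f = "compose (carrier (res A L (int n))) (\<lambda>g. g (basis_elem A {})) c"
    have f: "?f \<in> linear_maps A (res A L (int n)) M"
      by (rule compose_linear[OF res_module[OF A(1)] linear_mapsD(1)[OF cl] evaluation_linear[OF M ev0, folded K1_dual]])
    have f0: "?f (res_diff A L (int n + 1) y) = \<zero>\<^bsub>M\<^esub>" if y: "y \<in> carrier (res A L (int n + 1))" for y
    proof -
      have e: "int n + 1 = int (Suc n)" by simp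
      have "res_diff A L (int n + 1) y \<in> carrier (res A L (int n))"
        using linear_onD(1)[OF res_diff_linear[OF A(1)] y] by simp
      moreover have "c (res_diff A L (int n + 1) y) = \<zero>\<^bsub>K (Suc 0)\<^esub>"
        using c0[of y] y unfolding e dF_def by simp
      ultimately show ?thesis using b0 by (simp add: compose_apply K_Suc hom_module_simps)
    qed
    show "?c \<in> imV n (Suc (Suc 0))"
      unfolding imV_eq K_Suc[of "Suc 0"] koszul_def
    \<comment> \<open>It suffices to find a primitive of each component of \<open>?c\<close>; the
      component at {j} is the multiple of \<open>?f\<close> by the entry x_j.\<close>
    proof (rule row_coboundary_into_dual[OF M])
      show "?c \<in> linear_maps A (free_module A (Bs (Suc n))) (hom_module A (free_module A (koszul_basis xs (int (Suc 0)))) M)"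
        using uc unfolding K_Suc koszul_def .
      fix S assume S: "S \<in> koszul_basis xs (int (Suc 0))"
      then have S1: "S \<in> koszul_basis xs 1" by simp
      obtain j where j: "j < length xs" "S = {j}"
        "koszul_diff A xs 1 (basis_elem A S) = xs ! j \<odot>\<^bsub>koszul A xs 0\<^esub> basis_elem A {}"
        using koszul_basis_1[OF A(1) xs S1] by blast
      have x: "xs ! j \<in> \<aa>" "xs ! j \<in> carrier A" using j(1) assms(4) xs by (meson nth_mem subsetD)+
      have bS: "basis_elem A S \<in> carrier (koszul A xs 1)" using basis_elem_in[OF A(1) S1] by (simp add: koszul_def)
      have ann: "xs ! j \<odot>\<^bsub>L\<^esub> l = \<zero>\<^bsub>L\<^esub>" if "l \<in> carrier L" for l
        using ideal_annihilates_quotient[OF A(1) assms(3) x(1)] that unfolding L_def .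
      have val: "?c y (basis_elem A S) = xs ! j \<odot>\<^bsub>M\<^esub> ?f y" if y: "y \<in> carrier (res A L (int n))" for y
      proof -
        have cy: "c y \<in> linear_maps A (koszul A xs 0) M"
          using linear_mapsD(3)[OF cl y] by (simp add: K_Suc hom_module_simps)
        have "?c y (basis_elem A S) = c y (koszul_diff A xs 1 (basis_elem A S))"
          using y bS by (simp add: compose_apply F_Suc u_def)
        also have "\<dots> = xs ! j \<odot>\<^bsub>M\<^esub> c y (basis_elem A {})"
          unfolding j(3) using linear_onD(3)[OF linear_mapsD(1)[OF cy] x(2)] b0 by simp
        finally show ?thesis using y by (simp add: compose_apply)
      qed
      \<comment> \<open>x_j lies in the ideal and so annihilates \<open>L\<close>; hence its
        multiple of the cocycle \<open>?f\<close> is a coboundary.\<close>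
      from res_cocycle_scalar[OF L M x(2) ann f f0]
      show "\<exists>g\<in>linear_maps A (free_module A (Bs n)) M. \<forall>y\<in>carrier (free_module A (Bs (Suc n))). ?c y (basis_elem A S) = g (dF n y)"
        unfolding F_Suc unfolding F_eq dF_def using val by (simp add: F_Suc)
    qed
  qed
  from to_M[OF this] have "fin_gen_module A (Ext A n L M)" for n
    unfolding ext_module_fg_iff[OF L M] F_Suc unfolding F_eq dF_def .
  then show ?thesis unfolding M0_cof_def L_def using M by blast
qed

end
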